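(* Let $\kappa>0$, $s\ge2$, let $X=\{x_1,\dots,x_s\}\subset\mathbb R^3$ be a set of $s$ distinct points with minimum separation $\delta_X$, and let $\rho>0$ with $\bigcup_{j}\overline{B_\rho(x_j)}\subset B_1(0)$, $\rho\le\delta_X/2$, $\gamma:=\kappa\rho$, $\mu_X:=\frac92\frac{s^{2/3}}{\kappa\delta_X}<1$. Let $\widetilde{\mathcal U}$ be an $s$-dimensional subspace of $\mathcal H$, $\varepsilon_{\rm sub}:=\|P_{\widetilde{\mathcal U}}-P_{\mathcal U_X}\|_2$, and let $\eta\ge\varepsilon_{\rm sub}$ and $0<\delta_\star\le\delta_X$. With $C_2$, $A_\gamma$ as in the context, let $\Delta_\star,A_\star$ be numbers with $$C_2+\left(\frac2{\sqrt5}+\frac23\right)\eta\le\Delta_\star<\frac23,\qquad 0<A_\star\le A_\gamma,$$ put $c_\star^\pm:=\frac23\pm\Delta_\star$, $\varepsilon_\star:=\frac{2\eta}{\sqrt3c_\star^-\kappa}$, and assume $$\eta<\frac{\sqrt3}2\gamma c_\star^-,\qquad\eta<\sin\left(\tfrac12\arcsin\sqrt{A_\star}\right).$$ Put $\tau_\star:=\sin^2(\arcsin\sqrt{A_\star}-\arcsin\eta)$, $h_\star:=\frac{3}{2\kappa^2}$, $r_\star:=\frac32\Delta_\star<1$. Let $G\subset B_1(0)$ be a finite set with $$\sup_{z\in B_1(0)}\min_{g\in G}|z-g|<\min\left\{\rho-\varepsilon_\star,\ \frac{\sqrt3}{2\kappa}(\tau_\star-\eta^2)\right\},$$ and let the iteration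 number $N$ and clustering radius $r_{\rm cl}$ satisfy $$8\rho r_\star^N<\delta_\star-2\varepsilon_\star,\qquad 4\rho r_\star^N<r_{\rm cl}<\delta_\star-2\varepsilon_\star-4\rho r_\star^N .$$ Let $G_\star:=\{g\in G:\widetilde q(g)<\tau_\star\}$ be the set of accepted points, and for each $g\in G_\star$ let $z^{(0)}=g$, $z^{(n+1)}=z^{(n)}-h_\star\nabla\widetilde q(z^{(n)})$. Call $B_\rho(x_j)$ the $j$-th well. Then: (i) $G_\star\subset\bigcup_{j=1}^sB_\rho(x_j)$; (ii) every well contains at least one point of $G_\star$; (iii) for every $g\in G_\star$, the iterates $z^{(n)}$ remain in one well and converge to the unique minimizer $\widetilde x_j$ of $\widetilde q$ in that well; (iv) the set of distinct limits of these trajectories is precisely $\{\widetilde x_1,\dots,\widetilde x_s\}$, and $$d_{\rm match}(\{\widetilde x_1,\dots,\widetilde x_s\},X)\le\varepsilon_\star=\frac{2\eta}{\sqrt3c_\star^-\kappa}.$$ Any trajectory started at a point of $G_\star$ in the $j$-th well satisfies $|z^{(N)}-\widetilde x_j|\le2\rho\,r_\star^N$. Moreover, the finite procedure which collects all endpoints $z^{(N)}$ (over $g\in G_\star$), joins two endpoints when their distance is less than $r_{\rm cl}$, and returns one (arbitrary) representative from each connected component of the resulting graph, returns exactly $s$ representatives $\widehat X_N$, and $$d_{\rm match}(\widehat X_N,X)\le\varepsilon_\star+2\rho r_\star^N .$$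
   Context: $B_r(x)$ is the open Euclidean ball in $\mathbb R^3$. $\mathcal H=L^2(\mathbb S^2,\frac{d\omega}{4\pi})$ (complex), with norm and operator norm $\|\cdot\|_2$; $\varphi_z(\omega)=e^{i\kappa\omega\cdot z}$; $\mathcal U_X=\operatorname{span}\{\varphi_{x_1},\dots,\varphi_{x_s}\}$; $P_{\mathcal V}$ is the orthogonal projector onto $\mathcal V$; $\widetilde q(z)=1-\|P_{\widetilde{\mathcal U}}\varphi_z\|_2^2$. For $s$-point sets, $d_{\rm match}(X,Y)=\min_{\pi\in S_s}\max_{j}|x_j-y_{\pi(j)}|$. Constants: $c_\nu=\sup_{t>0}|t\cos t-\sin t|/t$, $\nu_X=\frac{64c_\nu^2}{27}\frac{\mu_X^2}{s}$, $$C_1=\frac{\gamma^2}{9}+\nu_X+\sqrt{1+\nu_X}\sqrt{\left(\tfrac13+\tfrac{\gamma^2}{10}\right)^2+4\nu_X},\qquad C_2=\frac{8}{15}\gamma^2+6\nu_X+\frac{2\mu_X}{1-\mu_X}C_1,$$ $b_\gamma=1-\sup_{t\ge\gamma}(\sin t/t)^2$, $A_\gamma=\frac{b_\gamma-\mu_X-\nu_X}{1-\mu_X}$. *)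

theory Defs
  imports "HOL-Probability.Probability"
begin

section \<open>The normalized surface measure on the unit sphere\<close>

text \<open>
  The normalized surface measure on the unit sphere, as a Borel measure on the ambient space
  \<open>real ^ 3\<close>: the image of the uniform distribution on the unit ball under radial projection
  (polar coordinates). The lemmas below show that it is the rotation-invariant
  probability measure concentrated on the sphere.
\<close>

definition sphere_measure :: "(real ^ 3) measure" where
  "sphere_measure = distr (uniform_measure lborel (ball 0 1)) borel (\<lambda>x. x /\<^sub>R norm x)"

lemma sets_sphere_measure [measurable_cong, simp]: "sets sphere_measure = sets borel"
  by (simp add: sphere_measure_def)

lemma space_sphere_measure [simp]: "space sphere_measure = UNIV"
  by (simp add: sphere_measure_def)

lemma emeasure_ball_pos_finite:
  "emeasure lborel (ball (0 :: real ^ 3) 1) \<noteq> 0" "emeasure lborel (ball (0 :: real ^ 3) 1) \<noteq> \<infinity>"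
proof -
  show "emeasure lborel (ball (0 :: real ^ 3) 1) \<noteq> \<infinity>"
    using emeasure_lborel_ball_finite[of "0 :: real ^ 3" 1] by simp
  show "emeasure lborel (ball (0 :: real ^ 3) 1) \<noteq> 0"
    using content_ball_pos[of 1 "0 :: real ^ 3"] by (auto simp: measure_def)
qed

lemma prob_space_sphere_measure: "prob_space sphere_measure"
  unfolding sphere_measure_def
  by (intro prob_space.prob_space_distr prob_space_uniform_measure emeasure_ball_pos_finite) simp_all

interpretation sphere_measure: prob_space sphere_measure
  by (rule prob_space_sphere_measure)

lemma AE_sphere_measure_norm: "AE \<omega> in sphere_measure. norm \<omega> = 1"
proof -
  have "AE x in lborel. x \<noteq> (0 :: real ^ 3)"
    by (rule AE_lborel_singleton)
  then have "AE x in uniform_measure lborel (ball (0 :: real ^ 3) 1). norm (x /\<^sub>R norm x) = 1"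
    by (intro AE_uniform_measureI) (auto elim: eventually_mono)
  then show ?thesis
    unfolding sphere_measure_def by (subst AE_distr_iff) auto
qed

lemma sphere_measure_rotation_invariant:
  assumes f: "orthogonal_transformation f"
  shows "distr sphere_measure borel f = sphere_measure"
proof (rule measure_eqI)
  fix A assume "A \<in> sets (distr sphere_measure borel f)"
  then have A: "A \<in> sets borel" by simp
  have lin: "linear f" and nrm: "\<And>x. norm (f x) = norm x"
    using f by (auto simp: orthogonal_transformation)
  have cf: "continuous_on UNIV f"
    using lin by (simp add: linear_continuous_on linear_linear)
  have fm [measurable]: "f \<in> borel_measurable borel"
    by (rule borel_measurable_continuous_onI[OF cf])
  have bij: "bij f" by (rule orthogonal_transformation_bij[OF f])
  let ?r = "\<lambda>x :: real ^ 3. x /\<^sub>R norm x"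
  have em: "emeasure sphere_measure B =
      emeasure lborel (ball 0 1 \<inter> ?r -` B) / emeasure lborel (ball (0 :: real ^ 3) 1)"
    if [measurable]: "B \<in> sets borel" for B
  proof -
    have "?r -` B \<in> sets borel"
      using measurable_sets[of ?r borel borel B] by simp
    then show ?thesis
      unfolding sphere_measure_def by (simp add: emeasure_distr)
  qed
  have C [measurable]: "?r -` A \<in> sets borel"
    using measurable_sets[of ?r borel borel A] A by simp
  let ?D = "ball 0 1 \<inter> ?r -` A"
  have D: "?D \<in> sets borel" by simp
  have eq: "f ` (ball 0 1 \<inter> ?r -` (f -` A)) = ?D"
  proof -
    have "ball 0 1 \<inter> ?r -` (f -` A) = f -` ?D"
      using nrm by (auto simp: linear_cmul[OF lin])
    moreover have "f ` (f -` ?D) = ?D"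
      using bij by (intro surj_image_vimage_eq bij_is_surj)
    ultimately show ?thesis by simp
  qed
  have E: "ball 0 1 \<inter> ?r -` (f -` A) \<in> sets borel"
  proof -
    have "f -` A \<in> sets borel" using measurable_sets[OF fm A] by simp
    then have "?r -` (f -` A) \<in> sets borel"
      using measurable_sets[of ?r borel borel "f -` A"] by simp
    then show ?thesis by simp
  qed
  have lm: "ball 0 1 \<inter> ?r -` B \<in> lmeasurable" if "ball 0 1 \<inter> ?r -` B \<in> sets borel" for B
    by (rule fmeasurableI2[of "ball 0 1"])  (use that in auto)
  have "emeasure lborel (ball 0 1 \<inter> ?r -` (f -` A)) = emeasure lborel ?D"
  proof -
    have "measure lebesgue (f ` (ball 0 1 \<inter> ?r -` (f -` A))) = measure lebesgue (ball 0 1 \<inter> ?r -` (f -` A))"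
      by (rule measure_orthogonal_image[OF f lm[OF E]])
    then have "measure lebesgue ?D = measure lebesgue (ball 0 1 \<inter> ?r -` (f -` A))"
      unfolding eq .
    then have "emeasure lebesgue ?D = emeasure lebesgue (ball 0 1 \<inter> ?r -` (f -` A))"
      by (simp only: emeasure_eq_measure2[OF lm[OF E]] emeasure_eq_measure2[OF lm[OF D]])
    then show ?thesis using D E by simp
  qed
  then show "emeasure (distr sphere_measure borel f) A = emeasure sphere_measure A"
    using A measurable_sets[OF fm A] by (simp add: emeasure_distr em)
qed simp


section \<open>The complex Hilbert space of square-integrable functions on the sphere\<close>

definition square_integrable :: "(real ^ 3 \<Rightarrow> complex) \<Rightarrow> bool" where
  "square_integrable f \<longleftrightarrow>
     f \<in> borel_measurable sphere_measure \<and> integrable sphere_measure (\<lambda>\<omega>. (cmod (f \<omega>))\<^sup>2)"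

definition sphere_eq :: "(real ^ 3 \<Rightarrow> complex) \<Rightarrow> (real ^ 3 \<Rightarrow> complex) \<Rightarrow> bool" where
  "sphere_eq f g \<longleftrightarrow>
     square_integrable f \<and> square_integrable g \<and> (AE \<omega> in sphere_measure. f \<omega> = g \<omega>)"

lemma square_integrable_measurable: "square_integrable f \<Longrightarrow> f \<in> borel_measurable borel"
  by (simp add: square_integrable_def measurable_cong_sets[OF sets_sphere_measure refl])

lemma measurable_cnj [measurable (raw)]:
  "g \<in> borel_measurable M \<Longrightarrow> (\<lambda>x. cnj (g x)) \<in> borel_measurable M"
  by (rule borel_measurable_continuous_on[OF continuous_on_cnj[OF continuous_on_id]])

lemma integral_mult_cnj_self:
  "(\<integral>\<omega>. f \<omega> * cnj (f \<omega>) \<partial>M) = complex_of_real (\<integral>\<omega>. (cmod (f \<omega>))\<^sup>2 \<partial>M)"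
  by (simp only: complex_norm_square[symmetric] integral_complex_of_real)

lemma square_integrable_zero: "square_integrable (\<lambda>\<omega>. 0)"
  by (simp add: square_integrable_def)

lemma square_integrable_add:
  assumes "square_integrable f" "square_integrable g"
  shows "square_integrable (\<lambda>\<omega>. f \<omega> + g \<omega>)"
proof -
  note [measurable] = assms[THEN square_integrable_measurable]
  have "integrable sphere_measure (\<lambda>\<omega>. (cmod (f \<omega> + g \<omega>))\<^sup>2)"
  proof (rule Bochner_Integration.integrable_bound)
    show "integrable sphere_measure (\<lambda>\<omega>. 2 * (cmod (f \<omega>))\<^sup>2 + 2 * (cmod (g \<omega>))\<^sup>2)"
      using assms by (simp add: square_integrable_def)
    show "AE \<omega> in sphere_measure.
        norm ((cmod (f \<omega> + g \<omega>))\<^sup>2) \<le> norm (2 * (cmod (f \<omega>))\<^sup>2 + 2 * (cmod (g \<omega>))\<^sup>2)"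
    proof (rule AE_I2)
      fix \<omega>
      have "(cmod (f \<omega> + g \<omega>))\<^sup>2 \<le> (cmod (f \<omega>) + cmod (g \<omega>))\<^sup>2"
        by (intro power_mono norm_triangle_ineq) simp
      also have "\<dots> \<le> 2 * (cmod (f \<omega>))\<^sup>2 + 2 * (cmod (g \<omega>))\<^sup>2"
        using sum_squares_bound[of "cmod (f \<omega>)" "cmod (g \<omega>)"] by (simp add: power2_sum)
      finally show "norm ((cmod (f \<omega> + g \<omega>))\<^sup>2) \<le> norm (2 * (cmod (f \<omega>))\<^sup>2 + 2 * (cmod (g \<omega>))\<^sup>2)"
        by simp
    qed
  qed measurable
  then show ?thesis by (simp add: square_integrable_def)
qed

lemma square_integrable_scale:
  assumes "square_integrable f"
  shows "square_integrable (\<lambda>\<omega>. c * f \<omega>)"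
proof -
  note [measurable] = assms[THEN square_integrable_measurable]
  have "(\<lambda>\<omega>. c * f \<omega>) \<in> borel_measurable sphere_measure"
    by measurable
  with assms show ?thesis
    by (simp add: square_integrable_def norm_mult power_mult_distrib)
qed

lemma square_integrable_mult_cnj:
  assumes "square_integrable f" "square_integrable g"
  shows "integrable sphere_measure (\<lambda>\<omega>. f \<omega> * cnj (g \<omega>))"
proof (rule Bochner_Integration.integrable_bound)
  note [measurable] = assms[THEN square_integrable_measurable]
  show "integrable sphere_measure (\<lambda>\<omega>. (cmod (f \<omega>))\<^sup>2 + (cmod (g \<omega>))\<^sup>2)"
    using assms by (simp add: square_integrable_def)
  show "(\<lambda>\<omega>. f \<omega> * cnj (g \<omega>)) \<in> borel_measurable sphere_measure"
    by measurable
  show "AE \<omega> in sphere_measure. norm (f \<omega> * cnj (g \<omega>)) \<le> norm ((cmod (f \<omega>))\<^sup>2 + (cmod (g \<omega>))\<^sup>2)"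
  proof (rule AE_I2)
    fix \<omega>
    have "0 \<le> cmod (f \<omega>) * cmod (g \<omega>)" by simp
    then have "cmod (f \<omega>) * cmod (g \<omega>) \<le> (cmod (f \<omega>))\<^sup>2 + (cmod (g \<omega>))\<^sup>2"
      using sum_squares_bound[of "cmod (f \<omega>)" "cmod (g \<omega>)"] by linarith
    then show "norm (f \<omega> * cnj (g \<omega>)) \<le> norm ((cmod (f \<omega>))\<^sup>2 + (cmod (g \<omega>))\<^sup>2)"
      by (simp add: norm_mult)
  qed
qed

text \<open>
  Square-integrable functions modulo almost-everywhere equality. The type carries the complex
  structure \<open>cscale\<close>, \<open>cinner\<close> (linear in the first argument); its
  \<open>real_inner\<close> structure is the real part of \<open>cinner\<close>, which has the same norm, so that
  \<open>onorm\<close> is the usual operator norm also for complex-linear operators.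
\<close>

quotient_type sphere_L2 = "real ^ 3 \<Rightarrow> complex" / partial: sphere_eq
proof (rule part_equivpI)
  show "\<exists>f. sphere_eq f f"
    using square_integrable_zero by (auto simp: sphere_eq_def)
  show "symp sphere_eq"
    by (rule sympI) (auto simp: sphere_eq_def elim: eventually_mono)
  show "transp sphere_eq"
    by (rule transpI) (auto simp: sphere_eq_def elim: eventually_elim2)
qed

lift_definition cscale :: "complex \<Rightarrow> sphere_L2 \<Rightarrow> sphere_L2" is "\<lambda>c f \<omega>. c * f \<omega>"
  by (auto simp: sphere_eq_def square_integrable_scale elim: eventually_mono)

lift_definition cinner :: "sphere_L2 \<Rightarrow> sphere_L2 \<Rightarrow> complex"
  is "\<lambda>f g. \<integral>\<omega>. f \<omega> * cnj (g \<omega>) \<partial>sphere_measure"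
proof -
  fix f f' g g' assume "sphere_eq f f'" "sphere_eq g g'"
  then have *: "AE \<omega> in sphere_measure. f \<omega> = f' \<omega>" "AE \<omega> in sphere_measure. g \<omega> = g' \<omega>"
    and [measurable]: "f \<in> borel_measurable borel" "f' \<in> borel_measurable borel"
      "g \<in> borel_measurable borel" "g' \<in> borel_measurable borel"
    by (auto simp: sphere_eq_def square_integrable_measurable)
  show "(\<integral>\<omega>. f \<omega> * cnj (g \<omega>) \<partial>sphere_measure) = (\<integral>\<omega>. f' \<omega> * cnj (g' \<omega>) \<partial>sphere_measure)"
  proof (rule integral_cong_AE)
    show "AE \<omega> in sphere_measure. f \<omega> * cnj (g \<omega>) = f' \<omega> * cnj (g' \<omega>)"
      using * by eventually_elim simp
  qed measurable
qed

instantiation sphere_L2 :: real_inner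
begin

lift_definition zero_sphere_L2 :: sphere_L2 is "\<lambda>\<omega>. 0"
  by (simp add: sphere_eq_def square_integrable_zero)

lift_definition plus_sphere_L2 :: "sphere_L2 \<Rightarrow> sphere_L2 \<Rightarrow> sphere_L2" is "\<lambda>f g \<omega>. f \<omega> + g \<omega>"
  by (auto simp: sphere_eq_def square_integrable_add elim: eventually_elim2)

definition scaleR_sphere_L2 :: "real \<Rightarrow> sphere_L2 \<Rightarrow> sphere_L2" where
  "scaleR_sphere_L2 r f = cscale (complex_of_real r) f"

definition uminus_sphere_L2 :: "sphere_L2 \<Rightarrow> sphere_L2" where
  "uminus_sphere_L2 f = cscale (- 1) f"

definition minus_sphere_L2 :: "sphere_L2 \<Rightarrow> sphere_L2 \<Rightarrow> sphere_L2" where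
  "minus_sphere_L2 f g = f + (- g)"

definition inner_sphere_L2 :: "sphere_L2 \<Rightarrow> sphere_L2 \<Rightarrow> real" where
  "inner_sphere_L2 f g = Re (cinner f g)"

definition norm_sphere_L2 :: "sphere_L2 \<Rightarrow> real" where
  "norm_sphere_L2 f = sqrt (Re (cinner f f))"

definition dist_sphere_L2 :: "sphere_L2 \<Rightarrow> sphere_L2 \<Rightarrow> real" where
  "dist_sphere_L2 f g = norm (f - g)"

definition sgn_sphere_L2 :: "sphere_L2 \<Rightarrow> sphere_L2" where
  "sgn_sphere_L2 f = scaleR (inverse (norm f)) f"

definition uniformity_sphere_L2 :: "(sphere_L2 \<times> sphere_L2) filter" where
  "uniformity_sphere_L2 = (INF e\<in>{0 <..}. principal {(x, y). dist x y < e})"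

definition open_sphere_L2 :: "sphere_L2 set \<Rightarrow> bool" where
  "open_sphere_L2 U \<longleftrightarrow> (\<forall>x\<in>U. eventually (\<lambda>(x', y). x' = x \<longrightarrow> y \<in> U) uniformity)"

instance
proof
  fix f g h :: sphere_L2 and a b :: real
  show "f + g + h = f + (g + h)"
    by transfer (auto simp: sphere_eq_def square_integrable_add add.assoc)
  show "f + g = g + f"
    by transfer (auto simp: sphere_eq_def square_integrable_add add.commute)
  show "0 + f = f"
    by transfer (auto simp: sphere_eq_def)
  show "- f + f = 0"
    unfolding uminus_sphere_L2_def
    by transfer (auto simp: sphere_eq_def square_integrable_zero)
  show "f - g = f + - g"
    by (simp add: minus_sphere_L2_def)
  show "a *\<^sub>R (f + g) = a *\<^sub>R f + a *\<^sub>R g"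
    unfolding scaleR_sphere_L2_def
    by transfer (auto simp: sphere_eq_def distrib_left
        intro!: square_integrable_add square_integrable_scale)
  show "(a + b) *\<^sub>R f = a *\<^sub>R f + b *\<^sub>R f"
    unfolding scaleR_sphere_L2_def
    by transfer (auto simp: sphere_eq_def distrib_right
        intro!: square_integrable_add square_integrable_scale)
  show "a *\<^sub>R b *\<^sub>R f = (a * b) *\<^sub>R f"
    unfolding scaleR_sphere_L2_def
    by transfer (simp add: sphere_eq_def mult.assoc square_integrable_scale)
  show "1 *\<^sub>R f = f"
    unfolding scaleR_sphere_L2_def by transfer (auto simp: sphere_eq_def)
  show "dist f g = norm (f - g)"
    by (simp add: dist_sphere_L2_def)
  show "sgn f = scaleR (inverse (norm f)) f"
    by (simp add: sgn_sphere_L2_def)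
  show "inner f g = inner g f"
  proof -
    have "Re (cinner f g) = Re (cinner g f)"
    proof transfer
      fix f g assume "sphere_eq f f" "sphere_eq g g"
      then have fg: "square_integrable f" "square_integrable g"
        by (auto simp: sphere_eq_def)
      show "Re (\<integral>\<omega>. f \<omega> * cnj (g \<omega>) \<partial>sphere_measure) = Re (\<integral>\<omega>. g \<omega> * cnj (f \<omega>) \<partial>sphere_measure)"
        using fg by (simp add: integral_Re[symmetric] square_integrable_mult_cnj mult.commute)
    qed
    then show ?thesis by (simp add: inner_sphere_L2_def)
  qed
  show "inner (f + g) h = inner f h + inner g h"
  proof -
    have "cinner (f + g) h = cinner f h + cinner g h"
      by transfer (auto simp: sphere_eq_def distrib_right square_integrable_mult_cnj)
    then show ?thesis by (simp add: inner_sphere_L2_def)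
  qed
  show "inner (a *\<^sub>R f) g = a * inner f g"
  proof -
    have "cinner (a *\<^sub>R f) g = complex_of_real a * cinner f g"
      unfolding scaleR_sphere_L2_def by transfer (simp add: mult.assoc)
    then show ?thesis by (simp add: inner_sphere_L2_def)
  qed
  have sq: "Re (\<integral>\<omega>. F \<omega> * cnj (F \<omega>) \<partial>sphere_measure) = (\<integral>\<omega>. (cmod (F \<omega>))\<^sup>2 \<partial>sphere_measure)" for F
    by (simp only: integral_mult_cnj_self Re_complex_of_real)
  show "0 \<le> inner f f"
    unfolding inner_sphere_L2_def by transfer (simp add: sq)
  show "inner f f = 0 \<longleftrightarrow> f = 0"
    unfolding inner_sphere_L2_def
  proof transfer
    fix F assume "sphere_eq F F"
    then have F: "square_integrable F" by (simp add: sphere_eq_def)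
    show "Re (\<integral>\<omega>. F \<omega> * cnj (F \<omega>) \<partial>sphere_measure) = 0 \<longleftrightarrow> sphere_eq F (\<lambda>\<omega>. 0)"
      unfolding sq using F
      by (subst integral_nonneg_eq_0_iff_AE)
        (auto simp: square_integrable_def sphere_eq_def square_integrable_zero)
  qed
  show "norm f = sqrt (inner f f)"
    by (simp add: norm_sphere_L2_def inner_sphere_L2_def)
qed (simp_all add: uniformity_sphere_L2_def open_sphere_L2_def)

end

lemma norm_sphere_L2_abs:
  assumes "square_integrable f"
  shows "norm (abs_sphere_L2 f) = sqrt (\<integral>\<omega>. (cmod (f \<omega>))\<^sup>2 \<partial>sphere_measure)"
proof -
  have "cinner (abs_sphere_L2 f) (abs_sphere_L2 f) = (\<integral>\<omega>. f \<omega> * cnj (f \<omega>) \<partial>sphere_measure)"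
    by (rule cinner.abs_eq) (use assms in \<open>simp_all add: sphere_eq_def\<close>)
  then show ?thesis
    by (simp only: norm_sphere_L2_def integral_mult_cnj_self Re_complex_of_real)
qed

text \<open>
  Spans, subspaces and dimensions in the Hilbert space are taken over the complex numbers:
  \<open>L2.span\<close>, \<open>L2.subspace\<close> and \<open>L2.dim\<close> refer to \<open>cscale\<close>.
\<close>

global_interpretation L2: vector_space cscale
proof
  fix a b :: complex and f g :: sphere_L2
  show "cscale a (f + g) = cscale a f + cscale a g"
    by transfer (auto simp: sphere_eq_def distrib_left
        intro!: square_integrable_add square_integrable_scale)
  show "cscale (a + b) f = cscale a f + cscale b f"
    by transfer (auto simp: sphere_eq_def distrib_right
        intro!: square_integrable_add square_integrable_scale)
  show "cscale a (cscale b f) = cscale (a * b) f"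
    by transfer (simp add: sphere_eq_def mult.assoc square_integrable_scale)
  show "cscale 1 f = f"
    by transfer (auto simp: sphere_eq_def)
qed

definition orth_proj :: "sphere_L2 set \<Rightarrow> sphere_L2 \<Rightarrow> sphere_L2" where
  "orth_proj V f = (THE p. p \<in> V \<and> (\<forall>v\<in>V. cinner (f - p) v = 0))"

lift_definition plane_wave :: "real \<Rightarrow> real ^ 3 \<Rightarrow> sphere_L2"
  is "\<lambda>\<kappa> z \<omega>. exp (\<i> * complex_of_real (\<kappa> * (\<omega> \<bullet> z)))"
  by (simp add: sphere_eq_def square_integrable_def)

definition wave_span :: "real \<Rightarrow> (real ^ 3) set \<Rightarrow> sphere_L2 set" where
  "wave_span \<kappa> X = L2.span (plane_wave \<kappa> ` X)"

definition q_fun :: "real \<Rightarrow> sphere_L2 set \<Rightarrow> real ^ 3 \<Rightarrow> real" where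
  "q_fun \<kappa> U z = 1 - (norm (orth_proj U (plane_wave \<kappa> z)))\<^sup>2"


section \<open>Finite point sets, gradient descent and clustering\<close>

definition min_sep :: "(real ^ 3) set \<Rightarrow> real" where
  "min_sep X = Min {dist x y | x y. x \<in> X \<and> y \<in> X \<and> x \<noteq> y}"

text \<open>Only meaningful for nonempty finite sets of equal cardinality.\<close>

definition d_match :: "(real ^ 3) set \<Rightarrow> (real ^ 3) set \<Rightarrow> real" where
  "d_match X Y = Min {Max ((\<lambda>x. dist x (\<pi> x)) ` X) | \<pi>. bij_betw \<pi> X Y}"

definition gradient :: "(real ^ 3 \<Rightarrow> real) \<Rightarrow> real ^ 3 \<Rightarrow> real ^ 3" where
  "gradient f z = (THE D. GDERIV f z :> D)"

definition gd_iter :: "real \<Rightarrow> (real ^ 3 \<Rightarrow> real) \<Rightarrow> real ^ 3 \<Rightarrow> nat \<Rightarrow> real ^ 3" where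
  "gd_iter h f g n = ((\<lambda>z. z - h *\<^sub>R gradient f z) ^^ n) g"

text \<open>
  Connected components of the graph on \<open>E\<close> joining points at distance less than \<open>r\<close>.
\<close>

definition clusters :: "real \<Rightarrow> (real ^ 3) set \<Rightarrow> (real ^ 3) set set" where
  "clusters r E = E // {(a, b). a \<in> E \<and> b \<in> E \<and> dist a b < r}\<^sup>*"


section \<open>Constants\<close>

definition c_nu :: real where
  "c_nu = (SUP t\<in>{0<..}. \<bar>t * cos t - sin t\<bar> / t)"

definition mu_const :: "real \<Rightarrow> nat \<Rightarrow> real \<Rightarrow> real" where
  "mu_const \<kappa> s \<delta> = 9 / 2 * (real s powr (2 / 3) / (\<kappa> * \<delta>))"

definition nu_const :: "nat \<Rightarrow> real \<Rightarrow> real" where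
  "nu_const s \<mu> = 64 * c_nu\<^sup>2 / 27 * (\<mu>\<^sup>2 / real s)"

definition C1_const :: "real \<Rightarrow> real \<Rightarrow> real" where
  "C1_const \<gamma> \<nu> = \<gamma>\<^sup>2 / 9 + \<nu> + sqrt (1 + \<nu>) * sqrt ((1 / 3 + \<gamma>\<^sup>2 / 10)\<^sup>2 + 4 * \<nu>)"

definition C2_const :: "real \<Rightarrow> real \<Rightarrow> real \<Rightarrow> real" where
  "C2_const \<gamma> \<mu> \<nu> = 8 / 15 * \<gamma>\<^sup>2 + 6 * \<nu> + 2 * \<mu> / (1 - \<mu>) * C1_const \<gamma> \<nu>"

definition b_const :: "real \<Rightarrow> real" where
  "b_const \<gamma> = 1 - (SUP t\<in>{\<gamma>..}. (sin t / t)\<^sup>2)"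

definition A_const :: "real \<Rightarrow> real \<Rightarrow> real \<Rightarrow> real" where
  "A_const \<gamma> \<mu> \<nu> = (b_const \<gamma> - \<mu> - \<nu>) / (1 - \<mu>)"

end

theory Submission
  imports Defs
begin

text \<open>
  In suitable units \<open>q\<close> is \<open>Q y = 1 - \<parallel>P \<phi> y\<parallel>\<^sup>2\<close> with Hessian
  \<open>-2 (\<langle>P \<phi>\<^sub>u, \<phi>\<^sub>v\<rangle> + \<langle>P \<phi>, \<phi>\<^sub>u\<^sub>v\<rangle>)\<close>. For the span of the plane waves at the points themselves, the Gram
  matrix has entries \<open>sinc \<bar>y - z\<bar>\<close>, and counting disjoint balls bounds its off-diagonal row sums by
  \<open>\<mu>\<close> and the squared correlations with distant points by \<open>\<nu>\<close>. So near a point only the term of that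
  point matters and the Hessian is \<open>2/3\<close> times the identity up to \<open>C\<^sub>2\<close>; away from all points \<open>Q\<close> is
  at least \<open>A\<^sub>\<gamma>\<close>. Replacing the subspace costs \<open>(2 / sqrt 5 + 2 / 3) \<eta>\<close> in the Hessian and
  \<open>arcsin \<eta>\<close> in the angle. Hence the gradient step is a contraction with factor \<open>r\<^sub>\<star>\<close> in each well
  that maps the closed ball of radius \<open>\<epsilon>\<^sub>\<star>\<close> around the centre into itself, and Banach's fixed point
  theorem gives the minimizers and the convergence; the clusters are the wells.
\<close>

section \<open>Orthogonal projections in the Hilbert space\<close>

text \<open>The constants have three sources. Moments: (\<omega> . v)^2 and (\<omega> . v)^4 have
  means 1/3 and 1/5, so for unit v the first and second derivative waves have norms 1/sqrt 3 and
  1/sqrt 5. This gives the weight of \<eta> in the Hessian and bounds the gradient at a centre by 2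
  \<eta> / sqrt 3, since it is 0 for exact data. Packing: among points separated by d, the m-th
  nearest lies at distance of order m^(1/3) d, so sums of 1/dist and 1/dist^2 grow like s^(2/3) and
  s^(1/3); these are the powers in \<mu> and \<nu>. Step size: h is the inverse of the leading
  curvature (2/3) \<kappa>^2, so a step has Lipschitz constant (3/2) \<Delta>; a map with Lipschitz
  constant r that moves the centre by at most (1 - r) e preserves the closed ball of radius e, and
  solving for e gives \<epsilon>. The obstacle is that the Gram matrix is only close to the
  identity; real correlations and l2 bounds on the coefficients control its inverse without forming
  it. Second derivatives are taken along lines, so the Hessian is a bilinear form that need only be
  estimated on one unit direction at a time.\<close>

lemma cinner_add_left: "cinner (f + g) h = cinner f h + cinner g h"
  by transfer (auto simp: sphere_eq_def distrib_right square_integrable_mult_cnj)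

lemma cinner_scale_left: "cinner (cscale c f) g = c * cinner f g"
  by transfer (simp add: mult.assoc)

lemma cnj_cinner: "cnj (cinner f g) = cinner g f"
proof transfer
  fix f g assume "sphere_eq f f" "sphere_eq g g"
  have "cnj (\<integral>\<omega>. f \<omega> * cnj (g \<omega>) \<partial>sphere_measure) = (\<integral>\<omega>. cnj (f \<omega> * cnj (g \<omega>)) \<partial>sphere_measure)"
    by (rule Bochner_Integration.integral_cnj[symmetric])
  also have "\<dots> = (\<integral>\<omega>. g \<omega> * cnj (f \<omega>) \<partial>sphere_measure)"
    by (simp add: mult.commute)
  finally show "cnj (\<integral>\<omega>. f \<omega> * cnj (g \<omega>) \<partial>sphere_measure) = (\<integral>\<omega>. g \<omega> * cnj (f \<omega>) \<partial>sphere_measure)" .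
qed

lemma cinner_add_right: "cinner f (g + h) = cinner f g + cinner f h"
  by (metis cinner_add_left cnj_cinner complex_cnj_add)

lemma cinner_scale_right: "cinner f (cscale c g) = cnj c * cinner f g"
  by (metis cinner_scale_left cnj_cinner complex_cnj_mult)

lemma cinner_minus_left: "cinner (- f) g = - cinner f g"
  unfolding uminus_sphere_L2_def cinner_scale_left by simp

lemma cinner_minus_right: "cinner f (- g) = - cinner f g"
  unfolding uminus_sphere_L2_def cinner_scale_right by simp

lemma cinner_diff_left: "cinner (f - g) h = cinner f h - cinner g h"
  unfolding minus_sphere_L2_def cinner_add_left cinner_minus_left by simp

lemma cinner_diff_right: "cinner f (g - h) = cinner f g - cinner f h"
  unfolding minus_sphere_L2_def cinner_add_right cinner_minus_right by simp

lemma cinner_zero_left [simp]: "cinner 0 f = 0"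
  using cinner_diff_left[of f f f] by simp

lemma cinner_zero_right [simp]: "cinner f 0 = 0"
  using cinner_diff_right[of f f f] by simp

lemma cinner_sum_left: "cinner (\<Sum>i\<in>I. f i) g = (\<Sum>i\<in>I. cinner (f i) g)"
  by (induction I rule: infinite_finite_induct) (auto simp: cinner_add_left)

lemma cinner_self: "cinner f f = complex_of_real ((norm f)\<^sup>2)"
proof -
  have "Im (cinner f f) = 0"
    using cnj_cinner[of f f] by (simp add: complex_eq_iff)
  moreover have "Re (cinner f f) = (norm f)\<^sup>2"
    by (simp add: inner_sphere_L2_def[symmetric] power2_norm_eq_inner)
  ultimately show ?thesis by (simp add: complex_eq_iff)
qed

text \<open>Gram-Schmidt, by induction on a finite generating set: \<open>d\<close> is the part of
  the new generator orthogonal to the old span, and \<open>cscale k d\<close> is the part of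
  \<open>f\<close> along it. This way completeness of the space never enters.\<close>

lemma orth_projection_exists:
  assumes "finite B"
  shows "\<exists>p\<in>L2.span B. \<forall>v\<in>L2.span B. cinner (f - p) v = 0"
  using assms
proof (induction B arbitrary: f)
  case empty
  then show ?case by simp
next
  case (insert b B)
  obtain b0 where b0: "b0 \<in> L2.span B" "\<forall>v\<in>L2.span B. cinner (b - b0) v = 0"
    using insert.IH by blast
  obtain p where p: "p \<in> L2.span B" "\<forall>v\<in>L2.span B. cinner (f - p) v = 0"
    using insert.IH by blast
  define d where "d = b - b0"
  define k where "k = cinner (f - p) d / cinner d d"
  have sub: "L2.span B \<subseteq> L2.span (insert b B)"
    by (rule L2.span_mono) auto
  have bin: "b \<in> L2.span (insert b B)" by (simp add: L2.span_base)
  have din: "d \<in> L2.span (insert b B)"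
    unfolding d_def using b0(1) sub bin by (intro L2.span_diff) auto
  \<comment> \<open>If \<open>b\<close> already lies in the span of \<open>B\<close>, then
    \<open>d = 0\<close> and both sides vanish; so the generators may be dependent.\<close>
  have kd: "k * cinner d d = cinner (f - p) d"
    by (cases "d = 0") (auto simp: k_def cinner_self)
  have "cinner (f - (p + cscale k d)) v = 0" if v: "v \<in> L2.span (insert b B)" for v
  proof -
    obtain c where c: "v - cscale c b \<in> L2.span B"
      using v by (auto simp: L2.span_breakdown_eq)
    define w where "w = v - cscale c b + cscale c b0"
    have w: "w \<in> L2.span B"
      unfolding w_def using c b0(1) by (intro L2.span_add L2.span_scale)
    have veq: "v = w + cscale c d"
      by (simp add: w_def d_def L2.scale_right_diff_distrib)
    have "cinner d w = 0" using b0(2) w by (simp add: d_def)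
    moreover have "cinner (f - p) w = 0" using p(2) w by simp
    ultimately have "cinner ((f - p) - cscale k d) v = cnj c * (cinner (f - p) d - k * cinner d d)"
      unfolding veq cinner_add_right cinner_scale_right cinner_diff_left[of "f - p"] cinner_scale_left
      by (simp add: algebra_simps)
    then show ?thesis using kd by (simp add: diff_diff_eq)
  qed
  moreover have "p + cscale k d \<in> L2.span (insert b B)"
    using p(1) sub din by (intro L2.span_add L2.span_scale) auto
  ultimately show ?case by blast
qed

text \<open>A common hypothesis for the two subspaces to be compared: one is given by its dimension,
  the other by its generators. It guarantees that the \<open>THE\<close> in \<open>orth_proj\<close>
  denotes.\<close>

definition fin_dim :: "sphere_L2 set \<Rightarrow> bool" where
  "fin_dim V \<longleftrightarrow> (\<exists>B. finite B \<and> V = L2.span B)"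

lemma fin_dim_subspace: "fin_dim V \<Longrightarrow> L2.subspace V"
  by (auto simp: fin_dim_def)

lemma orth_proj_eqI:
  assumes V: "L2.subspace V" and p: "p \<in> V" "\<And>v. v \<in> V \<Longrightarrow> cinner (f - p) v = 0"
  shows "orth_proj V f = p"
  unfolding orth_proj_def
proof (rule the_equality)
  fix r assume r: "r \<in> V \<and> (\<forall>v\<in>V. cinner (f - r) v = 0)"
  then have "p - r \<in> V" using p(1) V by (simp add: L2.subspace_diff)
  then have "cinner (f - r) (p - r) - cinner (f - p) (p - r) = 0"
    using r p by simp
  then have "cinner (p - r) (p - r) = 0"
    by (simp add: cinner_diff_left)
  then show "r = p" by (simp add: cinner_self)
qed (use p in auto)

lemma
  assumes "fin_dim V"
  shows orth_proj_in: "orth_proj V f \<in> V"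
    and orth_proj_orth: "v \<in> V \<Longrightarrow> cinner (f - orth_proj V f) v = 0"
proof -
  obtain B where B: "finite B" "V = L2.span B"
    using assms by (auto simp: fin_dim_def)
  obtain p where p: "p \<in> V" "\<And>v. v \<in> V \<Longrightarrow> cinner (f - p) v = 0"
    using orth_projection_exists[OF B(1)] B(2) by blast
  have "orth_proj V f = p"
    using p by (intro orth_proj_eqI fin_dim_subspace assms)
  then show "orth_proj V f \<in> V" "v \<in> V \<Longrightarrow> cinner (f - orth_proj V f) v = 0"
    using p by simp_all
qed

lemma inner_orth_proj_orth: "fin_dim V \<Longrightarrow> v \<in> V \<Longrightarrow> inner (f - orth_proj V f) v = 0"
  by (simp add: inner_sphere_L2_def orth_proj_orth)

lemma inner_orth_proj:
  assumes "fin_dim V"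
  shows "inner (orth_proj V f) g = inner (orth_proj V f) (orth_proj V g)"
  using inner_orth_proj_orth[OF assms orth_proj_in[OF assms, of f], of g]
  by (simp add: inner_diff_left inner_commute[of "orth_proj V f"])

lemma inner_orth_proj_commute:
  "fin_dim V \<Longrightarrow> inner (orth_proj V f) g = inner f (orth_proj V g)"
  by (metis inner_orth_proj inner_commute)

lemma norm_orth_proj_sq: "fin_dim V \<Longrightarrow> (norm (orth_proj V f))\<^sup>2 = inner (orth_proj V f) f"
  by (simp add: power2_norm_eq_inner inner_orth_proj[of V f f])

lemma norm_orth_proj_complement:
  assumes "fin_dim V"
  shows "(norm (f - orth_proj V f))\<^sup>2 = (norm f)\<^sup>2 - (norm (orth_proj V f))\<^sup>2"
  using norm_orth_proj_sq[OF assms, of f]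
  by (simp add: power2_norm_eq_inner inner_diff_left inner_diff_right inner_commute)

lemma norm_orth_proj_le:
  assumes "fin_dim V"
  shows "norm (orth_proj V f) \<le> norm f"
proof (rule power2_le_imp_le)
  have "0 \<le> (norm f)\<^sup>2 - (norm (orth_proj V f))\<^sup>2"
    unfolding norm_orth_proj_complement[OF assms, symmetric] by (rule zero_le_power2)
  then show "(norm (orth_proj V f))\<^sup>2 \<le> (norm f)\<^sup>2" by (simp only: diff_ge_0_iff_ge)
qed (rule norm_ge_zero)

lemma orth_proj_add:
  assumes "fin_dim V"
  shows "orth_proj V (f + g) = orth_proj V f + orth_proj V g"
proof (rule orth_proj_eqI)
  show "orth_proj V f + orth_proj V g \<in> V"
    using assms by (intro L2.subspace_add fin_dim_subspace orth_proj_in)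
  show "cinner (f + g - (orth_proj V f + orth_proj V g)) v = 0" if "v \<in> V" for v
    using orth_proj_orth[OF assms that, of f] orth_proj_orth[OF assms that, of g]
    by (simp add: cinner_diff_left cinner_add_left)
qed (intro fin_dim_subspace assms)

lemma orth_proj_scale:
  assumes "fin_dim V"
  shows "orth_proj V (cscale c f) = cscale c (orth_proj V f)"
proof (rule orth_proj_eqI)
  show "cscale c (orth_proj V f) \<in> V"
    using assms by (intro L2.subspace_scale fin_dim_subspace orth_proj_in)
  show "cinner (cscale c f - cscale c (orth_proj V f)) v = 0" if "v \<in> V" for v
    using orth_proj_orth[OF assms that, of f]
    by (simp add: cinner_diff_left cinner_scale_left)
qed (intro fin_dim_subspace assms)

lemma bounded_linear_orth_proj: "fin_dim V \<Longrightarrow> bounded_linear (orth_proj V)"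
  by (rule bounded_linear_intro[where K = 1])
    (auto simp: orth_proj_add orth_proj_scale scaleR_sphere_L2_def norm_orth_proj_le)

lemma orth_proj_id: "fin_dim V \<Longrightarrow> v \<in> V \<Longrightarrow> orth_proj V v = v"
  by (intro orth_proj_eqI) (auto simp: fin_dim_subspace)

lemma fin_dim_dim:
  assumes "L2.subspace U" "L2.dim U = s" "s \<noteq> 0"
  shows "fin_dim U"
proof -
  obtain B where B: "B \<subseteq> U" "L2.independent B" "U \<subseteq> L2.span B" "card B = L2.dim U"
    using L2.basis_exists by blast
  \<comment> \<open>An infinite set has \<open>card\<close> 0, so a nonzero dimension forces the
    basis to be finite.\<close>
  have "finite B" using B(4) assms by (metis card.infinite)
  moreover have "L2.span B = U"
    using B(1,3) assms(1) by (metis L2.span_minimal subset_antisym)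
  ultimately show ?thesis by (auto simp: fin_dim_def)
qed

lemma fin_dim_wave_span: "finite X \<Longrightarrow> fin_dim (wave_span \<kappa> X)"
  by (auto simp: fin_dim_def wave_span_def)

text \<open>
  The sine of the angle between \<open>f\<close> and a subspace is the distance of \<open>f\<close> to it, so this is the
  triangle inequality for angles.
\<close>

lemma orth_proj_angle:
  assumes U: "fin_dim U" and V: "fin_dim V" and f: "norm f = 1"
    and close: "\<And>g. norm (orth_proj U g - orth_proj V g) \<le> \<eta> * norm g"
    and \<alpha>: "0 \<le> \<alpha>" "norm (f - orth_proj U f) \<le> sin \<alpha>"
    and \<beta>: "0 \<le> \<beta>" "\<eta> \<le> sin \<beta>" "\<alpha> + \<beta> < pi / 2"
  shows "norm (f - orth_proj V f) \<le> sin (\<alpha> + \<beta>)"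
proof -
  define p where "p = orth_proj U f"
  define a where "a = norm p"
  define w where "w = f - p"
  define x where "x = norm w"
  have ax: "x\<^sup>2 = 1 - a\<^sup>2"
    using norm_orth_proj_complement[OF U, of f] f by (simp add: x_def w_def a_def p_def)
  have x0: "0 \<le> x" "0 \<le> a" by (auto simp: x_def a_def)
  have xs: "x \<le> sin \<alpha>" using \<alpha> by (simp add: x_def w_def p_def)
  have ca: "cos \<alpha> > 0" using \<alpha> \<beta> by (intro cos_gt_zero_pi) auto
  have cb: "cos \<beta> > 0" using \<alpha> \<beta> by (intro cos_gt_zero_pi) auto
  have cab: "cos (\<alpha> + \<beta>) > 0" using \<alpha> \<beta> by (intro cos_gt_zero_pi) auto
  have sa: "sin \<alpha> \<ge> 0" using \<alpha> \<beta> by (intro sin_ge_zero) auto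
  have sb: "sin \<beta> \<ge> 0" using \<alpha> \<beta> by (intro sin_ge_zero) auto
  have ac: "cos \<alpha> \<le> a"
  proof (rule power2_le_imp_le)
    have "x\<^sup>2 \<le> (sin \<alpha>)\<^sup>2" using xs x0 by (simp add: power_mono)
    then show "(cos \<alpha>)\<^sup>2 \<le> a\<^sup>2" using ax sin_cos_squared_add[of \<alpha>] by linarith
  qed (use x0 in simp)
  \<comment> \<open>\<open>f\<close> splits as \<open>a\<close> times the unit vector
    \<open>u\<close> of \<open>U\<close> plus \<open>w\<close> orthogonal to \<open>u\<close>.
    Pairing \<open>f\<close> with the projection \<open>r\<close> of \<open>u\<close> to
    \<open>V\<close> then bounds the norm of \<open>orth_proj V f\<close> from below by cos
    (\<alpha> + \<beta>).\<close>
  define u where "u = p /\<^sub>R a"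
  have apos: "a > 0" using ca ac by linarith
  have u1: "norm u = 1" using apos by (simp add: u_def a_def)
  have uU: "u \<in> U"
    unfolding u_def p_def scaleR_sphere_L2_def
    using U by (intro L2.subspace_scale fin_dim_subspace orth_proj_in)
  have pu: "p = a *\<^sub>R u" using apos by (simp add: u_def)
  have wu: "inner w u = 0"
    using inner_orth_proj_orth[OF U uU] by (simp add: w_def p_def)
  define r where "r = orth_proj V u"
  define b where "b = norm r"
  have b0: "b \<ge> 0" by (simp add: b_def)
  have ur: "(norm (u - r))\<^sup>2 = 1 - b\<^sup>2"
    using norm_orth_proj_complement[OF V, of u] u1 by (simp add: r_def b_def)
  have rr: "inner r u = b\<^sup>2" using norm_orth_proj_sq[OF V, of u] by (simp add: r_def b_def)
  have "norm (u - r) \<le> sin \<beta>"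
    using close[of u] u1 \<beta> orth_proj_id[OF U uU] by (simp add: r_def)
  then have b1: "1 - b\<^sup>2 \<le> (sin \<beta>)\<^sup>2"
    unfolding ur[symmetric] by (rule power_mono) simp
  then have "(cos \<beta>)\<^sup>2 \<le> b\<^sup>2" using sin_cos_squared_add[of \<beta>] by linarith
  then have cbb: "cos \<beta> \<le> b" using b0 by (rule power2_le_imp_le)
  then have bpos: "b > 0" using cb by linarith
  have sq1b: "sqrt (1 - b\<^sup>2) \<le> sin \<beta>"
    using b1 sb by (simp add: real_le_lsqrt)
  have b2: "0 \<le> 1 - b\<^sup>2" unfolding ur[symmetric] by simp
  \<comment> \<open>Only the component of \<open>r\<close> orthogonal to \<open>u\<close> pairs with
    \<open>w\<close>; it has length b sqrt (1 - b^2), the product of cosine and sine of the angle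
    between \<open>u\<close> and \<open>V\<close>.\<close>
  have "\<bar>inner w r\<bar> \<le> x * (b * sqrt (1 - b\<^sup>2))"
  proof -
    have "inner w r = inner w (r - b\<^sup>2 *\<^sub>R u)"
      using wu by (simp add: inner_diff_right)
    also have "\<bar>\<dots>\<bar> \<le> norm w * norm (r - b\<^sup>2 *\<^sub>R u)"
      by (rule Cauchy_Schwarz_ineq2)
    also have "norm (r - b\<^sup>2 *\<^sub>R u) = b * sqrt (1 - b\<^sup>2)"
    proof (rule power2_eq_imp_eq)
      have "inner u u = 1" "inner r r = b\<^sup>2"
        using u1 by (simp_all add: power2_norm_eq_inner[symmetric] b_def)
      then show "(norm (r - b\<^sup>2 *\<^sub>R u))\<^sup>2 = (b * sqrt (1 - b\<^sup>2))\<^sup>2"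
        using b2 rr
        by (simp add: power2_norm_eq_inner inner_diff_left inner_diff_right inner_commute
            power_mult_distrib) (simp add: algebra_simps power2_eq_square power4_eq_xxxx)
    qed (use b0 b2 in auto)
    finally show ?thesis by (simp add: x_def)
  qed
  then have wr: "inner w r \<ge> - (x * (b * sqrt (1 - b\<^sup>2)))" by linarith
  have fpw: "f = a *\<^sub>R u + w" unfolding pu[symmetric] by (simp add: w_def)
  have "b * (a * b - x * sqrt (1 - b\<^sup>2)) \<le> inner f r"
    using wr rr by (simp add: fpw inner_add_left inner_commute algebra_simps power2_eq_square)
  also have "inner f r = inner (orth_proj V f) r"
    unfolding r_def using inner_orth_proj[OF V, of u f] by (simp add: inner_commute)
  also have "\<dots> \<le> norm (orth_proj V f) * b"
    unfolding b_def by (rule norm_cauchy_schwarz)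
  finally have "a * b - x * sqrt (1 - b\<^sup>2) \<le> norm (orth_proj V f)"
    using bpos by (simp add: mult.commute)
  moreover have "cos (\<alpha> + \<beta>) \<le> a * b - x * sqrt (1 - b\<^sup>2)"
    unfolding cos_add using ac cbb xs sq1b x0 b0 sa sb ca cb b2
    by (intro diff_mono mult_mono) auto
  ultimately have "cos (\<alpha> + \<beta>) \<le> norm (orth_proj V f)" by linarith
  then have "(cos (\<alpha> + \<beta>))\<^sup>2 \<le> (norm (orth_proj V f))\<^sup>2"
    using cab by (intro power_mono) auto
  then have "(norm (f - orth_proj V f))\<^sup>2 \<le> (sin (\<alpha> + \<beta>))\<^sup>2"
    unfolding norm_orth_proj_complement[OF V] f using sin_cos_squared_add[of "\<alpha> + \<beta>"]
    unfolding power_one by linarith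
  moreover have "0 \<le> sin (\<alpha> + \<beta>)" using \<alpha> \<beta> by (intro sin_ge_zero) auto
  ultimately show ?thesis by (rule power2_le_imp_le)
qed

section \<open>Gram matrices close to the identity\<close>

lemma schur_test:
  fixes M :: "'a \<Rightarrow> 'a \<Rightarrow> real" and c :: "'a \<Rightarrow> complex"
  assumes Y: "finite Y" and sym: "\<And>x y. M x y = M y x"
    and row: "\<And>x. x \<in> Y \<Longrightarrow> (\<Sum>y\<in>Y. \<bar>M x y\<bar>) \<le> \<mu>" and \<mu>: "0 \<le> \<mu>"
  shows "L2_set (\<lambda>x. cmod (\<Sum>y\<in>Y. c y * M x y)) Y \<le> \<mu> * L2_set (\<lambda>x. cmod (c x)) Y"
proof -
  have entry: "(cmod (\<Sum>y\<in>Y. c y * M x y))\<^sup>2 \<le> \<mu> * (\<Sum>y\<in>Y. \<bar>M x y\<bar> * (cmod (c y))\<^sup>2)"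
    if x: "x \<in> Y" for x
  proof -
    have "cmod (\<Sum>y\<in>Y. c y * M x y) \<le> (\<Sum>y\<in>Y. cmod (c y * M x y))"
      by (rule norm_sum)
    \<comment> \<open>Cauchy-Schwarz with |M| split evenly between the two factors: one becomes a
      row sum, the other is summed over \<open>x\<close> afterwards, where by symmetry the column
      sums are row sums.\<close>
    also have "\<dots> = (\<Sum>y\<in>Y. \<bar>sqrt \<bar>M x y\<bar>\<bar> * \<bar>sqrt \<bar>M x y\<bar> * cmod (c y)\<bar>)"
      by (intro sum.cong) (auto simp: norm_mult abs_mult mult.assoc[symmetric])
    also have "\<dots> \<le> L2_set (\<lambda>y. sqrt \<bar>M x y\<bar>) Y * L2_set (\<lambda>y. sqrt \<bar>M x y\<bar> * cmod (c y)) Y"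
      by (rule L2_set_mult_ineq)
    finally have "(cmod (\<Sum>y\<in>Y. c y * M x y))\<^sup>2 \<le>
        (L2_set (\<lambda>y. sqrt \<bar>M x y\<bar>) Y * L2_set (\<lambda>y. sqrt \<bar>M x y\<bar> * cmod (c y)) Y)\<^sup>2"
      by (rule power_mono) simp
    also have "\<dots> = (\<Sum>y\<in>Y. \<bar>M x y\<bar>) * (\<Sum>y\<in>Y. \<bar>M x y\<bar> * (cmod (c y))\<^sup>2)"
      by (simp add: L2_set_def power_mult_distrib sum_nonneg)
    also have "\<dots> \<le> \<mu> * (\<Sum>y\<in>Y. \<bar>M x y\<bar> * (cmod (c y))\<^sup>2)"
      by (intro mult_right_mono row x sum_nonneg) simp
    finally show ?thesis .
  qed
  have "(\<Sum>x\<in>Y. (cmod (\<Sum>y\<in>Y. c y * M x y))\<^sup>2) \<le> (\<Sum>x\<in>Y. \<mu> * (\<Sum>y\<in>Y. \<bar>M x y\<bar> * (cmod (c y))\<^sup>2))"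
    by (intro sum_mono entry)
  also have "\<dots> = \<mu> * (\<Sum>y\<in>Y. (\<Sum>x\<in>Y. \<bar>M x y\<bar>) * (cmod (c y))\<^sup>2)"
    unfolding sum_distrib_left[symmetric] sum_distrib_right by (subst sum.swap) simp
  also have "\<dots> \<le> \<mu> * (\<Sum>y\<in>Y. \<mu> * (cmod (c y))\<^sup>2)"
  proof (intro mult_left_mono sum_mono mult_right_mono \<mu>)
    fix y assume "y \<in> Y"
    then show "(\<Sum>x\<in>Y. \<bar>M x y\<bar>) \<le> \<mu>" using row[of y] by (simp add: sym[of _ y])
  qed simp
  also have "\<dots> = (\<mu> * L2_set (\<lambda>x. cmod (c x)) Y)\<^sup>2"
    by (simp add: L2_set_def power_mult_distrib sum_nonneg sum_distrib_left[symmetric] power2_eq_square)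
  finally show ?thesis
    using \<mu> by (subst L2_set_def) (intro real_le_lsqrt mult_nonneg_nonneg L2_set_nonneg, auto)
qed

text \<open>The coefficients are indexed by \<open>Y\<close> and not by the image, so that
  \<open>e\<close> need not be injective.\<close>

lemma span_image_explicit:
  assumes "finite Y" "v \<in> L2.span (e ` Y)"
  obtains c where "v = (\<Sum>y\<in>Y. cscale (c y) (e y))"
proof -
  let ?S = "{(\<Sum>y\<in>Y. cscale (c y) (e y)) | c. True}"
  have "L2.subspace ?S"
  proof (rule L2.subspaceI)
    show "0 \<in> ?S" by (auto intro!: exI[of _ "\<lambda>_. 0"])
    fix x y assume "x \<in> ?S" "y \<in> ?S"
    then obtain c d where "x = (\<Sum>y\<in>Y. cscale (c y) (e y))" "y = (\<Sum>y\<in>Y. cscale (d y) (e y))"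
      by blast
    then show "x + y \<in> ?S"
      by (auto intro!: exI[of _ "\<lambda>y. c y + d y"] simp: L2.scale_left_distrib sum.distrib)
  next
    fix k x assume "x \<in> ?S"
    then obtain c where "x = (\<Sum>y\<in>Y. cscale (c y) (e y))" by blast
    then show "cscale k x \<in> ?S"
      by (auto intro!: exI[of _ "\<lambda>y. k * c y"] simp: L2.scale_sum_right)
  qed
  moreover have "e y \<in> ?S" if "y \<in> Y" for y
  proof -
    have "e y = (\<Sum>x\<in>Y. cscale (if x = y then 1 else 0) (e x))"
      using assms(1) that by (simp add: if_distrib[of "\<lambda>c. cscale c _"] cong: if_cong)
    then show ?thesis by (intro CollectI exI[of _ "\<lambda>x. if x = y then 1 else 0"]) simp
  qed
  ultimately have "L2.span (e ` Y) \<subseteq> ?S"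
    by (intro L2.span_minimal) auto
  then show ?thesis using assms(2) that by blast
qed

text \<open>
  The Gram matrix maps \<open>c\<close> to the vector of the inner products \<open>a y = \<langle>f, e y\<rangle>\<close>; by the Schur
  test it is \<open>\<mu>\<close>-close to the identity, so \<open>\<parallel>a - c\<parallel> \<le> \<mu> \<parallel>c\<parallel>\<close>.
\<close>

lemma gram_coefficients:
  assumes Y: "finite Y"
    and G: "\<And>x y. cinner (e x) (e y) = complex_of_real (M x y)" "\<And>x y. M x y = M y x" "\<And>x. M x x = 1"
    and row: "\<And>x. x \<in> Y \<Longrightarrow> (\<Sum>y\<in>Y - {x}. \<bar>M x y\<bar>) \<le> \<mu>" and \<mu>: "0 \<le> \<mu>" "\<mu> < 1"
  obtains c where "orth_proj (L2.span (e ` Y)) f = (\<Sum>y\<in>Y. cscale (c y) (e y))"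
    "L2_set (\<lambda>y. cmod (c y - cinner f (e y))) Y \<le> \<mu> / (1 - \<mu>) * L2_set (\<lambda>y. cmod (cinner f (e y))) Y"
    "L2_set (\<lambda>y. cmod (c y)) Y \<le> 1 / (1 - \<mu>) * L2_set (\<lambda>y. cmod (cinner f (e y))) Y"
proof -
  let ?V = "L2.span (e ` Y)"
  have V: "fin_dim ?V" using Y by (auto simp: fin_dim_def)
  obtain c where c: "orth_proj ?V f = (\<Sum>y\<in>Y. cscale (c y) (e y))"
    using span_image_explicit[OF Y orth_proj_in[OF V]] by metis
  define a where "a = (\<lambda>y. cinner f (e y))"
  \<comment> \<open>The Gram matrix minus the identity, since its diagonal is 1.\<close>
  define M' where "M' = (\<lambda>x y. if x = y then 0 else M x y)"
  have diff: "a x - c x = (\<Sum>y\<in>Y. c y * M' x y)" if x: "x \<in> Y" for x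
  proof -
    have "cinner (f - orth_proj ?V f) (e x) = 0"
      using x by (intro orth_proj_orth V L2.span_base) auto
    then have "a x = (\<Sum>y\<in>Y. c y * M y x)"
      by (simp add: a_def c cinner_diff_left cinner_sum_left cinner_scale_left G(1))
    also have "\<dots> = c x + (\<Sum>y\<in>Y - {x}. c y * M x y)"
      using Y x G(3) by (subst sum.remove[of _ x]) (auto simp: G(2)[of _ x])
    also have "(\<Sum>y\<in>Y - {x}. c y * M x y) = (\<Sum>y\<in>Y. c y * M' x y)"
      using Y x by (intro sum.mono_neutral_cong_left) (auto simp: M'_def)
    finally show ?thesis by simp
  qed
  let ?c = "L2_set (\<lambda>y. cmod (c y)) Y" and ?a = "L2_set (\<lambda>y. cmod (a y)) Y"
  let ?d = "L2_set (\<lambda>y. cmod (a y - c y)) Y"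
  have "?d = L2_set (\<lambda>x. cmod (\<Sum>y\<in>Y. c y * M' x y)) Y"
    by (intro L2_set_cong) (auto simp: diff)
  also have "\<dots> \<le> \<mu> * ?c"
  proof (rule schur_test[OF Y])
    show "M' x y = M' y x" for x y by (auto simp: M'_def G(2))
    show "(\<Sum>y\<in>Y. \<bar>M' x y\<bar>) \<le> \<mu>" if x: "x \<in> Y" for x
    proof -
      have "(\<Sum>y\<in>Y. \<bar>M' x y\<bar>) = (\<Sum>y\<in>Y - {x}. \<bar>M x y\<bar>)"
        using Y x by (intro sum.mono_neutral_cong_right) (auto simp: M'_def)
      then show ?thesis using row[OF x] by simp
    qed
  qed fact
  finally have d: "?d \<le> \<mu> * ?c" .
  have "?c \<le> L2_set (\<lambda>y. cmod (a y) + cmod (a y - c y)) Y"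
    using norm_triangle_sub[of "c _" "a _"]
    by (intro L2_set_mono) (auto simp: norm_minus_commute)
  also have "\<dots> \<le> ?a + ?d" by (rule L2_set_triangle_ineq)
  finally have "(1 - \<mu>) * ?c \<le> ?a" using d by (simp add: algebra_simps)
  then have ca: "?c \<le> 1 / (1 - \<mu>) * ?a" using \<mu> by (simp add: field_simps)
  have "\<mu> * ?c \<le> \<mu> * (1 / (1 - \<mu>) * ?a)"
    using ca \<mu>(1) by (rule mult_left_mono)
  then have "?d \<le> \<mu> / (1 - \<mu>) * ?a" using d by simp
  then show ?thesis
    using that[OF c] ca by (simp add: a_def norm_minus_commute)
qed

text \<open>As the correlations are real, the inner product of the projection with \<open>g\<close>
  is the sum of \<open>Re (c y) * b y\<close> for the coefficients \<open>c\<close>, and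
  \<open>c\<close> differs from \<open>a\<close> by at most \<mu> / (1 - \<mu>) times the length of
  \<open>a\<close>. The first bound serves the Hessian, the second the lower bound on
  \<open>Q\<close> away from the points.\<close>

lemma gram_bilinear:
  assumes Y: "finite Y"
    and G: "\<And>x y. cinner (e x) (e y) = complex_of_real (M x y)" "\<And>x y. M x y = M y x" "\<And>x. M x x = 1"
    and row: "\<And>x. x \<in> Y \<Longrightarrow> (\<Sum>y\<in>Y - {x}. \<bar>M x y\<bar>) \<le> \<mu>" and \<mu>: "0 \<le> \<mu>" "\<mu> < 1"
    and f: "\<And>y. y \<in> Y \<Longrightarrow> cinner f (e y) = complex_of_real (a y)"
    and g: "\<And>y. y \<in> Y \<Longrightarrow> cinner g (e y) = complex_of_real (b y)"
  shows "\<bar>inner (orth_proj (L2.span (e ` Y)) f) g - (\<Sum>y\<in>Y. a y * b y)\<bar> \<le>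
      \<mu> / (1 - \<mu>) * (L2_set a Y * L2_set b Y)"
    and "(norm (orth_proj (L2.span (e ` Y)) f))\<^sup>2 \<le> (\<Sum>y\<in>Y. (a y)\<^sup>2) / (1 - \<mu>)"
proof -
  obtain c where c: "orth_proj (L2.span (e ` Y)) f = (\<Sum>y\<in>Y. cscale (c y) (e y))"
    and 1: "L2_set (\<lambda>y. cmod (c y - cinner f (e y))) Y \<le> \<mu> / (1 - \<mu>) * L2_set (\<lambda>y. cmod (cinner f (e y))) Y"
    and 2: "L2_set (\<lambda>y. cmod (c y)) Y \<le> 1 / (1 - \<mu>) * L2_set (\<lambda>y. cmod (cinner f (e y))) Y"
    by (rule gram_coefficients[OF Y G row \<mu>, of f])
  have absl: "L2_set (\<lambda>y. \<bar>h y\<bar>) Y = L2_set h Y" for h :: "'a \<Rightarrow> real"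
    by (simp add: L2_set_def)
  have na: "L2_set (\<lambda>y. cmod (cinner f (e y))) Y = L2_set a Y"
    unfolding absl[of a, symmetric] by (intro L2_set_cong) (auto simp: f)
  have nd: "L2_set (\<lambda>y. cmod (c y - cinner f (e y))) Y = L2_set (\<lambda>y. cmod (c y - a y)) Y"
    by (intro L2_set_cong) (auto simp: f)
  have ge: "cinner (e y) h = complex_of_real t" if "cinner h (e y) = complex_of_real t" for y h t
    by (metis that cnj_cinner complex_cnj_complex_of_real)
  have expand: "inner (orth_proj (L2.span (e ` Y)) f) h = (\<Sum>y\<in>Y. Re (c y) * t y)"
    if "\<And>y. y \<in> Y \<Longrightarrow> cinner h (e y) = complex_of_real (t y)" for h and t :: "'a \<Rightarrow> real"
    unfolding inner_sphere_L2_def c using ge[OF that]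
    by (simp add: cinner_sum_left cinner_scale_left)
  have "\<bar>inner (orth_proj (L2.span (e ` Y)) f) g - (\<Sum>y\<in>Y. a y * b y)\<bar> =
      \<bar>\<Sum>y\<in>Y. Re (c y - a y) * b y\<bar>"
    by (simp add: expand[OF g] sum_subtractf[symmetric] algebra_simps)
  also have "\<dots> \<le> (\<Sum>y\<in>Y. \<bar>Re (c y - a y) * b y\<bar>)" by (rule sum_abs)
  also have "\<dots> \<le> (\<Sum>y\<in>Y. \<bar>cmod (c y - a y)\<bar> * \<bar>b y\<bar>)"
    by (intro sum_mono) (simp add: abs_mult mult_right_mono abs_Re_le_cmod del: minus_complex.sel)
  also have "\<dots> \<le> L2_set (\<lambda>y. cmod (c y - a y)) Y * L2_set b Y"
    by (rule L2_set_mult_ineq)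
  also have "\<dots> \<le> \<mu> / (1 - \<mu>) * L2_set a Y * L2_set b Y"
    using 1 by (intro mult_right_mono L2_set_nonneg) (simp add: na nd)
  finally show "\<bar>inner (orth_proj (L2.span (e ` Y)) f) g - (\<Sum>y\<in>Y. a y * b y)\<bar> \<le>
      \<mu> / (1 - \<mu>) * (L2_set a Y * L2_set b Y)" by (simp add: mult.assoc)
  have V: "fin_dim (L2.span (e ` Y))" using Y by (auto simp: fin_dim_def)
  have "(norm (orth_proj (L2.span (e ` Y)) f))\<^sup>2 = (\<Sum>y\<in>Y. Re (c y) * a y)"
    by (simp add: norm_orth_proj_sq[OF V] expand[OF f])
  also have "\<dots> \<le> (\<Sum>y\<in>Y. \<bar>cmod (c y)\<bar> * \<bar>a y\<bar>)"
  proof (rule sum_mono)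
    fix y
    have "Re (c y) * a y \<le> \<bar>Re (c y)\<bar> * \<bar>a y\<bar>" by (metis abs_ge_self abs_mult)
    also have "\<dots> \<le> \<bar>cmod (c y)\<bar> * \<bar>a y\<bar>"
      by (simp add: mult_right_mono abs_Re_le_cmod)
    finally show "Re (c y) * a y \<le> \<bar>cmod (c y)\<bar> * \<bar>a y\<bar>" .
  qed
  also have "\<dots> \<le> L2_set (\<lambda>y. cmod (c y)) Y * L2_set a Y"
    by (rule L2_set_mult_ineq)
  also have "\<dots> \<le> 1 / (1 - \<mu>) * L2_set a Y * L2_set a Y"
    using 2 by (intro mult_right_mono L2_set_nonneg) (simp add: na)
  also have "\<dots> = (\<Sum>y\<in>Y. (a y)\<^sup>2) / (1 - \<mu>)"
    by (simp add: L2_set_def sum_nonneg)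
  finally show "(norm (orth_proj (L2.span (e ` Y)) f))\<^sup>2 \<le> (\<Sum>y\<in>Y. (a y)\<^sup>2) / (1 - \<mu>)" .
qed

section \<open>Waves and their derivatives\<close>

lemma continuous_bounded_on_sphere:
  fixes f :: "real ^ 3 \<Rightarrow> 'b::real_normed_vector"
  assumes "continuous_on UNIV f"
  obtains C where "C > 0" "\<And>\<omega>. norm \<omega> = 1 \<Longrightarrow> norm (f \<omega>) \<le> C"
proof -
  have "bounded (f ` sphere 0 1)"
    using assms continuous_on_subset
    by (intro compact_imp_bounded compact_continuous_image) auto
  then show ?thesis
    using that by (fastforce simp: bounded_pos)
qed

text \<open>The measure lives on the whole ambient space but is carried by the unit sphere, where
  compactness bounds a continuous function.\<close>

lemma integrable_sphere_continuous:
  fixes f :: "real ^ 3 \<Rightarrow> 'b::{banach, second_countable_topology}"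
  assumes "continuous_on UNIV f"
  shows "integrable sphere_measure f"
proof -
  obtain C where "\<And>\<omega>. norm \<omega> = 1 \<Longrightarrow> norm (f \<omega>) \<le> C"
    using continuous_bounded_on_sphere[OF assms] by metis
  then have "AE \<omega> in sphere_measure. norm (f \<omega>) \<le> C"
    using AE_sphere_measure_norm by (auto elim: eventually_mono)
  moreover have "f \<in> borel_measurable sphere_measure"
    using borel_measurable_continuous_onI[OF assms]
    by (simp add: measurable_cong_sets[OF sets_sphere_measure refl])
  ultimately show ?thesis by (rule sphere_measure.integrable_const_bound)
qed

lemma integral_sphere_mono:
  fixes f g :: "real ^ 3 \<Rightarrow> real"
  assumes "continuous_on UNIV f" "continuous_on UNIV g" "\<And>\<omega>. norm \<omega> = 1 \<Longrightarrow> f \<omega> \<le> g \<omega>"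
  shows "(\<integral>\<omega>. f \<omega> \<partial>sphere_measure) \<le> (\<integral>\<omega>. g \<omega> \<partial>sphere_measure)"
  using assms AE_sphere_measure_norm
  by (intro integral_mono_AE integrable_sphere_continuous) (auto elim: eventually_mono)

lemma integral_sphere_cong:
  fixes f g :: "real ^ 3 \<Rightarrow> real"
  assumes "continuous_on UNIV f" "continuous_on UNIV g" "\<And>\<omega>. norm \<omega> = 1 \<Longrightarrow> f \<omega> = g \<omega>"
  shows "(\<integral>\<omega>. f \<omega> \<partial>sphere_measure) = (\<integral>\<omega>. g \<omega> \<partial>sphere_measure)"
  using assms by (intro antisym integral_sphere_mono) auto

lemma prob_sphere_measure_UNIV [simp]: "measure sphere_measure UNIV = 1"
  using sphere_measure.prob_space by simp

lemma integral_sphere_orthogonal: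
  fixes F :: "real ^ 3 \<Rightarrow> 'b::{banach, second_countable_topology}"
  assumes "continuous_on UNIV F" "orthogonal_transformation f"
  shows "(\<integral>\<omega>. F (f \<omega>) \<partial>sphere_measure) = (\<integral>\<omega>. F \<omega> \<partial>sphere_measure)"
proof -
  have "continuous_on UNIV f"
    using assms(2) by (simp add: orthogonal_transformation linear_continuous_on linear_linear)
  then have "f \<in> borel_measurable borel"
    by (rule borel_measurable_continuous_onI)
  then have "f \<in> measurable sphere_measure borel"
    by (simp add: measurable_cong_sets[OF sets_sphere_measure refl])
  then have "(\<integral>\<omega>. F \<omega> \<partial>distr sphere_measure borel f) = (\<integral>\<omega>. F (f \<omega>) \<partial>sphere_measure)"
    by (intro integral_distr borel_measurable_continuous_onI assms)
  then show ?thesis by (simp add: sphere_measure_rotation_invariant[OF assms(2)])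
qed

lemma square_integrable_continuous:
  assumes "continuous_on UNIV f"
  shows "square_integrable f"
  unfolding square_integrable_def
  using borel_measurable_continuous_onI[OF assms]
  by (auto intro!: integrable_sphere_continuous continuous_intros assms
      simp: measurable_cong_sets[OF sets_sphere_measure refl])

lemma sphere_eq_continuous: "continuous_on UNIV f \<Longrightarrow> sphere_eq f f"
  by (simp add: sphere_eq_def square_integrable_continuous)

lemma norm_abs_sphere_L2_le:
  assumes f: "continuous_on UNIV f" and C: "\<And>\<omega>. norm \<omega> = 1 \<Longrightarrow> cmod (f \<omega>) \<le> C"
  shows "norm (abs_sphere_L2 f) \<le> C"
proof -
  have "C \<ge> 0"
    using order_trans[OF norm_ge_zero C[of "axis 1 1"]] by (simp add: norm_axis_1)
  have "(\<integral>\<omega>. (cmod (f \<omega>))\<^sup>2 \<partial>sphere_measure) \<le> (\<integral>\<omega>. C\<^sup>2 \<partial>sphere_measure)"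
    using C by (intro integral_sphere_mono continuous_intros f power_mono) auto
  then show ?thesis
    using \<open>C \<ge> 0\<close> by (simp add: norm_sphere_L2_abs square_integrable_continuous f real_le_lsqrt)
qed

text \<open>The amplitude \<open>p\<close> keeps plane waves and all their directional derivatives
  in one family, so that a single differentiation rule serves every order. The wave number is
  absorbed into \<open>y\<close>.\<close>

definition wave :: "(real ^ 3 \<Rightarrow> complex) \<Rightarrow> real ^ 3 \<Rightarrow> sphere_L2" where
  "wave p y = abs_sphere_L2 (\<lambda>\<omega>. p \<omega> * exp (\<i> * complex_of_real (\<omega> \<bullet> y)))"

lemma plane_wave_eq: "plane_wave \<kappa> z = wave (\<lambda>_. 1) (\<kappa> *\<^sub>R z)"
  by (simp add: plane_wave.abs_eq wave_def)

lemma wave_add: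
  assumes "continuous_on UNIV p" "continuous_on UNIV q"
  shows "wave p y + wave q y = wave (\<lambda>\<omega>. p \<omega> + q \<omega>) y"
  unfolding wave_def
  by (subst plus_sphere_L2.abs_eq)
    (auto intro!: sphere_eq_continuous continuous_intros assms simp: distrib_right)

lemma cscale_wave:
  assumes "continuous_on UNIV p"
  shows "cscale c (wave p y) = wave (\<lambda>\<omega>. c * p \<omega>) y"
  unfolding wave_def
  by (subst cscale.abs_eq)
    (auto intro!: sphere_eq_continuous continuous_intros assms simp: mult.assoc)

lemma scaleR_wave:
  assumes "continuous_on UNIV p"
  shows "r *\<^sub>R wave p y = wave (\<lambda>\<omega>. complex_of_real r * p \<omega>) y"
  unfolding scaleR_sphere_L2_def by (rule cscale_wave[OF assms])

lemma cinner_wave: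
  assumes "continuous_on UNIV p" "continuous_on UNIV q"
  shows "cinner (wave p y) (wave q x) =
    (\<integral>\<omega>. p \<omega> * cnj (q \<omega>) * exp (\<i> * complex_of_real (\<omega> \<bullet> (y - x))) \<partial>sphere_measure)"
  unfolding wave_def
  by (subst cinner.abs_eq)
    (auto intro!: sphere_eq_continuous continuous_intros assms
      simp: exp_cnj mult_ac exp_add[symmetric] inner_diff_right algebra_simps
      intro!: Bochner_Integration.integral_cong)

lemma inner_wave:
  assumes "continuous_on UNIV p" "continuous_on UNIV q"
  shows "inner (wave p y) (wave q x) =
    (\<integral>\<omega>. Re (p \<omega> * cnj (q \<omega>) * exp (\<i> * complex_of_real (\<omega> \<bullet> (y - x)))) \<partial>sphere_measure)"
  unfolding inner_sphere_L2_def cinner_wave[OF assms]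
  by (intro integral_Re[symmetric] integrable_sphere_continuous continuous_intros assms)

lemma norm_wave_sq:
  assumes "continuous_on UNIV p"
  shows "(norm (wave p y))\<^sup>2 = (\<integral>\<omega>. (cmod (p \<omega>))\<^sup>2 \<partial>sphere_measure)"
  unfolding power2_norm_eq_inner inner_wave[OF assms assms]
  by (simp add: inner_complex_def)

lemma norm_wave_le:
  assumes "continuous_on UNIV p" "\<And>\<omega>. norm \<omega> = 1 \<Longrightarrow> cmod (p \<omega>) \<le> C"
  shows "norm (wave p y) \<le> C"
  unfolding wave_def
  using assms by (intro norm_abs_sphere_L2_le continuous_intros) (auto simp: norm_mult)

text \<open>Multiplication by \<open>\<i> (\<omega> \<bullet> v)\<close> realizes the directional derivative of a wave along \<open>v\<close>.\<close>

definition dmult :: "real ^ 3 \<Rightarrow> (real ^ 3 \<Rightarrow> complex) \<Rightarrow> real ^ 3 \<Rightarrow> complex" where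
  "dmult v p = (\<lambda>\<omega>. p \<omega> * (\<i> * complex_of_real (\<omega> \<bullet> v)))"

lemma continuous_dmult [continuous_intros]:
  "continuous_on UNIV p \<Longrightarrow> continuous_on UNIV (dmult v p)"
  unfolding dmult_def by (intro continuous_intros)

text \<open>The remainder of exp (i t) after its linear part is at most t^2 / 2. With t = \<omega> .
  h this is bounded by |h|^2 uniformly over the sphere, so differentiation under the L2 norm needs
  no limit theorem.\<close>

lemma has_derivative_wave:
  assumes p: "continuous_on UNIV p"
  shows "(wave p has_derivative (\<lambda>v. wave (dmult v p) y)) (at y)"
proof -
  obtain C where C: "C > 0" "\<And>\<omega>. norm \<omega> = 1 \<Longrightarrow> norm (p \<omega>) \<le> C"
    using continuous_bounded_on_sphere[OF p] by metis
  have bl: "bounded_linear (\<lambda>v. wave (dmult v p) y)"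
  proof (rule bounded_linear_intro[where K = C])
    fix u v :: "real ^ 3" and r :: real
    show "wave (dmult (u + v) p) y = wave (dmult u p) y + wave (dmult v p) y"
      by (subst wave_add) (auto intro!: continuous_intros p
          simp: dmult_def inner_add_right algebra_simps)
    show "wave (dmult (r *\<^sub>R u) p) y = r *\<^sub>R wave (dmult u p) y"
      by (subst scaleR_wave) (auto intro!: continuous_intros p simp: dmult_def algebra_simps)
    show "norm (wave (dmult u p) y) \<le> norm u * C"
    proof (rule norm_wave_le)
      show "cmod (dmult u p \<omega>) \<le> norm u * C" if "norm \<omega> = 1" for \<omega>
        using mult_mono[OF C(2)[OF that] Cauchy_Schwarz_ineq2[of \<omega> u]] C(1) that
        by (simp add: dmult_def norm_mult mult.commute)
    qed (intro continuous_intros p)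
  qed
  show ?thesis
  proof (rule has_derivativeI_sandwich[where e = 1 and H = "\<lambda>x. C * norm (x - y)"])
    show "((\<lambda>x. C * norm (x - y)) \<longlongrightarrow> 0) (at y)"
      by (auto intro!: tendsto_eq_intros)
  next
    fix x assume x: "x \<noteq> y"
    define h where "h = x - y"
    let ?r = "\<lambda>\<omega>. p \<omega> * (exp (\<i> * complex_of_real (\<omega> \<bullet> h)) - 1 - \<i> * complex_of_real (\<omega> \<bullet> h))"
    have rc: "continuous_on UNIV ?r" by (intro continuous_intros p)
    \<comment> \<open>The phase at \<open>x\<close> is the phase at \<open>y\<close> times the phase
      of \<open>h\<close>; the latter is a new amplitude, which is expanded at 0.\<close>
    have "wave p x = wave (\<lambda>\<omega>. p \<omega> * exp (\<i> * complex_of_real (\<omega> \<bullet> h))) y"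
      by (simp add: wave_def mult.assoc exp_add[symmetric] h_def inner_diff_right algebra_simps)
    also have "\<dots> = wave p y + (wave (dmult h p) y + wave ?r y)"
      unfolding wave_add[OF continuous_dmult[OF p] rc]
        wave_add[OF p continuous_on_add[OF continuous_dmult[OF p] rc]]
      by (simp add: dmult_def algebra_simps)
    finally have "wave p x - wave p y - wave (dmult (x - y) p) y = wave ?r y"
      by (simp add: h_def)
    moreover have "norm (wave ?r y) \<le> C * (norm h)\<^sup>2"
    proof (rule norm_wave_le[OF rc])
      fix \<omega> :: "real ^ 3" assume w: "norm \<omega> = 1"
      have "cmod (exp (\<i> * complex_of_real (\<omega> \<bullet> h)) - 1 - \<i> * complex_of_real (\<omega> \<bullet> h)) \<le> \<bar>\<omega> \<bullet> h\<bar>\<^sup>2 / 2"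
        using iexp_approx1[of "\<omega> \<bullet> h" 1] by (simp add: numeral_2_eq_2 algebra_simps)
      also have "\<dots> \<le> (norm h)\<^sup>2"
      proof -
        have "\<bar>\<omega> \<bullet> h\<bar>\<^sup>2 \<le> (norm h)\<^sup>2"
          using Cauchy_Schwarz_ineq2[of \<omega> h] w by (intro power_mono) auto
        then show ?thesis using zero_le_power2[of "norm h"] by linarith
      qed
      finally show "cmod (?r \<omega>) \<le> C * (norm h)\<^sup>2"
        unfolding norm_mult by (intro mult_mono C(2) w) (use C(1) in auto)
    qed
    ultimately have "norm (wave p x - wave p y - wave (dmult (x - y) p) y) \<le> C * (norm h)\<^sup>2"
      by simp
    then have "norm (wave p x - wave p y - wave (dmult (x - y) p) y) / norm h \<le> C * (norm h)\<^sup>2 / norm h"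
      by (intro divide_right_mono) auto
    also have "\<dots> = C * norm h"
      using x by (simp add: h_def power2_eq_square)
    finally show "norm (wave p x - wave p y - wave (dmult (x - y) p) y) / norm (x - y) \<le> C * norm (x - y)"
      by (simp add: h_def)
  qed (simp_all add: bl)
qed

lemma has_vector_derivative_wave_line:
  assumes p: "continuous_on UNIV p"
  shows "((\<lambda>t. wave p (a + t *\<^sub>R v)) has_vector_derivative wave (dmult v p) (a + t *\<^sub>R v)) (at t)"
proof -
  have l: "((\<lambda>t. a + t *\<^sub>R v) has_derivative (\<lambda>s. s *\<^sub>R v)) (at t)"
    by (auto intro!: derivative_eq_intros)
  have bl: "bounded_linear (\<lambda>u. wave (dmult u p) (a + t *\<^sub>R v))"
    using has_derivative_bounded_linear[OF has_derivative_wave[OF p]] .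
  have "((\<lambda>t. wave p (a + t *\<^sub>R v)) has_derivative (\<lambda>s. wave (dmult (s *\<^sub>R v) p) (a + t *\<^sub>R v))) (at t)"
    using has_derivative_compose[OF l has_derivative_wave[OF p]] .
  then show ?thesis
    unfolding has_vector_derivative_def linear_scale[OF bounded_linear.linear[OF bl]] .
qed

lemma DERIV_inner_wave_line:
  assumes p: "continuous_on UNIV p"
  shows "((\<lambda>t. inner (wave p (a + t *\<^sub>R v)) w) has_real_derivative
           inner (wave (dmult v p) (a + t *\<^sub>R v)) w) (at t)"
  using bounded_linear.has_vector_derivative[OF bounded_linear_inner_left
      has_vector_derivative_wave_line[OF p, of a v t], of w]
  by (simp add: has_real_derivative_iff_has_vector_derivative)

section \<open>Integrals over the sphere\<close>

abbreviation one_fun :: "real ^ 3 \<Rightarrow> complex" where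
  "one_fun \<equiv> \<lambda>_. 1"

lemma inner_wave_1:
  "inner (wave one_fun y) (wave one_fun x) = (\<integral>\<omega>. cos (\<omega> \<bullet> (y - x)) \<partial>sphere_measure)"
  by (subst inner_wave) (simp_all add: Re_exp)

lemma inner_wave_d:
  "inner (wave (dmult v one_fun) y) (wave one_fun x) =
    (\<integral>\<omega>. - (\<omega> \<bullet> v) * sin (\<omega> \<bullet> (y - x)) \<partial>sphere_measure)"
  by (subst inner_wave) (auto intro!: continuous_intros simp: Re_exp Im_exp dmult_def)

lemma inner_wave_dd:
  "inner (wave (dmult u (dmult v one_fun)) y) (wave one_fun x) =
    (\<integral>\<omega>. - ((\<omega> \<bullet> u) * (\<omega> \<bullet> v) * cos (\<omega> \<bullet> (y - x))) \<partial>sphere_measure)"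
  by (subst inner_wave) (auto intro!: continuous_intros simp: Re_exp Im_exp dmult_def algebra_simps)

text \<open>The antipodal map preserves the measure and conjugates the integrand. This is the source
  of the real correlations that \<open>gram_bilinear\<close> requires.\<close>

lemma cinner_wave_real:
  assumes p: "continuous_on UNIV p" and "\<And>\<omega>. p (- \<omega>) = cnj (p \<omega>)"
  shows "cinner (wave p y) (wave one_fun x) = complex_of_real (inner (wave p y) (wave one_fun x))"
proof -
  let ?F = "\<lambda>\<omega>. p \<omega> * cnj (one_fun \<omega>) * exp (\<i> * complex_of_real (\<omega> \<bullet> (y - x)))"
  have F: "continuous_on UNIV ?F" by (intro continuous_intros p)
  have "cnj (\<integral>\<omega>. ?F \<omega> \<partial>sphere_measure) = (\<integral>\<omega>. cnj (?F \<omega>) \<partial>sphere_measure)"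
    by (rule Bochner_Integration.integral_cnj[symmetric])
  also have "\<dots> = (\<integral>\<omega>. ?F (- \<omega>) \<partial>sphere_measure)"
    by (simp add: assms(2) exp_cnj)
  also have "\<dots> = (\<integral>\<omega>. ?F \<omega> \<partial>sphere_measure)"
    by (intro integral_sphere_orthogonal[OF F])
      (auto simp: orthogonal_transformation_def intro!: linear_uminus)
  finally have "cnj (cinner (wave p y) (wave one_fun x)) = cinner (wave p y) (wave one_fun x)"
    unfolding cinner_wave[OF p continuous_on_const] .
  then show ?thesis
    by (simp add: inner_sphere_L2_def complex_eq_iff)
qed

lemma integral_cos_norm:
  assumes "norm y = norm z"
  shows "(\<integral>\<omega>. cos (\<omega> \<bullet> y) \<partial>sphere_measure) = (\<integral>\<omega>. cos (\<omega> \<bullet> z) \<partial>sphere_measure)"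
proof -
  obtain f where f: "orthogonal_transformation f" "f y = z"
    using orthogonal_transformation_exists[OF assms] by metis
  have "(\<integral>\<omega>. cos (\<omega> \<bullet> z) \<partial>sphere_measure) = (\<integral>\<omega>. cos (f \<omega> \<bullet> z) \<partial>sphere_measure)"
    by (rule integral_sphere_orthogonal[OF _ f(1), symmetric]) (intro continuous_intros)
  also have "\<dots> = (\<integral>\<omega>. cos (\<omega> \<bullet> y) \<partial>sphere_measure)"
    using f by (auto simp: orthogonal_transformation_def)
  finally show ?thesis by simp
qed

lemma orthonormal_expansion_3:
  fixes w :: "real ^ 3"
  shows "(w \<bullet> axis 1 1)\<^sup>2 + (w \<bullet> axis 2 1)\<^sup>2 + (w \<bullet> axis 3 1)\<^sup>2 = (norm w)\<^sup>2"
  unfolding power2_norm_eq_inner inner_axis by (simp add: inner_vec_def sum_3 power2_eq_square)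

text \<open>
  The function \<open>y \<mapsto> \<integral> cos (\<omega> \<bullet> y)\<close> is radial and satisfies the Helmholtz equation, since
  \<open>\<parallel>\<omega>\<parallel> = 1\<close>; so \<open>t\<close> times its radial profile solves \<open>w'' = - w\<close>.
\<close>

lemma integral_cos_sphere:
  "(\<integral>\<omega>. cos (\<omega> \<bullet> y) \<partial>sphere_measure) = sinc (norm y)"
proof -
  define e :: "3 \<Rightarrow> real ^ 3" where "e = (\<lambda>i. axis i 1)"
  have ee: "e i \<bullet> e j = (if i = j then 1 else 0)" for i j
    by (simp add: e_def inner_axis_axis)
  let ?w0 = "wave one_fun 0"
  define c where "c = (\<lambda>y. inner (wave one_fun y) ?w0)"
  define c1 where "c1 = (\<lambda>v y. inner (wave (dmult v one_fun) y) ?w0)"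
  define c2 where "c2 = (\<lambda>v y. inner (wave (dmult v (dmult v one_fun)) y) ?w0)"
  have c_eq: "c y = (\<integral>\<omega>. cos (\<omega> \<bullet> y) \<partial>sphere_measure)" for y
    by (simp add: c_def inner_wave_1)
  have dc: "((\<lambda>t. c (a + t *\<^sub>R v)) has_real_derivative c1 v (a + t *\<^sub>R v)) (at t)" for a v t
    unfolding c_def c1_def by (intro DERIV_inner_wave_line continuous_intros)
  have dc1: "((\<lambda>t. c1 v (a + t *\<^sub>R v)) has_real_derivative c2 v (a + t *\<^sub>R v)) (at t)" for a v t
    unfolding c1_def c2_def by (intro DERIV_inner_wave_line continuous_intros)
  have c0: "c 0 = 1" "c1 v 0 = 0" for v
    by (simp_all add: c_def c1_def inner_wave_1 inner_wave_d)
  define h where "h = (\<lambda>t. c (t *\<^sub>R e 1))"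
  define h1 where "h1 = (\<lambda>t. c1 (e 1) (t *\<^sub>R e 1))"
  define h2 where "h2 = (\<lambda>t. c2 (e 1) (t *\<^sub>R e 1))"
  have dh: "(h has_real_derivative h1 t) (at t)" for t
    using dc[of 0 "e 1" t] by (simp add: h_def h1_def)
  have dh1: "(h1 has_real_derivative h2 t) (at t)" for t
    using dc1[of "e 1" 0 t] by (simp add: h2_def h1_def)
  \<comment> \<open>Along a line orthogonal to the ray the profile is evaluated at sqrt (t^2 +
    \<tau>^2); its second derivative at \<tau> = 0 is the contribution of one transversal direction
    to the Laplacian.\<close>
  have radial: "c2 (e i) (t *\<^sub>R e 1) = h1 t / t" if t: "t > 0" and i: "i \<noteq> 1" for t i
  proof -
    let ?y = "\<lambda>\<tau>. t *\<^sub>R e 1 + \<tau> *\<^sub>R e i" and ?r = "\<lambda>\<tau>. sqrt (t\<^sup>2 + \<tau>\<^sup>2)"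
    have pos: "t\<^sup>2 + \<tau>\<^sup>2 > 0" for \<tau>
      using t by (simp add: add_pos_nonneg)
    have ny: "norm (?y \<tau>) = ?r \<tau>" for \<tau>
      unfolding norm_eq_sqrt_inner using i
      by (simp add: inner_add_left inner_add_right ee power2_eq_square)
    have "c (?y \<tau>) = h (?r \<tau>)" for \<tau>
      unfolding h_def c_eq using ny ee[of 1 1]
      by (intro integral_cos_norm) (simp add: norm_eq_sqrt_inner)
    then have ceq: "(\<lambda>\<tau>. c (?y \<tau>)) = (\<lambda>\<tau>. h (?r \<tau>))" by simp
    have "(?r has_real_derivative \<tau> / ?r \<tau>) (at \<tau>)" for \<tau>
      using pos[of \<tau>] by (auto intro!: derivative_eq_intros simp: field_simps)
    then have "((\<lambda>\<tau>. h (?r \<tau>)) has_real_derivative h1 (?r \<tau>) * (\<tau> / ?r \<tau>)) (at \<tau>)" for \<tau>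
      by (rule DERIV_chain2[OF dh])
    then have c1_eq: "c1 (e i) (?y \<tau>) = h1 (?r \<tau>) * (\<tau> / ?r \<tau>)" for \<tau>
      using dc[of "t *\<^sub>R e 1" "e i" \<tau>] unfolding ceq by (blast intro: DERIV_unique)
    have "((\<lambda>\<tau>. h1 (?r \<tau>) * (\<tau> / ?r \<tau>)) has_real_derivative h1 t / t) (at 0)"
      using t pos[of 0]
      by (auto intro!: DERIV_chain2[OF dh1] derivative_eq_intros simp: field_simps)
    moreover have "((\<lambda>\<tau>. h1 (?r \<tau>) * (\<tau> / ?r \<tau>)) has_real_derivative c2 (e i) (t *\<^sub>R e 1)) (at 0)"
      using dc1[of "e i" "t *\<^sub>R e 1" 0] unfolding c1_eq by simp
    ultimately show ?thesis by (blast intro: DERIV_unique)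
  qed
  have helmholtz: "h2 t + 2 * (h1 t / t) = - h t" if t: "t > 0" for t
  proof -
    let ?I = "\<lambda>i. \<lambda>\<omega>. - ((\<omega> \<bullet> e i) * (\<omega> \<bullet> e i) * cos (\<omega> \<bullet> (t *\<^sub>R e 1)))"
    have int: "integrable sphere_measure (?I i)" for i
      by (intro integrable_sphere_continuous continuous_intros)
    have "h2 t + 2 * (h1 t / t) = c2 (e 1) (t *\<^sub>R e 1) + (c2 (e 2) (t *\<^sub>R e 1) + c2 (e 3) (t *\<^sub>R e 1))"
      using radial[OF t, of 2] radial[OF t, of 3] by (simp add: h2_def)
    also have "\<dots> = (\<integral>\<omega>. ?I 1 \<omega> + (?I 2 \<omega> + ?I 3 \<omega>) \<partial>sphere_measure)"
      unfolding c2_def inner_wave_dd diff_zero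
      by (simp only: Bochner_Integration.integral_add int Bochner_Integration.integrable_add)
    also have "\<dots> = (\<integral>\<omega>. - cos (\<omega> \<bullet> (t *\<^sub>R e 1)) \<partial>sphere_measure)"
    proof (rule integral_sphere_cong)
      fix \<omega> :: "real ^ 3" assume w: "norm \<omega> = 1"
      have "?I 1 \<omega> + (?I 2 \<omega> + ?I 3 \<omega>) =
          - (((\<omega> \<bullet> e 1)\<^sup>2 + (\<omega> \<bullet> e 2)\<^sup>2 + (\<omega> \<bullet> e 3)\<^sup>2) * cos (\<omega> \<bullet> (t *\<^sub>R e 1)))"
        by (simp add: algebra_simps power2_eq_square)
      then show "?I 1 \<omega> + (?I 2 \<omega> + ?I 3 \<omega>) = - cos (\<omega> \<bullet> (t *\<^sub>R e 1))"
        using orthonormal_expansion_3[of \<omega>] w by (simp add: e_def)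
    qed (intro continuous_intros)+
    also have "\<dots> = - h t" by (simp add: h_def c_eq)
    finally show ?thesis .
  qed
  have "t * h t = sin t" if t: "t > 0" for t
  proof -
    \<comment> \<open>The energy of w'' = - w for w = t h(t) - sin t. It is constant and vanishes at
      0; the equation itself is used only for positive arguments, continuity covers 0.\<close>
    define E where "E = (\<lambda>t. (t * h t - sin t)\<^sup>2 + (h t + t * h1 t - cos t)\<^sup>2)"
    have dE: "(E has_real_derivative 2 * (x * h x - sin x) * (h x + x * h1 x - cos x) +
        2 * (h x + x * h1 x - cos x) * (2 * h1 x + x * h2 x + sin x)) (at x)" for x
      unfolding E_def
      by (auto intro!: derivative_eq_intros DERIV_chain2[OF dh] DERIV_chain2[OF dh1]
          simp: algebra_simps)
    have "E t = E 0"
    proof (rule DERIV_isconst_end[OF t])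
      show "continuous_on {0..t} E"
        by (intro continuous_at_imp_continuous_on ballI DERIV_isCont[OF dE])
      fix x assume x: "0 < x" "x < t"
      have "2 * h1 x + x * h2 x = - (x * h x)"
        using helmholtz[OF x(1)] x(1) by (simp add: field_simps)
      then have "2 * (x * h x - sin x) * (h x + x * h1 x - cos x) +
          2 * (h x + x * h1 x - cos x) * (2 * h1 x + x * h2 x + sin x) = 0"
        by (simp add: algebra_simps)
      then show "(E has_real_derivative 0) (at x)" using dE[of x] by simp
    qed
    also have "E 0 = 0" by (simp add: E_def h_def c0)
    finally show ?thesis unfolding E_def by (simp add: sum_power2_eq_zero_iff)
  qed
  then have h_sinc: "h t = sinc t" if "t \<ge> 0" for t
    using that by (cases "t = 0") (auto simp: h_def c0 field_simps)
  have "c y = h (norm y)"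
    unfolding h_def c_eq using ee[of 1 1] by (intro integral_cos_norm) (simp add: norm_eq_sqrt_inner)
  then show ?thesis using h_sinc by (simp add: c_eq)
qed

lemma sphere_moment_norm:
  fixes u v :: "real ^ 3"
  assumes "norm u = norm v"
  shows "(\<integral>\<omega>. (\<omega> \<bullet> u) ^ n \<partial>sphere_measure) = (\<integral>\<omega>. (\<omega> \<bullet> v) ^ n \<partial>sphere_measure)"
proof -
  obtain f where f: "orthogonal_transformation f" "f u = v"
    using orthogonal_transformation_exists[OF assms] by metis
  have "(\<integral>\<omega>. (\<omega> \<bullet> v) ^ n \<partial>sphere_measure) = (\<integral>\<omega>. (f \<omega> \<bullet> v) ^ n \<partial>sphere_measure)"
    by (rule integral_sphere_orthogonal[OF _ f(1), symmetric]) (intro continuous_intros)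
  also have "\<dots> = (\<integral>\<omega>. (\<omega> \<bullet> u) ^ n \<partial>sphere_measure)"
    using f by (auto simp: orthogonal_transformation_def)
  finally show ?thesis by simp
qed

lemma sphere_second_moment:
  fixes v :: "real ^ 3"
  assumes "norm v = 1"
  shows "(\<integral>\<omega>. (\<omega> \<bullet> v)\<^sup>2 \<partial>sphere_measure) = 1 / 3"
proof -
  let ?I = "\<lambda>v. \<integral>\<omega>. (\<omega> \<bullet> v)\<^sup>2 \<partial>sphere_measure"
  have int: "integrable sphere_measure (\<lambda>\<omega>. (\<omega> \<bullet> v)\<^sup>2)" for v :: "real ^ 3"
    by (intro integrable_sphere_continuous continuous_intros)
  have eq: "?I (axis i 1) = ?I v" for i
    using assms by (intro sphere_moment_norm) (simp add: norm_axis_1)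
  have "?I (axis 1 1) + ?I (axis 2 1) + ?I (axis 3 1) =
      (\<integral>\<omega>. (\<omega> \<bullet> axis 1 1)\<^sup>2 + (\<omega> \<bullet> axis 2 1)\<^sup>2 + (\<omega> \<bullet> axis 3 1)\<^sup>2 \<partial>sphere_measure)"
    by (simp only: Bochner_Integration.integral_add int Bochner_Integration.integrable_add)
  also have "\<dots> = (\<integral>\<omega>. 1 \<partial>sphere_measure)"
    by (rule integral_sphere_cong) (auto intro!: continuous_intros simp: orthonormal_expansion_3)
  finally show ?thesis unfolding eq by simp
qed

text \<open>
  With \<open>M = \<integral> (\<omega> \<bullet> v)^4\<close> and \<open>b\<close> the mixed moment of two axes, rotating by \<open>\<pi>/4\<close> gives \<open>M = 3 b\<close>,
  and expanding \<open>(\<parallel>\<omega>\<parallel>\<^sup>2)\<^sup>2 = 1\<close> gives \<open>3 M + 6 b = 1\<close>.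
\<close>

lemma sphere_fourth_moment:
  fixes v :: "real ^ 3"
  assumes "norm v = 1"
  shows "(\<integral>\<omega>. (\<omega> \<bullet> v) ^ 4 \<partial>sphere_measure) = 1 / 5"
proof -
  let ?I = "\<lambda>v. \<integral>\<omega>. (\<omega> \<bullet> v) ^ 4 \<partial>sphere_measure"
  define e :: "3 \<Rightarrow> real ^ 3" where "e = (\<lambda>i. axis i 1)"
  let ?m = "\<lambda>i j. \<integral>\<omega>. (\<omega> \<bullet> e i)\<^sup>2 * (\<omega> \<bullet> e j)\<^sup>2 \<partial>sphere_measure"
  have ee: "e i \<bullet> e j = (if i = j then 1 else 0)" for i j
    by (simp add: e_def inner_axis_axis)
  have int4: "integrable sphere_measure (\<lambda>\<omega>. (\<omega> \<bullet> v) ^ 4)" for v :: "real ^ 3"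
    by (intro integrable_sphere_continuous continuous_intros)
  have int22: "integrable sphere_measure (\<lambda>\<omega>. (\<omega> \<bullet> u)\<^sup>2 * (\<omega> \<bullet> v)\<^sup>2)" for u v :: "real ^ 3"
    by (intro integrable_sphere_continuous continuous_intros)
  note int = int4 int22 Bochner_Integration.integrable_add integrable_mult_right
  have eq: "?I (e i) = ?I v" for i
    using assms by (intro sphere_moment_norm) (simp add: norm_axis_1 e_def)
  have mixed: "?m i j = ?I v / 3" if ij: "i \<noteq> j" for i j
  proof -
    let ?p = "(1 / sqrt 2) *\<^sub>R (e i + e j)" and ?q = "(1 / sqrt 2) *\<^sub>R (e i - e j)"
    have n: "norm (e i + e j) = sqrt 2" "norm (e i - e j) = sqrt 2"
      using ij by (simp_all add: norm_eq_sqrt_inner inner_add_left inner_add_right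
          inner_diff_left inner_diff_right ee)
    have pq: "?I ?p = ?I v" "?I ?q = ?I v"
      by (rule sphere_moment_norm, simp add: assms n)+
    have r4: "(x / sqrt 2) ^ 4 = x ^ 4 / 4" for x :: real
    proof -
      have "sqrt 2 ^ 4 = ((sqrt 2)\<^sup>2)\<^sup>2" by (simp add: power_mult[symmetric] del: real_sqrt_pow2)
      then show ?thesis by (simp add: power_divide)
    qed
    have "?I ?p + ?I ?q = (\<integral>\<omega>. (\<omega> \<bullet> ?p) ^ 4 + (\<omega> \<bullet> ?q) ^ 4 \<partial>sphere_measure)"
      by (simp only: Bochner_Integration.integral_add int)
    also have "\<dots> = (\<integral>\<omega>. (1/2) * (\<omega> \<bullet> e i) ^ 4 + (1/2) * (\<omega> \<bullet> e j) ^ 4 +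
        3 * ((\<omega> \<bullet> e i)\<^sup>2 * (\<omega> \<bullet> e j)\<^sup>2) \<partial>sphere_measure)"
    proof (rule Bochner_Integration.integral_cong)
      fix \<omega> :: "real ^ 3"
      have p: "\<omega> \<bullet> ?p = (\<omega> \<bullet> e i + \<omega> \<bullet> e j) / sqrt 2" and q: "\<omega> \<bullet> ?q = (\<omega> \<bullet> e i - \<omega> \<bullet> e j) / sqrt 2"
        by (simp_all add: inner_add_right inner_diff_right)
      show "(\<omega> \<bullet> ?p) ^ 4 + (\<omega> \<bullet> ?q) ^ 4 = (1/2) * (\<omega> \<bullet> e i) ^ 4 + (1/2) * (\<omega> \<bullet> e j) ^ 4 +
          3 * ((\<omega> \<bullet> e i)\<^sup>2 * (\<omega> \<bullet> e j)\<^sup>2)"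
        unfolding p q r4 by (simp add: power4_eq_xxxx power2_eq_square field_simps)
    qed simp
    also have "\<dots> = (1/2) * ?I (e i) + (1/2) * ?I (e j) + 3 * ?m i j"
      by (simp only: Bochner_Integration.integral_add integral_mult_right_zero int)
    finally show ?thesis unfolding pq eq by simp
  qed
  have "(1 :: real) = (\<integral>\<omega>. 1 \<partial>sphere_measure)" by simp
  also have "\<dots> = (\<integral>\<omega>. (\<omega> \<bullet> e 1) ^ 4 + (\<omega> \<bullet> e 2) ^ 4 + (\<omega> \<bullet> e 3) ^ 4 +
      2 * ((\<omega> \<bullet> e 1)\<^sup>2 * (\<omega> \<bullet> e 2)\<^sup>2) + 2 * ((\<omega> \<bullet> e 1)\<^sup>2 * (\<omega> \<bullet> e 3)\<^sup>2) +
      2 * ((\<omega> \<bullet> e 2)\<^sup>2 * (\<omega> \<bullet> e 3)\<^sup>2) \<partial>sphere_measure)"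
  proof (rule integral_sphere_cong)
    fix \<omega> :: "real ^ 3" assume "norm \<omega> = 1"
    then have "1 = ((\<omega> \<bullet> e 1)\<^sup>2 + (\<omega> \<bullet> e 2)\<^sup>2 + (\<omega> \<bullet> e 3)\<^sup>2)\<^sup>2"
      using orthonormal_expansion_3[of \<omega>] by (simp add: e_def)
    also have "\<dots> = (\<omega> \<bullet> e 1) ^ 4 + (\<omega> \<bullet> e 2) ^ 4 + (\<omega> \<bullet> e 3) ^ 4 +
      2 * ((\<omega> \<bullet> e 1)\<^sup>2 * (\<omega> \<bullet> e 2)\<^sup>2) + 2 * ((\<omega> \<bullet> e 1)\<^sup>2 * (\<omega> \<bullet> e 3)\<^sup>2) +
      2 * ((\<omega> \<bullet> e 2)\<^sup>2 * (\<omega> \<bullet> e 3)\<^sup>2)"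
      by (simp add: power4_eq_xxxx power2_eq_square algebra_simps)
    finally show "1 = (\<omega> \<bullet> e 1) ^ 4 + (\<omega> \<bullet> e 2) ^ 4 + (\<omega> \<bullet> e 3) ^ 4 +
      2 * ((\<omega> \<bullet> e 1)\<^sup>2 * (\<omega> \<bullet> e 2)\<^sup>2) + 2 * ((\<omega> \<bullet> e 1)\<^sup>2 * (\<omega> \<bullet> e 3)\<^sup>2) +
      2 * ((\<omega> \<bullet> e 2)\<^sup>2 * (\<omega> \<bullet> e 3)\<^sup>2)" .
  qed (intro continuous_intros)+
  also have "\<dots> = ?I (e 1) + ?I (e 2) + ?I (e 3) + 2 * ?m 1 2 + 2 * ?m 1 3 + 2 * ?m 2 3"
    by (simp only: Bochner_Integration.integral_add integral_mult_right_zero int)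
  also have "\<dots> = 5 * ?I v"
    using mixed[of 1 2] mixed[of 1 3] mixed[of 2 3] by (simp add: eq)
  finally show ?thesis by simp
qed

text \<open>The inequality of arithmetic and geometric means reduces this to fourth moments;
  equality holds for u = v.\<close>

lemma sphere_mixed_moment_le:
  fixes u v :: "real ^ 3"
  assumes "norm u = 1" "norm v = 1"
  shows "(\<integral>\<omega>. (\<omega> \<bullet> u)\<^sup>2 * (\<omega> \<bullet> v)\<^sup>2 \<partial>sphere_measure) \<le> 1 / 5"
proof -
  have "(\<integral>\<omega>. (\<omega> \<bullet> u)\<^sup>2 * (\<omega> \<bullet> v)\<^sup>2 \<partial>sphere_measure) \<le>
      (\<integral>\<omega>. (1/2) * (\<omega> \<bullet> u) ^ 4 + (1/2) * (\<omega> \<bullet> v) ^ 4 \<partial>sphere_measure)"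
  proof (rule integral_sphere_mono)
    fix \<omega> :: "real ^ 3"
    show "(\<omega> \<bullet> u)\<^sup>2 * (\<omega> \<bullet> v)\<^sup>2 \<le> (1/2) * (\<omega> \<bullet> u) ^ 4 + (1/2) * (\<omega> \<bullet> v) ^ 4"
      using sum_squares_bound[of "(\<omega> \<bullet> u)\<^sup>2" "(\<omega> \<bullet> v)\<^sup>2"] by simp
  qed (intro continuous_intros)+
  also have "\<dots> = (1/2) * (\<integral>\<omega>. (\<omega> \<bullet> u) ^ 4 \<partial>sphere_measure) + (1/2) * (\<integral>\<omega>. (\<omega> \<bullet> v) ^ 4 \<partial>sphere_measure)"
    by (subst Bochner_Integration.integral_add)
      (auto intro!: integrable_sphere_continuous continuous_intros)
  finally show ?thesis using assms by (simp add: sphere_fourth_moment)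
qed

section \<open>Correlations of plane waves\<close>

lemma sphere_second_moment_scaled:
  fixes w :: "real ^ 3"
  shows "(\<integral>\<omega>. (\<omega> \<bullet> w)\<^sup>2 \<partial>sphere_measure) = (norm w)\<^sup>2 / 3"
proof (cases "w = 0")
  case False
  then have w: "w = norm w *\<^sub>R (w /\<^sub>R norm w)" "norm (w /\<^sub>R norm w) = 1" by simp_all
  have "(\<integral>\<omega>. (\<omega> \<bullet> w)\<^sup>2 \<partial>sphere_measure) =
      (\<integral>\<omega>. (norm w)\<^sup>2 * (\<omega> \<bullet> (w /\<^sub>R norm w))\<^sup>2 \<partial>sphere_measure)"
    by (subst w(1)) (simp only: inner_scaleR_right power_mult_distrib)
  then show ?thesis
    by (simp only: integral_mult_right_zero sphere_second_moment[OF w(2)])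
qed simp

lemma one_minus_cos_le: "1 - cos x \<le> x\<^sup>2 / 2" for x :: real
proof -
  have "(sin (x / 2))\<^sup>2 \<le> (x / 2)\<^sup>2"
    using abs_sin_x_le_abs_x[of "x / 2"] by (rule abs_le_square_iff[THEN iffD1])
  moreover have "cos x = 1 - 2 * (sin (x / 2))\<^sup>2"
    using cos_double_sin[of "x / 2"] by simp
  ultimately show ?thesis by (simp add: power_divide)
qed

lemma norm_wave_one [simp]: "norm (wave one_fun y) = 1"
  using norm_wave_sq[of one_fun y] by (intro power2_eq_imp_eq[of "norm _" 1]) simp_all

lemma norm_wave_d_sq:
  "norm v = 1 \<Longrightarrow> (norm (wave (dmult v one_fun) y))\<^sup>2 = 1 / 3"
  by (subst norm_wave_sq)
    (auto intro!: continuous_intros simp: dmult_def norm_mult sphere_second_moment)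

lemma norm_wave_dd_sq:
  "norm v = 1 \<Longrightarrow> (norm (wave (dmult v (dmult v one_fun)) y))\<^sup>2 = 1 / 5"
  by (subst norm_wave_sq)
    (auto intro!: continuous_intros simp: dmult_def norm_mult power_mult_distrib
      power_add[symmetric] sphere_fourth_moment)

text \<open>Integrates 1 - cos t \<le> t^2 / 2 against the second moment 1/3, in place of a Taylor
  estimate of \<open>sinc\<close>.\<close>

lemma wave_inner_ge: "1 - (norm (y - x))\<^sup>2 / 6 \<le> inner (wave one_fun y) (wave one_fun x)"
proof -
  have "(\<integral>\<omega>. 1 - (1/2) * (\<omega> \<bullet> (y - x))\<^sup>2 \<partial>sphere_measure) \<le>
      (\<integral>\<omega>. cos (\<omega> \<bullet> (y - x)) \<partial>sphere_measure)"
  proof (intro integral_sphere_mono continuous_intros)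
    fix \<omega> :: "real ^ 3"
    show "1 - (1/2) * (\<omega> \<bullet> (y - x))\<^sup>2 \<le> cos (\<omega> \<bullet> (y - x))"
      using one_minus_cos_le[of "\<omega> \<bullet> (y - x)"] by linarith
  qed
  also have "(\<integral>\<omega>. 1 - (1/2) * (\<omega> \<bullet> (y - x))\<^sup>2 \<partial>sphere_measure) =
      1 - (1/2) * (\<integral>\<omega>. (\<omega> \<bullet> (y - x))\<^sup>2 \<partial>sphere_measure)"
    by (subst Bochner_Integration.integral_diff)
      (auto intro!: integrable_sphere_continuous continuous_intros)
  finally show ?thesis by (simp add: inner_wave_1 sphere_second_moment_scaled)
qed

lemma abs_wave_inner_le_1: "\<bar>inner (wave one_fun y) (wave one_fun x)\<bar> \<le> 1"
  using Cauchy_Schwarz_ineq2[of "wave one_fun y" "wave one_fun x"] by simp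

lemma norm_wave_diff_le: "norm (wave one_fun y - wave one_fun x) \<le> norm (y - x) / sqrt 3"
proof (rule power2_le_imp_le)
  have "(norm (wave one_fun y - wave one_fun x))\<^sup>2 = 2 - 2 * inner (wave one_fun y) (wave one_fun x)"
    using power2_norm_eq_inner[of "wave one_fun y"] power2_norm_eq_inner[of "wave one_fun x"]
    by (simp add: power2_norm_eq_inner[of "_ - _"] inner_diff_left inner_diff_right inner_commute)
  then show "(norm (wave one_fun y - wave one_fun x))\<^sup>2 \<le> (norm (y - x) / sqrt 3)\<^sup>2"
    using wave_inner_ge[of y x] by (simp add: power_divide)
qed simp

lemma norm_wave_d: "norm v = 1 \<Longrightarrow> norm (wave (dmult v one_fun) y) = 1 / sqrt 3"
  using norm_wave_d_sq[of v y] by (intro power2_eq_imp_eq[of "norm _" "1 / sqrt 3"]) (simp_all add: power_divide)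

text \<open>The derivative wave is orthogonal to the wave at the same point, so
  \<open>wave one_fun x\<close> may be replaced by its difference to the wave at \<open>y\<close>.
  Both factors of Cauchy-Schwarz then carry 1/sqrt 3.\<close>

lemma abs_wave_d_le:
  assumes "norm v = 1"
  shows "\<bar>inner (wave (dmult v one_fun) y) (wave one_fun x)\<bar> \<le> norm (y - x) / 3"
proof -
  have "inner (wave (dmult v one_fun) y) (wave one_fun y) = 0"
    by (simp add: inner_wave_d)
  then have "\<bar>inner (wave (dmult v one_fun) y) (wave one_fun x)\<bar> =
      \<bar>inner (wave (dmult v one_fun) y) (wave one_fun x - wave one_fun y)\<bar>"
    by (simp add: inner_diff_right)
  also have "\<dots> \<le> norm (wave (dmult v one_fun) y) * norm (wave one_fun x - wave one_fun y)"
    by (rule Cauchy_Schwarz_ineq2)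
  also have "\<dots> \<le> 1 / sqrt 3 * (norm (y - x) / sqrt 3)"
    unfolding norm_wave_d[OF assms] using norm_wave_diff_le[of x y]
    by (intro mult_left_mono) (simp_all add: norm_minus_commute)
  also have "\<dots> = norm (y - x) / 3" by simp
  finally show ?thesis .
qed

text \<open>At \<open>y = x\<close> the correlation is minus the second moment, -1/3. The deviation
  is the integral of (\<omega> . v)^2 (1 - cos), and 1/10 is half the bound 1/5 on mixed fourth
  moments.\<close>

lemma wave_dd_near:
  assumes v: "norm v = 1"
  shows "\<bar>inner (wave (dmult v (dmult v one_fun)) y) (wave one_fun x) + 1 / 3\<bar> \<le> (norm (y - x))\<^sup>2 / 10"
proof -
  let ?d = "y - x"
  have "inner (wave (dmult v (dmult v one_fun)) y) (wave one_fun x) + 1 / 3 =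
      (\<integral>\<omega>. - ((\<omega> \<bullet> v) * (\<omega> \<bullet> v) * cos (\<omega> \<bullet> ?d)) \<partial>sphere_measure) + (\<integral>\<omega>. (\<omega> \<bullet> v)\<^sup>2 \<partial>sphere_measure)"
    by (simp add: inner_wave_dd sphere_second_moment v)
  also have "\<dots> = (\<integral>\<omega>. (\<omega> \<bullet> v)\<^sup>2 * (1 - cos (\<omega> \<bullet> ?d)) \<partial>sphere_measure)"
    by (subst Bochner_Integration.integral_add[symmetric])
      (auto intro!: integrable_sphere_continuous continuous_intros simp: algebra_simps power2_eq_square)
  finally have eq: "inner (wave (dmult v (dmult v one_fun)) y) (wave one_fun x) + 1 / 3 =
      (\<integral>\<omega>. (\<omega> \<bullet> v)\<^sup>2 * (1 - cos (\<omega> \<bullet> ?d)) \<partial>sphere_measure)" .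
  have ge: "0 \<le> (\<integral>\<omega>. (\<omega> \<bullet> v)\<^sup>2 * (1 - cos (\<omega> \<bullet> ?d)) \<partial>sphere_measure)"
    by (intro Bochner_Integration.integral_nonneg) simp
  have "(\<integral>\<omega>. (\<omega> \<bullet> v)\<^sup>2 * (1 - cos (\<omega> \<bullet> ?d)) \<partial>sphere_measure) \<le>
      (\<integral>\<omega>. (1/2) * ((\<omega> \<bullet> v)\<^sup>2 * (\<omega> \<bullet> ?d)\<^sup>2) \<partial>sphere_measure)"
  proof (rule integral_sphere_mono)
    fix \<omega> :: "real ^ 3"
    show "(\<omega> \<bullet> v)\<^sup>2 * (1 - cos (\<omega> \<bullet> ?d)) \<le> (1/2) * ((\<omega> \<bullet> v)\<^sup>2 * (\<omega> \<bullet> ?d)\<^sup>2)"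
      using mult_left_mono[OF one_minus_cos_le[of "\<omega> \<bullet> ?d"], of "(\<omega> \<bullet> v)\<^sup>2"] by simp
  qed (intro continuous_intros)+
  also have "\<dots> = (1/2) * (\<integral>\<omega>. (\<omega> \<bullet> v)\<^sup>2 * (\<omega> \<bullet> ?d)\<^sup>2 \<partial>sphere_measure)"
    by (rule integral_mult_right_zero)
  also have "(\<integral>\<omega>. (\<omega> \<bullet> v)\<^sup>2 * (\<omega> \<bullet> ?d)\<^sup>2 \<partial>sphere_measure) \<le> (norm ?d)\<^sup>2 * (1 / 5)"
  proof (cases "?d = 0")
    case False
    define e where "e = ?d /\<^sub>R norm ?d"
    have e: "norm e = 1" "?d = norm ?d *\<^sub>R e" using False by (auto simp: e_def)
    have "(\<integral>\<omega>. (\<omega> \<bullet> v)\<^sup>2 * (\<omega> \<bullet> ?d)\<^sup>2 \<partial>sphere_measure) =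
        (\<integral>\<omega>. (norm ?d)\<^sup>2 * ((\<omega> \<bullet> v)\<^sup>2 * (\<omega> \<bullet> e)\<^sup>2) \<partial>sphere_measure)"
      by (subst e(2)) (simp only: inner_scaleR_right power_mult_distrib mult_ac)
    also have "\<dots> = (norm ?d)\<^sup>2 * (\<integral>\<omega>. (\<omega> \<bullet> v)\<^sup>2 * (\<omega> \<bullet> e)\<^sup>2 \<partial>sphere_measure)"
      by (rule integral_mult_right_zero)
    finally show ?thesis
      using mult_left_mono[OF sphere_mixed_moment_le[OF v e(1)], of "(norm ?d)\<^sup>2"] by simp
  qed simp
  finally show ?thesis unfolding eq using ge by simp
qed

section \<open>Decay of the correlations with the distance\<close>

lemma bdd_above_c_nu: "bdd_above ((\<lambda>t :: real. \<bar>t * cos t - sin t\<bar> / t) ` {0<..})"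
proof (rule bdd_aboveI2)
  fix t :: real assume t: "t \<in> {0<..}"
  have "\<bar>t * cos t - sin t\<bar> \<le> \<bar>t * cos t\<bar> + \<bar>sin t\<bar>" by (rule abs_triangle_ineq4)
  also have "\<dots> \<le> t + t"
  proof (rule add_mono)
    show "\<bar>t * cos t\<bar> \<le> t" using t by (simp add: abs_mult mult_left_le)
    show "\<bar>sin t\<bar> \<le> t" using t abs_sin_x_le_abs_x[of t] by simp
  qed
  finally show "\<bar>t * cos t - sin t\<bar> / t \<le> 2" using t by (simp add: field_simps)
qed

lemma c_nu_bound: "t > 0 \<Longrightarrow> \<bar>t * cos t - sin t\<bar> / t \<le> c_nu"
  unfolding c_nu_def by (rule cSUP_upper[OF _ bdd_above_c_nu]) simp

text \<open>The value at t = \<pi> is exactly 1. Hence \<open>c_nu / dist\<close> also dominates the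
  decay 1 / dist of the plain correlations, and one constant serves all orders.\<close>

lemma c_nu_ge_1: "1 \<le> c_nu"
  using c_nu_bound[of pi] by simp

text \<open>The derivative of t cos t - sin t is - t sin t, of modulus at most t; so t^2 / 2 plus or
  minus this function is nondecreasing from 0.\<close>

lemma abs_t_cos_minus_sin_le:
  fixes t :: real
  assumes "t > 0"
  shows "\<bar>t * cos t - sin t\<bar> \<le> t\<^sup>2 / 2"
proof -
  have "0\<^sup>2 / 2 - (0 * cos 0 - sin 0) \<le> t\<^sup>2 / 2 - (t * cos t - sin t)"
  proof (rule DERIV_nonneg_imp_nondecreasing[of 0 t "\<lambda>t. t\<^sup>2 / 2 - (t * cos t - sin t)"])
    fix x :: real assume x: "0 \<le> x"
    have "((\<lambda>t. t\<^sup>2 / 2 - (t * cos t - sin t)) has_real_derivative x * (1 + sin x)) (at x)"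
      by (auto intro!: derivative_eq_intros simp: algebra_simps)
    moreover have "0 \<le> x * (1 + sin x)"
      using x sin_ge_minus_one[of x] by (intro mult_nonneg_nonneg) linarith+
    ultimately show "\<exists>y. ((\<lambda>t. t\<^sup>2 / 2 - (t * cos t - sin t)) has_real_derivative y) (at x) \<and> 0 \<le> y"
      by blast
  qed (use assms in simp)
  moreover have "0\<^sup>2 / 2 + (0 * cos 0 - sin 0) \<le> t\<^sup>2 / 2 + (t * cos t - sin t)"
  proof (rule DERIV_nonneg_imp_nondecreasing[of 0 t "\<lambda>t. t\<^sup>2 / 2 + (t * cos t - sin t)"])
    fix x :: real assume "0 \<le> x"
    then show "\<exists>y. ((\<lambda>t. t\<^sup>2 / 2 + (t * cos t - sin t)) has_real_derivative y) (at x) \<and> 0 \<le> y"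
      by (intro exI[of _ "x * (1 - sin x)"])
        (auto intro!: derivative_eq_intros mult_nonneg_nonneg simp: algebra_simps mult_left_le)
  qed (use assms in simp)
  ultimately show ?thesis by (intro abs_leI) simp_all
qed

text \<open>This is sinc'(s) / s, so the gradient of sinc |d| in d is \<open>sinc_slope\<close> at
  |d|, times d.\<close>

definition sinc_slope :: "real \<Rightarrow> real" where
  "sinc_slope s = (s * cos s - sin s) / s ^ 3"

lemma DERIV_norm_line:
  fixes d v :: "'a :: real_inner"
  assumes "d \<noteq> 0"
  shows "((\<lambda>t. norm (d + t *\<^sub>R v)) has_real_derivative (d \<bullet> v) / norm d) (at 0)"
proof -
  have "norm (d + t *\<^sub>R v) = sqrt ((norm d)\<^sup>2 + 2 * t * (d \<bullet> v) + t\<^sup>2 * (v \<bullet> v))" for t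
    unfolding norm_eq_sqrt_inner[of "d + _"] power2_norm_eq_inner
    by (simp add: inner_add_left inner_add_right inner_commute power2_eq_square algebra_simps)
  moreover have "((\<lambda>t. sqrt ((norm d)\<^sup>2 + 2 * t * (d \<bullet> v) + t\<^sup>2 * (v \<bullet> v))) has_real_derivative
      (d \<bullet> v) / norm d) (at 0)"
    using assms by (auto intro!: derivative_eq_intros simp: field_simps)
  ultimately show ?thesis by simp
qed

lemma wave_d_explicit:
  assumes "y \<noteq> x"
  shows "inner (wave (dmult v one_fun) y) (wave one_fun x) =
    sinc_slope (norm (y - x)) * ((y - x) \<bullet> v)"
    (is "?l = ?r")
proof -
  let ?d = "y - x"
  let ?f = "\<lambda>t. inner (wave one_fun (y + t *\<^sub>R v)) (wave one_fun x)"
  let ?p = "\<lambda>t. norm (?d + t *\<^sub>R v)"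
  have f: "?f t = sinc (?p t)" for t
    by (simp only: inner_wave_1 integral_cos_sphere add_diff_eq diff_add_eq)
  have pos: "norm ?d > 0" using assms by simp
  have dp: "(?p has_real_derivative (?d \<bullet> v) / norm ?d) (at 0)"
    using assms by (intro DERIV_norm_line) simp
  have ds: "((\<lambda>s. sin s / s) has_real_derivative sinc_slope s * s) (at s)" if "s > 0" for s :: real
    using that
    by (auto intro!: derivative_eq_intros simp: sinc_slope_def power2_eq_square power3_eq_cube field_simps)
  have "(sinc has_real_derivative sinc_slope s * s) (at s)" if "s > 0" for s :: real
    by (rule has_field_derivative_transform_within_open[OF ds[OF that], of "{0<..}"]) (use that in auto)
  then have dsp: "(sinc has_real_derivative sinc_slope (norm ?d) * norm ?d) (at (?p 0))"
    using pos by simp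
  have "(?f has_real_derivative sinc_slope (norm ?d) * norm ?d * ((?d \<bullet> v) / norm ?d)) (at 0)"
    unfolding f by (rule DERIV_chain2[OF dsp dp])
  moreover have "(?f has_real_derivative ?l) (at 0)"
    using DERIV_inner_wave_line[of one_fun y v "wave one_fun x" 0] by simp
  ultimately show ?thesis using pos by (auto dest: DERIV_unique)
qed

lemma wave_dd_explicit:
  assumes "y \<noteq> x"
  shows "inner (wave (dmult v (dmult v one_fun)) y) (wave one_fun x) =
    - sin (norm (y - x)) / norm (y - x) * (((y - x) \<bullet> v) / norm (y - x))\<^sup>2 +
    sinc_slope (norm (y - x)) * (v \<bullet> v - 3 * (((y - x) \<bullet> v) / norm (y - x))\<^sup>2)"
    (is "?l = ?r")
proof -
  let ?d = "y - x"
  let ?f = "\<lambda>t. inner (wave (dmult v one_fun) (y + t *\<^sub>R v)) (wave one_fun x)"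
  let ?p = "\<lambda>t. norm (?d + t *\<^sub>R v)"
  let ?g = "\<lambda>t. sinc_slope (?p t) * ((?d + t *\<^sub>R v) \<bullet> v)"
  have pos: "norm ?d > 0" using assms by simp
  \<comment> \<open>The formula for the first derivative holds only off \<open>x\<close>. This is an
    open condition satisfied at t = 0, which is enough to differentiate once more.\<close>
  have fg: "?f t = ?g t" if "?p t > 0" for t
  proof -
    have "y + t *\<^sub>R v \<noteq> x" using that by (auto simp: algebra_simps)
    then have "?f t = sinc_slope (norm (y + t *\<^sub>R v - x)) * ((y + t *\<^sub>R v - x) \<bullet> v)"
      by (rule wave_d_explicit)
    then show ?thesis by (simp only: diff_add_eq)
  qed
  have dp: "(?p has_real_derivative (?d \<bullet> v) / norm ?d) (at 0)"
    using assms by (intro DERIV_norm_line) simp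
  have "((\<lambda>s. (s * cos s - sin s) / s ^ 3) has_real_derivative - sin s / s\<^sup>2 - 3 * sinc_slope s / s) (at s)"
    if "s > 0" for s :: real
    using that
    by (auto intro!: derivative_eq_intros simp: sinc_slope_def) (simp add: field_simps eval_nat_numeral)
  then have ds: "(sinc_slope has_real_derivative - sin s / s\<^sup>2 - 3 * sinc_slope s / s) (at s)" if "s > 0" for s
    using that unfolding sinc_slope_def[abs_def] by blast
  then have dsp: "(sinc_slope has_real_derivative
      - sin (norm ?d) / (norm ?d)\<^sup>2 - 3 * sinc_slope (norm ?d) / norm ?d) (at (?p 0))"
    using pos by simp
  have dl: "((\<lambda>t. (?d + t *\<^sub>R v) \<bullet> v) has_real_derivative v \<bullet> v) (at 0)"
    by (auto intro!: derivative_eq_intros simp: inner_add_left)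
  have "(?g has_real_derivative
      (- sin (norm ?d) / (norm ?d)\<^sup>2 - 3 * sinc_slope (norm ?d) / norm ?d) * ((?d \<bullet> v) / norm ?d)
        * ((?d + 0 *\<^sub>R v) \<bullet> v) + v \<bullet> v * sinc_slope (?p 0)) (at 0)"
    by (rule DERIV_mult[OF DERIV_chain2[OF dsp dp] dl])
  then have "(?f has_real_derivative
      (- sin (norm ?d) / (norm ?d)\<^sup>2 - 3 * sinc_slope (norm ?d) / norm ?d) * ((?d \<bullet> v) / norm ?d)
        * ((?d + 0 *\<^sub>R v) \<bullet> v) + v \<bullet> v * sinc_slope (?p 0)) (at 0)"
  proof (rule has_field_derivative_transform_within_open)
    show "open {t. ?p t > 0}"
      by (intro open_Collect_less continuous_intros)
  qed (use pos fg in auto)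
  moreover have "(?f has_real_derivative ?l) (at 0)"
    using DERIV_inner_wave_line[of "dmult v one_fun" y v "wave one_fun x" 0]
    by (simp add: continuous_dmult)
  ultimately have "?l = (- sin (norm ?d) / (norm ?d)\<^sup>2 - 3 * sinc_slope (norm ?d) / norm ?d) * ((?d \<bullet> v) / norm ?d)
        * (?d \<bullet> v) + v \<bullet> v * sinc_slope (norm ?d)"
    by (auto dest: DERIV_unique)
  also have "\<dots> = ?r" using pos by (simp add: field_simps power2_eq_square)
  finally show ?thesis .
qed

lemma abs_wave_inner_far:
  assumes "y \<noteq> x"
  shows "\<bar>inner (wave one_fun y) (wave one_fun x)\<bar> \<le> 1 / norm (y - x)"
  using assms by (simp add: inner_wave_1 integral_cos_sphere divide_right_mono)

text \<open>With \<open>r\<close> the distance and \<open>c\<close> the cosine of the angle to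
  \<open>v\<close>, the first derivative uses |slope| \<le> c_nu / r^2 and the second |slope| \<le>
  1 / (2 r). The constant 2 bounds c^2 + |1 - 3 c^2| / 2, as both summands are at most 1.\<close>

lemma wave_derivatives_far:
  assumes v: "norm v = 1" and yx: "y \<noteq> x"
  shows "\<bar>inner (wave (dmult v one_fun) y) (wave one_fun x)\<bar> \<le> c_nu / norm (y - x)"
    and "\<bar>inner (wave (dmult v (dmult v one_fun)) y) (wave one_fun x)\<bar> \<le> 2 / norm (y - x)"
proof -
  define r where "r = norm (y - x)"
  define c where "c = ((y - x) \<bullet> v) / r"
  have r: "r > 0" using yx by (simp add: r_def)
  have "\<bar>(y - x) \<bullet> v\<bar> \<le> r" using Cauchy_Schwarz_ineq2[of "y - x" v] v by (simp add: r_def)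
  then have c: "\<bar>c\<bar> \<le> 1" using r by (simp add: c_def)
  then have c2: "c\<^sup>2 \<le> 1" by (simp add: abs_square_le_1)
  have dv: "(y - x) \<bullet> v = c * r" using r by (simp add: c_def)
  have sl: "\<bar>sinc_slope r\<bar> * r = \<bar>r * cos r - sin r\<bar> / r / r"
    using r by (simp add: sinc_slope_def abs_divide power3_eq_cube)
  have s1: "\<bar>sinc_slope r\<bar> * r \<le> c_nu / r"
    unfolding sl using c_nu_bound[OF r] r by (intro divide_right_mono) auto
  have s2: "\<bar>sinc_slope r\<bar> \<le> 1 / 2 * (1 / r)"
    using abs_t_cos_minus_sin_le[OF r] r
    by (simp add: sinc_slope_def abs_divide field_simps power2_eq_square power3_eq_cube)
  have "\<bar>inner (wave (dmult v one_fun) y) (wave one_fun x)\<bar> = \<bar>sinc_slope r\<bar> * r * \<bar>c\<bar>"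
    using r by (simp add: wave_d_explicit[OF yx] r_def[symmetric] dv abs_mult mult_ac)
  also have "\<dots> \<le> c_nu / r * 1"
    using s1 c c_nu_ge_1 r by (intro mult_mono) auto
  finally show "\<bar>inner (wave (dmult v one_fun) y) (wave one_fun x)\<bar> \<le> c_nu / norm (y - x)"
    by (simp add: r_def)
  have "inner (wave (dmult v (dmult v one_fun)) y) (wave one_fun x) =
      - sin r / r * c\<^sup>2 + sinc_slope r * (1 - 3 * c\<^sup>2)"
    using v by (simp add: wave_dd_explicit[OF yx] r_def[symmetric] c_def power2_norm_eq_inner[symmetric])
  also have "\<bar>\<dots>\<bar> \<le> \<bar>sin r / r\<bar> * c\<^sup>2 + \<bar>sinc_slope r\<bar> * \<bar>1 - 3 * c\<^sup>2\<bar>"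
    using abs_triangle_ineq[of "- sin r / r * c\<^sup>2" "sinc_slope r * (1 - 3 * c\<^sup>2)"]
    by (simp add: abs_mult)
  also have "\<dots> \<le> 1 / r * c\<^sup>2 + 1 / 2 * (1 / r) * \<bar>1 - 3 * c\<^sup>2\<bar>"
    using s2 r abs_sin_le_one[of r] by (intro add_mono mult_right_mono) (auto simp: divide_right_mono)
  also have "\<dots> = 1 / r * (c\<^sup>2 + 1 / 2 * \<bar>1 - 3 * c\<^sup>2\<bar>)" by (simp add: algebra_simps)
  also have "\<dots> \<le> 1 / r * 2"
  proof (rule mult_left_mono)
    have "\<bar>1 - 3 * c\<^sup>2\<bar> \<le> 2"
      using c2 zero_le_power2[of c] unfolding abs_le_iff by linarith
    then show "c\<^sup>2 + 1 / 2 * \<bar>1 - 3 * c\<^sup>2\<bar> \<le> 2"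
      using add_mono[OF c2 mult_left_mono[of _ 2 "1 / 2"]] by simp
  qed (use r in simp)
  finally show "\<bar>inner (wave (dmult v (dmult v one_fun)) y) (wave one_fun x)\<bar> \<le> 2 / norm (y - x)"
    by (simp add: r_def)
qed

section \<open>Packing estimates\<close>

text \<open>The balls of radius d/2 about the points are disjoint and lie in one ball of radius R +
  d/2; the volume of the unit ball cancels.\<close>

lemma packing_card:
  fixes S :: "(real ^ 3) set"
  assumes S: "finite S" "S \<subseteq> cball z R" and d: "d > 0" "R \<ge> 0"
    and sep: "\<And>x y. x \<in> S \<Longrightarrow> y \<in> S \<Longrightarrow> x \<noteq> y \<Longrightarrow> d \<le> dist x y"
  shows "real (card S) * (d / 2) ^ 3 \<le> (R + d / 2) ^ 3"
proof -
  let ?c = "measure lborel (ball (0 :: real ^ 3) 1)"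
  have c: "?c > 0" by (rule content_ball_pos) simp
  have vol: "measure lborel (ball x r) = r ^ 3 * ?c" if "r \<ge> 0" for x :: "real ^ 3" and r
    using content_ball_conv_unit_ball[OF that, of x] by simp
  have fm: "ball x r \<in> fmeasurable lborel" for x :: "real ^ 3" and r
    using emeasure_lborel_ball_finite[of x r] by (intro fmeasurableI) (auto simp: top.not_eq_extremum)
  have "real (card S) * (d / 2) ^ 3 * ?c = (\<Sum>x\<in>S. measure lborel (ball x (d / 2)))"
    unfolding vol[OF less_imp_le[OF half_gt_zero[OF d(1)]]] by simp
  also have "\<dots> = measure lborel (\<Union>x\<in>S. ball x (d / 2))"
  proof (rule measure_UNION'[symmetric, OF S(1) fm])
    have "disjnt (ball x (d / 2)) (ball y (d / 2))" if "x \<in> S" "y \<in> S" "x \<noteq> y" for x y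
      unfolding disjnt_def using sep[OF that] by (intro disjoint_ballI) simp
    then show "pairwise (\<lambda>x y. disjnt (ball x (d / 2)) (ball y (d / 2))) S"
      by (auto simp: pairwise_def)
  qed
  also have "\<dots> \<le> measure lborel (ball z (R + d / 2))"
  proof (rule measure_mono_fmeasurable[OF _ _ fm])
    show "(\<Union>x\<in>S. ball x (d / 2)) \<subseteq> ball z (R + d / 2)"
    proof
      fix w assume "w \<in> (\<Union>x\<in>S. ball x (d / 2))"
      then obtain x where "x \<in> S" "dist x w < d / 2" by auto
      moreover have "dist z x \<le> R" using S(2) \<open>x \<in> S\<close> by auto
      ultimately show "w \<in> ball z (R + d / 2)"
        using dist_triangle[of z w x] by simp
    qed
  qed (use S(1) in \<open>auto intro!: sets.finite_UN\<close>)
  also have "\<dots> = (R + d / 2) ^ 3 * ?c" using d by (intro vol) simp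
  finally show ?thesis using c by simp
qed

text \<open>Bounds a sum after sorting its terms, by removing a term of largest rank at each step.\<close>

lemma sum_le_by_rank:
  fixes f :: "'a \<Rightarrow> real"
  assumes "finite S" and "\<And>T. T \<subseteq> S \<Longrightarrow> T \<noteq> {} \<Longrightarrow> \<exists>k\<in>T. f k \<le> \<psi> (card T)"
  shows "sum f S \<le> (\<Sum>m=1..card S. \<psi> m)"
  using assms
proof (induction "card S" arbitrary: S)
  case 0
  then show ?case by simp
next
  case (Suc n)
  then have "S \<noteq> {}" by auto
  then obtain k where k: "k \<in> S" "f k \<le> \<psi> (card S)" using Suc.prems(2)[of S] by auto
  have n: "card (S - {k}) = n" using Suc.hyps(2) Suc.prems(1) k(1) by simp
  have "sum f (S - {k}) \<le> (\<Sum>m=1..card (S - {k}). \<psi> m)"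
    using Suc.prems n by (intro Suc.hyps(1)) auto
  then have "sum f S \<le> (\<Sum>m=1..n. \<psi> m) + \<psi> (Suc n)"
    using sum.remove[OF Suc.prems(1) k(1), of f] k(2) n Suc.hyps(2) by simp
  then show ?case by (simp add: Suc.hyps(2)[symmetric])
qed

text \<open>Discrete form of integrating x^(-1/3). For consecutive cube roots, a^3 - b^3 = 1, and
  the inductive step 1/a \<le> (3/2) (a^2 - b^2) follows because 3 a (a^2 - b^2) - 2 (a^3 - b^3) is
  (a - b)^2 (a + 2 b).\<close>

lemma sum_inverse_root3_le:
  "(\<Sum>m=1..n. 1 / root 3 (real (m + 1))) \<le> 3 / 2 * (root 3 (real (n + 1)))\<^sup>2"
proof (induction n)
  case (Suc n)
  define a where "a = root 3 (real (Suc n + 1))"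
  define b where "b = root 3 (real (n + 1))"
  have ab: "0 < b" "b < a" by (simp_all add: a_def b_def)
  have cubes: "a ^ 3 - b ^ 3 = 1" by (simp add: a_def b_def)
  have "3 * a * (a\<^sup>2 - b\<^sup>2) - 2 * (a ^ 3 - b ^ 3) = (a - b)\<^sup>2 * (a + 2 * b)"
    by (simp add: algebra_simps power2_eq_square power3_eq_cube)
  then have "3 * a * (a\<^sup>2 - b\<^sup>2) = (a - b)\<^sup>2 * (a + 2 * b) + 2 * 1"
    unfolding cubes by (simp only: diff_eq_eq)
  moreover have "0 \<le> (a - b)\<^sup>2 * (a + 2 * b)" using ab by simp
  ultimately have "2 \<le> 3 * a * (a\<^sup>2 - b\<^sup>2)" by simp
  then have "1 / a \<le> 3 / 2 * (a\<^sup>2 - b\<^sup>2)" using ab by (simp add: field_simps)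
  then have "3 / 2 * b\<^sup>2 + 1 / a \<le> 3 / 2 * a\<^sup>2" by (simp add: algebra_simps)
  then show ?case using Suc.IH by (simp add: a_def b_def)
qed simp

text \<open>Discrete form of integrating x^(-2/3); with a^3 - b^3 = 1 the factor a^2 + a b + b^2 is
  at most 3 a^2.\<close>

lemma sum_inverse_root3_sq_le:
  "(\<Sum>m=1..n. 1 / (root 3 (real m))\<^sup>2) \<le> 3 * root 3 (real n)"
proof (induction n)
  case (Suc n)
  define a where "a = root 3 (real (Suc n))"
  define b where "b = root 3 (real n)"
  have ab: "0 \<le> b" "b < a" by (simp_all add: a_def b_def)
  have "a ^ 3 - b ^ 3 = 1" by (simp add: a_def b_def)
  then have eq: "(a - b) * (a\<^sup>2 + a * b + b\<^sup>2) = 1"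
    by (simp add: algebra_simps power2_eq_square power3_eq_cube)
  have "a * b \<le> a\<^sup>2" "b\<^sup>2 \<le> a\<^sup>2"
    using ab by (auto simp: power2_eq_square intro!: mult_mono)
  then have "a\<^sup>2 + a * b + b\<^sup>2 \<le> 3 * a\<^sup>2" by linarith
  then have "1 \<le> (a - b) * (3 * a\<^sup>2)"
    unfolding eq[symmetric] using ab by (intro mult_left_mono) auto
  then have "1 / a\<^sup>2 \<le> 3 * (a - b)" using ab by (simp add: field_simps)
  then have "3 * b + 1 / a\<^sup>2 \<le> 3 * a" by simp
  then show ?case using Suc.IH by (simp add: a_def b_def)
qed simp

lemma farthest_point:
  fixes T :: "(real ^ 3) set"
  assumes "finite T" "T \<noteq> {}"
  obtains k where "k \<in> T" "T \<subseteq> cball z (dist z k)"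
proof -
  have "Max (dist z ` T) \<in> dist z ` T" using assms by (intro Max_in) auto
  then obtain k where "k \<in> T" "dist z k = Max (dist z ` T)" by (metis imageE)
  then have "k \<in> T" "\<And>x. x \<in> T \<Longrightarrow> dist z x \<le> dist z k"
    using assms by auto
  then show ?thesis by (intro that[of k] subsetI) auto
qed

lemma root3_le_if:
  assumes "real m * (d / 2) ^ 3 \<le> (c * (d / 2)) ^ 3" "d > 0" "c \<ge> 0"
  shows "root 3 (real m) \<le> c"
proof -
  have "real m * (d / 2) ^ 3 \<le> c ^ 3 * (d / 2) ^ 3" using assms(1) by (simp only: power_mult_distrib)
  then have "real m \<le> c ^ 3" using assms(2) by (simp add: field_simps)
  then show ?thesis using assms(3) by (simp add: real_root_le_iff[of 3 "real m" "c ^ 3", symmetric] real_root_power_cancel)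
qed

text \<open>The centre \<open>x\<close> is itself a packed point, hence the shift to m + 1. If the
  farthest of m points is at distance R, then R \<ge> d gives R + d/2 \<le> 3R/2, so m + 1 \<le>
  (3R/d)^3. The 9/2 is 3 from here times 3/2 from the sum of inverse cube roots.\<close>

lemma packing_sum_inverse:
  fixes X :: "(real ^ 3) set"
  assumes X: "finite X" "x \<in> X" and d: "d > 0"
    and sep: "\<And>x y. x \<in> X \<Longrightarrow> y \<in> X \<Longrightarrow> x \<noteq> y \<Longrightarrow> d \<le> dist x y"
  shows "(\<Sum>y\<in>X - {x}. 1 / dist x y) \<le> 9 / 2 * ((root 3 (card X))\<^sup>2 / d)"
proof -
  let ?S = "X - {x}"
  have "(\<Sum>y\<in>?S. 1 / dist x y) \<le> (\<Sum>m=1..card ?S. 3 / d * (1 / root 3 (real (m + 1))))"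
  proof (rule sum_le_by_rank)
    fix T assume T: "T \<subseteq> ?S" "T \<noteq> {}"
    have fT: "finite T" using T(1) X(1) finite_subset by blast
    obtain k where k: "k \<in> T" "T \<subseteq> cball x (dist x k)" by (rule farthest_point[OF fT T(2)])
    have dk: "d \<le> dist x k" using sep[of x k] k(1) T(1) X(2) by auto
    have "real (card (insert x T)) * (d / 2) ^ 3 \<le> (dist x k + d / 2) ^ 3"
    proof (rule packing_card[where z = x])
      show "d \<le> dist a b" if "a \<in> insert x T" "b \<in> insert x T" "a \<noteq> b" for a b
        using that T(1) X(2) by (intro sep) auto
    qed (use fT k d in auto)
    also have "\<dots> \<le> (3 * dist x k / d * (d / 2)) ^ 3"
      using dk d by (intro power_mono) auto
    finally have "root 3 (real (card (insert x T))) \<le> 3 * dist x k / d"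
      by (rule root3_le_if) (use d in auto)
    moreover have "x \<notin> T" using T(1) by blast
    then have "card (insert x T) = card T + 1" using fT by simp
    moreover have "0 < dist x k" using dk d by linarith
    ultimately have "1 / dist x k \<le> 3 / d * (1 / root 3 (real (card T + 1)))"
      using d by (simp add: field_simps)
    then show "\<exists>k\<in>T. 1 / dist x k \<le> 3 / d * (1 / root 3 (real (card T + 1)))"
      using k(1) by blast
  qed (use X in simp)
  also have "\<dots> = 3 / d * (\<Sum>m=1..card ?S. 1 / root 3 (real (m + 1)))"
    by (rule sum_distrib_left[symmetric])
  also have "\<dots> \<le> 3 / d * (3 / 2 * (root 3 (real (card ?S + 1)))\<^sup>2)"
    using d by (intro mult_left_mono sum_inverse_root3_le) auto
  also have "card ?S + 1 = card X" using X by (metis Suc_eq_plus1 card_Suc_Diff1)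
  finally show ?thesis by simp
qed

text \<open>Here \<open>z\<close> need not be one of the points, and R \<ge> d/2 gives only R + d/2
  \<le> 2R, so m \<le> (4R/d)^3. The 48 is 16 = 4^2 times 3 from the sum of inverse squared cube
  roots.\<close>

lemma packing_sum_inverse_sq:
  fixes S :: "(real ^ 3) set"
  assumes S: "finite S" and d: "d > 0"
    and sep: "\<And>x y. x \<in> S \<Longrightarrow> y \<in> S \<Longrightarrow> x \<noteq> y \<Longrightarrow> d \<le> dist x y"
    and far: "\<And>y. y \<in> S \<Longrightarrow> d / 2 \<le> dist z y"
  shows "(\<Sum>y\<in>S. 1 / (dist z y)\<^sup>2) \<le> 48 * root 3 (card S) / d\<^sup>2"
proof -
  have "(\<Sum>y\<in>S. 1 / (dist z y)\<^sup>2) \<le> (\<Sum>m=1..card S. 16 / d\<^sup>2 * (1 / (root 3 (real m))\<^sup>2))"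
  proof (rule sum_le_by_rank)
    fix T assume T: "T \<subseteq> S" "T \<noteq> {}"
    have fT: "finite T" using T(1) S finite_subset by blast
    obtain k where k: "k \<in> T" "T \<subseteq> cball z (dist z k)" by (rule farthest_point[OF fT T(2)])
    have dk: "d / 2 \<le> dist z k" using far k(1) T(1) by auto
    have "real (card T) * (d / 2) ^ 3 \<le> (dist z k + d / 2) ^ 3"
    proof (rule packing_card[where z = z])
      show "d \<le> dist a b" if "a \<in> T" "b \<in> T" "a \<noteq> b" for a b
        using that T(1) by (intro sep) auto
    qed (use fT k d in auto)
    also have "\<dots> \<le> (4 * dist z k / d * (d / 2)) ^ 3"
      using dk d by (intro power_mono) auto
    finally have r: "root 3 (real (card T)) \<le> 4 * dist z k / d"
      by (rule root3_le_if) (use d in auto)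
    have pos: "0 < root 3 (real (card T))" using fT T(2) by (simp add: card_gt_0_iff)
    have dkpos: "0 < dist z k" using dk d by linarith
    have "(root 3 (real (card T)))\<^sup>2 \<le> (4 * dist z k / d)\<^sup>2"
      using r pos by (intro power_mono) auto
    then have "1 / (dist z k)\<^sup>2 \<le> 16 / d\<^sup>2 * (1 / (root 3 (real (card T)))\<^sup>2)"
      using d dkpos pos by (simp add: field_simps)
    then show "\<exists>k\<in>T. 1 / (dist z k)\<^sup>2 \<le> 16 / d\<^sup>2 * (1 / (root 3 (real (card T)))\<^sup>2)"
      using k(1) by blast
  qed fact
  also have "\<dots> = 16 / d\<^sup>2 * (\<Sum>m=1..card S. 1 / (root 3 (real m))\<^sup>2)"
    by (rule sum_distrib_left[symmetric])
  also have "\<dots> \<le> 16 / d\<^sup>2 * (3 * root 3 (real (card S)))"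
    by (intro mult_left_mono sum_inverse_root3_sq_le) auto
  finally show ?thesis by simp
qed

section \<open>The Hessian for exact data and coercivity\<close>

text \<open>Polarization and the parallelogram law on unit vectors, with no loss in the constant. It
  lets all Hessian estimates be made with both directions equal.\<close>

lemma symmetric_form_bound:
  fixes B :: "'a::real_inner \<Rightarrow> 'a \<Rightarrow> real"
  assumes lin: "\<And>v. linear (\<lambda>u. B u v)" and sym: "\<And>u v. B u v = B v u"
    and diag: "\<And>v. \<bar>B v v\<bar> \<le> C * (norm v)\<^sup>2"
  shows "\<bar>B u v\<bar> \<le> C * (norm u * norm v)"
proof -
  have lin2: "linear (B u)" for u
    using lin[of u] by (simp add: sym[of _ u])
  have C: "\<bar>B u v\<bar> \<le> C" if "norm u = 1" "norm v = 1" for u v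
  proof -
    have "4 * B u v = B (u + v) (u + v) - B (u - v) (u - v)"
      using lin lin2 sym[of v u]
      by (simp add: linear_add[OF lin] linear_add[OF lin2] linear_diff[OF lin] linear_diff[OF lin2])
    then have "4 * \<bar>B u v\<bar> \<le> \<bar>B (u + v) (u + v)\<bar> + \<bar>B (u - v) (u - v)\<bar>"
      by linarith
    also have "\<dots> \<le> C * (norm (u + v))\<^sup>2 + C * (norm (u - v))\<^sup>2"
      by (intro add_mono diag)
    also have "\<dots> = C * ((norm (u + v))\<^sup>2 + (norm (u - v))\<^sup>2)" by (simp add: distrib_left)
    also have "(norm (u + v))\<^sup>2 + (norm (u - v))\<^sup>2 = 2 * (norm u)\<^sup>2 + 2 * (norm v)\<^sup>2"
      unfolding power2_norm_eq_inner
      by (simp add: inner_add_left inner_add_right inner_diff_left inner_diff_right)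
    finally show ?thesis using that by simp
  qed
  show ?thesis
  proof (cases "u = 0 \<or> v = 0")
    case True
    then show ?thesis using linear_0[OF lin] linear_0[OF lin2] by auto
  next
    case False
    then have u: "u = norm u *\<^sub>R (u /\<^sub>R norm u)" and v: "v = norm v *\<^sub>R (v /\<^sub>R norm v)" by simp_all
    have "B (a *\<^sub>R x) (b *\<^sub>R y) = a * (b * B x y)" for a b x y
      by (simp only: linear_scale[OF lin] linear_scale[OF lin2] real_scaleR_def mult.left_commute)
    from this[of "norm u" "u /\<^sub>R norm u" "norm v" "v /\<^sub>R norm v"]
    have "B u v = norm u * (norm v * B (u /\<^sub>R norm u) (v /\<^sub>R norm v))"
      unfolding u[symmetric] v[symmetric] .
    also have "\<bar>\<dots>\<bar> = norm u * norm v * \<bar>B (u /\<^sub>R norm u) (v /\<^sub>R norm v)\<bar>"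
      by (simp add: abs_mult)
    also have "\<dots> \<le> norm u * norm v * C"
      using False by (intro mult_left_mono C) auto
    finally show ?thesis by (simp add: mult_ac)
  qed
qed

lemma root_3_powr:
  assumes "n > 0"
  shows "real n powr (2 / 3) = (root 3 (real n))\<^sup>2"
proof -
  have "root 3 (real n) = real n powr (1 / 3)" using assms by (simp add: root_powr_inverse)
  then show ?thesis by (simp add: power2_eq_square powr_add[symmetric])
qed

text \<open>
  The wave number is scaled away: \<open>Y\<close> is \<open>\<kappa> X\<close>, \<open>d\<close> is \<open>\<kappa> \<delta>\<^sub>X\<close>, and the radius \<open>\<rho>\<close> becomes \<open>\<gamma>\<close>.
\<close>

locale wave_config =
  fixes Y :: "(real ^ 3) set" and d \<gamma> \<mu> \<nu> :: real
  assumes finY: "finite Y" "Y \<noteq> {}"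
    and d: "0 < d" and sep: "\<And>x y. x \<in> Y \<Longrightarrow> y \<in> Y \<Longrightarrow> x \<noteq> y \<Longrightarrow> d \<le> dist x y"
    and \<gamma>: "0 < \<gamma>" "\<gamma> \<le> d / 2"
    and \<mu>: "\<mu> = 9 / 2 * (real (card Y) powr (2 / 3) / d)" "\<mu> < 1"
    and \<nu>: "\<nu> = nu_const (card Y) \<mu>"
begin

abbreviation \<phi> :: "real ^ 3 \<Rightarrow> sphere_L2" where "\<phi> \<equiv> wave one_fun"
abbreviation \<phi>1 :: "real ^ 3 \<Rightarrow> real ^ 3 \<Rightarrow> sphere_L2" where "\<phi>1 v \<equiv> wave (dmult v one_fun)"
abbreviation \<phi>2 :: "real ^ 3 \<Rightarrow> real ^ 3 \<Rightarrow> real ^ 3 \<Rightarrow> sphere_L2" where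
  "\<phi>2 u v \<equiv> wave (dmult u (dmult v one_fun))"

abbreviation "V \<equiv> L2.span (\<phi> ` Y)"

lemma V: "fin_dim V"
  using finY by (auto simp: fin_dim_def)

lemma card_pos: "card Y > 0"
  using finY by (simp add: card_gt_0_iff)

lemma \<mu>_nonneg: "0 \<le> \<mu>"
  unfolding \<mu> using d by simp

text \<open>Since (64/27) (9/2)^2 = 48 and s^(4/3) / s = s^(1/3), \<nu> is \<open>c_nu\<close>
  squared times the packing bound for inverse squared distances.\<close>

lemma \<nu>_eq: "\<nu> = c_nu\<^sup>2 * (48 * root 3 (real (card Y)) / d\<^sup>2)"
proof -
  define r where "r = root 3 (real (card Y))"
  have r: "r > 0" "real (card Y) = r ^ 3" using card_pos by (simp_all add: r_def)
  have "\<nu> = 64 * c_nu\<^sup>2 / 27 * ((9 / 2 * (r\<^sup>2 / d))\<^sup>2 / r ^ 3)"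
    unfolding \<nu> nu_const_def \<mu>(1) root_3_powr[OF card_pos] r_def[symmetric]
    by (simp only: r(2))
  also have "\<dots> = c_nu\<^sup>2 * (48 * r / d\<^sup>2)"
    using r d by (simp add: field_simps eval_nat_numeral)
  finally show ?thesis by (simp add: r_def)
qed

lemma \<nu>_nonneg: "0 \<le> \<nu>"
  unfolding \<nu>_eq by simp

lemma inner_\<phi>_sym: "inner (\<phi> x) (\<phi> y) = inner (\<phi> y) (\<phi> x)"
  by (rule inner_commute)

lemma inner_\<phi>_self: "inner (\<phi> x) (\<phi> x) = 1"
  by (simp add: power2_norm_eq_inner[symmetric])

lemma cinner_\<phi>: "cinner (\<phi> x) (\<phi> y) = complex_of_real (inner (\<phi> x) (\<phi> y))"
  by (rule cinner_wave_real) auto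

lemma cinner_\<phi>1: "cinner (\<phi>1 v x) (\<phi> y) = complex_of_real (inner (\<phi>1 v x) (\<phi> y))"
  by (rule cinner_wave_real) (auto intro!: continuous_intros simp: dmult_def)

lemma cinner_\<phi>2: "cinner (\<phi>2 u v x) (\<phi> y) = complex_of_real (inner (\<phi>2 u v x) (\<phi> y))"
  by (rule cinner_wave_real) (auto intro!: continuous_intros simp: dmult_def)

lemma gram_row:
  assumes "x \<in> Y"
  shows "(\<Sum>y\<in>Y - {x}. \<bar>inner (\<phi> x) (\<phi> y)\<bar>) \<le> \<mu>"
proof -
  have "(\<Sum>y\<in>Y - {x}. \<bar>inner (\<phi> x) (\<phi> y)\<bar>) \<le> (\<Sum>y\<in>Y - {x}. 1 / dist x y)"
    unfolding dist_norm by (intro sum_mono abs_wave_inner_far) auto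
  also have "\<dots> \<le> 9 / 2 * ((root 3 (card Y))\<^sup>2 / d)"
    by (rule packing_sum_inverse[OF finY(1) assms d sep])
  finally show ?thesis unfolding \<mu>(1) root_3_powr[OF card_pos] .
qed

lemma
  assumes f: "\<And>y. y \<in> Y \<Longrightarrow> cinner f (\<phi> y) = complex_of_real (a y)"
    and g: "\<And>y. y \<in> Y \<Longrightarrow> cinner g (\<phi> y) = complex_of_real (b y)"
  shows gram_inner: "\<bar>inner (orth_proj V f) g - (\<Sum>y\<in>Y. a y * b y)\<bar> \<le>
      \<mu> / (1 - \<mu>) * (L2_set a Y * L2_set b Y)"
    and gram_norm: "(norm (orth_proj V f))\<^sup>2 \<le> (\<Sum>y\<in>Y. (a y)\<^sup>2) / (1 - \<mu>)"
  by (rule gram_bilinear[OF finY(1) cinner_\<phi> inner_\<phi>_sym inner_\<phi>_self gram_row \<mu>_nonneg \<mu>(2) f g];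
      assumption)+

text \<open>All three correlations decay like a constant over the distance, so packing bounds their
  squares. The constants 1 and \<open>c_nu\<close> fit into \<nu> because \<open>c_nu\<close> is at
  least 1; the constant 2 of the second derivative yields the factor 4.\<close>

lemma tail:
  assumes Z: "Z \<subseteq> Y" and far: "\<And>k. k \<in> Z \<Longrightarrow> d / 2 \<le> dist y k"
  shows "(\<Sum>k\<in>Z. (inner (\<phi> y) (\<phi> k))\<^sup>2) \<le> \<nu>"
    and "norm v = 1 \<Longrightarrow> (\<Sum>k\<in>Z. (inner (\<phi>1 v y) (\<phi> k))\<^sup>2) \<le> \<nu>"
    and "norm v = 1 \<Longrightarrow> (\<Sum>k\<in>Z. (inner (\<phi>2 v v y) (\<phi> k))\<^sup>2) \<le> 4 * \<nu>"
proof -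
  have fZ: "finite Z" using Z finY(1) finite_subset by blast
  have ne: "y \<noteq> k" if "k \<in> Z" for k using far[OF that] d by auto
  have "(\<Sum>k\<in>Z. 1 / (dist y k)\<^sup>2) \<le> 48 * root 3 (card Z) / d\<^sup>2"
    by (rule packing_sum_inverse_sq[OF fZ d]) (use sep Z far in auto)
  also have "\<dots> \<le> 48 * root 3 (card Y) / d\<^sup>2"
    using card_mono[OF finY(1) Z] by (intro divide_right_mono mult_left_mono) auto
  finally have "c_nu\<^sup>2 * (\<Sum>k\<in>Z. 1 / (dist y k)\<^sup>2) \<le> \<nu>"
    unfolding \<nu>_eq by (rule mult_left_mono) simp
  then have S: "(\<Sum>k\<in>Z. (c_nu / dist y k)\<^sup>2) \<le> \<nu>"
    by (simp add: sum_distrib_left power_divide)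
  have c: "1 \<le> c_nu" by (rule c_nu_ge_1)
  have le: "(\<Sum>k\<in>Z. (g k)\<^sup>2) \<le> \<nu>" if g: "\<And>k. k \<in> Z \<Longrightarrow> \<bar>g k\<bar> \<le> c_nu / dist y k" for g :: "_ \<Rightarrow> real"
  proof -
    have "(\<Sum>k\<in>Z. (g k)\<^sup>2) \<le> (\<Sum>k\<in>Z. (c_nu / dist y k)\<^sup>2)"
    proof (rule sum_mono)
      fix k assume "k \<in> Z"
      then have "\<bar>g k\<bar>\<^sup>2 \<le> (c_nu / dist y k)\<^sup>2" by (intro power_mono g) auto
      then show "(g k)\<^sup>2 \<le> (c_nu / dist y k)\<^sup>2" by simp
    qed
    then show ?thesis using S by linarith
  qed
  have lift: "t \<le> c_nu / dist y k" if "t \<le> 1 / dist y k" for t k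
    using order_trans[OF that divide_right_mono[OF c zero_le_dist]] .
  show "(\<Sum>k\<in>Z. (inner (\<phi> y) (\<phi> k))\<^sup>2) \<le> \<nu>"
    using abs_wave_inner_far ne by (intro le lift) (auto simp: dist_norm)
  show "(\<Sum>k\<in>Z. (inner (\<phi>1 v y) (\<phi> k))\<^sup>2) \<le> \<nu>" if "norm v = 1"
    using wave_derivatives_far(1)[OF that] ne by (intro le) (auto simp: dist_norm)
  show "(\<Sum>k\<in>Z. (inner (\<phi>2 v v y) (\<phi> k))\<^sup>2) \<le> 4 * \<nu>" if "norm v = 1"
  proof -
    have "(\<Sum>k\<in>Z. (inner (\<phi>2 v v y) (\<phi> k) / 2)\<^sup>2) \<le> \<nu>"
      using wave_derivatives_far(2)[OF that] ne by (intro le lift) (auto simp: dist_norm)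
    then show ?thesis by (simp add: power_divide sum_divide_distrib[symmetric])
  qed
qed

lemma bdd_above_sinc_sq: "bdd_above ((\<lambda>t. (sin t / t)\<^sup>2) ` {\<gamma>..})"
proof (rule bdd_aboveI2)
  fix t :: real assume "t \<in> {\<gamma>..}"
  then have t: "t > 0" using \<gamma> by auto
  have "\<bar>sin t / t\<bar> \<le> 1" using abs_sin_x_le_abs_x[of t] t by (simp add: abs_divide)
  then show "(sin t / t)\<^sup>2 \<le> 1" by (simp add: abs_square_le_1)
qed

text \<open>By separation only the nearest point \<open>j\<close> can be closer than d/2. Its
  squared correlation is a value of sinc^2 beyond \<gamma>, at most 1 - b; the others contribute
  \<nu>, and inverting the Gram matrix costs the division by 1 - \<mu>.\<close>

lemma coercive_outside:
  assumes out: "\<And>k. k \<in> Y \<Longrightarrow> \<gamma> \<le> dist y k"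
  shows "A_const \<gamma> \<mu> \<nu> \<le> (norm (\<phi> y - orth_proj V (\<phi> y)))\<^sup>2"
proof -
  obtain j where j: "is_arg_min (dist y) (\<lambda>k. k \<in> Y) j"
    using ex_is_arg_min_if_finite[OF finY, of "dist y"] by blast
  then have jY: "j \<in> Y" and near: "\<And>k. k \<in> Y \<Longrightarrow> dist y j \<le> dist y k"
    by (auto simp: is_arg_min_linorder)
  have far: "d / 2 \<le> dist y k" if "k \<in> Y - {j}" for k
    using sep[of j k] that jY near[of k] dist_triangle[of j k y] by (auto simp: dist_commute)
  have "(inner (\<phi> y) (\<phi> j))\<^sup>2 = (sin (dist y j) / dist y j)\<^sup>2"
    using out[OF jY] \<gamma> by (auto simp: inner_wave_1 integral_cos_sphere dist_norm)
  also have "\<dots> \<le> 1 - b_const \<gamma>"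
    using cSUP_upper[OF _ bdd_above_sinc_sq, of "dist y j"] out[OF jY] by (simp add: b_const_def)
  finally have "(\<Sum>k\<in>Y. (inner (\<phi> y) (\<phi> k))\<^sup>2) \<le> 1 - b_const \<gamma> + \<nu>"
    using tail(1)[of "Y - {j}" y] far by (simp add: sum.remove[OF finY(1) jY])
  then have "(\<Sum>k\<in>Y. (inner (\<phi> y) (\<phi> k))\<^sup>2) / (1 - \<mu>) \<le> (1 - b_const \<gamma> + \<nu>) / (1 - \<mu>)"
    using \<mu>(2) by (intro divide_right_mono) auto
  with gram_norm[OF cinner_\<phi> cinner_\<phi>, of y]
  have "(norm (orth_proj V (\<phi> y)))\<^sup>2 \<le> (1 - b_const \<gamma> + \<nu>) / (1 - \<mu>)" by linarith
  moreover have "A_const \<gamma> \<mu> \<nu> = 1 - (1 - b_const \<gamma> + \<nu>) / (1 - \<mu>)"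
    using \<mu>(2) by (simp add: A_const_def field_simps)
  ultimately show ?thesis unfolding norm_orth_proj_complement[OF V] by simp
qed

text \<open>Keeps sqrt A in the domain where \<open>arcsin\<close> inverts the sine.\<close>

lemma A_const_le_1: "A_const \<gamma> \<mu> \<nu> \<le> 1"
proof -
  have "(sin \<gamma> / \<gamma>)\<^sup>2 \<le> (SUP t\<in>{\<gamma>..}. (sin t / t)\<^sup>2)"
    by (intro cSUP_upper bdd_above_sinc_sq) auto
  then have "b_const \<gamma> \<le> 1"
    unfolding b_const_def using zero_le_power2[of "sin \<gamma> / \<gamma>"] by linarith
  then show ?thesis
    using \<mu>(2) \<nu>_nonneg by (simp add: A_const_def field_simps)
qed

text \<open>At the point \<open>j\<close> itself, the term of \<open>j\<close> gives 0 in the first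
  summand and -1/3 in the second, hence the Hessian 2/3 after multiplication by -2.
  \<open>C1_const\<close> collects the products of the l2 norms of the correlation vectors, which
  \<open>gram_inner\<close> multiplies by \<mu> / (1 - \<mu>).\<close>

lemma hessian_exact:
  assumes jY: "j \<in> Y" and near: "dist y j \<le> \<gamma>" and v: "norm v = 1"
  shows "2 * \<bar>inner (orth_proj V (\<phi>1 v y)) (\<phi>1 v y) + inner (orth_proj V (\<phi> y)) (\<phi>2 v v y) + 1 / 3\<bar>
    \<le> C2_const \<gamma> \<mu> \<nu>"
proof -
  define a0 where "a0 = (\<lambda>k. inner (\<phi> y) (\<phi> k))"
  define a1 where "a1 = (\<lambda>k. inner (\<phi>1 v y) (\<phi> k))"
  define a2 where "a2 = (\<lambda>k. inner (\<phi>2 v v y) (\<phi> k))"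
  let ?Z = "Y - {j}"
  have far: "d / 2 \<le> dist y k" if "k \<in> ?Z" for k
    using sep[of j k] that jY near \<gamma> dist_triangle[of j k y] by (auto simp: dist_commute)
  have t0: "(\<Sum>k\<in>?Z. (a0 k)\<^sup>2) \<le> \<nu>" unfolding a0_def using far by (intro tail) auto
  have t1: "(\<Sum>k\<in>?Z. (a1 k)\<^sup>2) \<le> \<nu>" unfolding a1_def using far v by (intro tail) auto
  have t2: "(\<Sum>k\<in>?Z. (a2 k)\<^sup>2) \<le> 4 * \<nu>" unfolding a2_def using far v by (intro tail) auto
  define t where "t = norm (y - j)"
  have t: "0 \<le> t" "t \<le> \<gamma>" using near by (simp_all add: t_def dist_norm)
  have tt: "t\<^sup>2 \<le> \<gamma>\<^sup>2" using t by (intro power_mono)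
  have j0: "\<bar>a0 j\<bar> \<le> 1" "1 - a0 j \<le> t\<^sup>2 / 6"
    using abs_wave_inner_le_1[of y j] wave_inner_ge[of y j] by (simp_all add: a0_def t_def)
  have "\<bar>a1 j\<bar> \<le> t / 3" using abs_wave_d_le[OF v, of y j] by (simp add: a1_def t_def)
  then have "\<bar>a1 j\<bar>\<^sup>2 \<le> (t / 3)\<^sup>2" by (intro power_mono) auto
  then have j1: "(a1 j)\<^sup>2 \<le> t\<^sup>2 / 9" by (simp add: power_divide)
  have j2: "\<bar>a2 j + 1 / 3\<bar> \<le> t\<^sup>2 / 10" using wave_dd_near[OF v, of y j] by (simp add: a2_def t_def)
  have split: "(\<Sum>k\<in>Y. f k) = f j + (\<Sum>k\<in>?Z. f k)" for f :: "_ \<Rightarrow> real"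
    by (rule sum.remove[OF finY(1) jY])
  have n1: "(\<Sum>k\<in>Y. (a1 k)\<^sup>2) \<le> \<gamma>\<^sup>2 / 9 + \<nu>"
    using split[of "\<lambda>k. (a1 k)\<^sup>2"] j1 t1 tt by linarith
  have "(a0 j)\<^sup>2 \<le> 1" using j0(1) by (simp add: abs_square_le_1)
  then have n0: "(\<Sum>k\<in>Y. (a0 k)\<^sup>2) \<le> 1 + \<nu>"
    using split[of "\<lambda>k. (a0 k)\<^sup>2"] t0 by linarith
  have "\<bar>a2 j\<bar> \<le> 1 / 3 + \<gamma>\<^sup>2 / 10" using j2 tt by linarith
  then have "\<bar>a2 j\<bar>\<^sup>2 \<le> (1 / 3 + \<gamma>\<^sup>2 / 10)\<^sup>2" by (intro power_mono) auto
  then have n2: "(\<Sum>k\<in>Y. (a2 k)\<^sup>2) \<le> (1 / 3 + \<gamma>\<^sup>2 / 10)\<^sup>2 + 4 * \<nu>"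
    using split[of "\<lambda>k. (a2 k)\<^sup>2"] t2 by simp
  let ?m = "\<mu> / (1 - \<mu>)"
  have m: "0 \<le> ?m" using \<mu>_nonneg \<mu>(2) by simp
  have e1: "\<bar>inner (orth_proj V (\<phi>1 v y)) (\<phi>1 v y) - (\<Sum>k\<in>Y. a1 k * a1 k)\<bar> \<le> ?m * (\<gamma>\<^sup>2 / 9 + \<nu>)"
  proof -
    have "\<bar>inner (orth_proj V (\<phi>1 v y)) (\<phi>1 v y) - (\<Sum>k\<in>Y. a1 k * a1 k)\<bar> \<le> ?m * (L2_set a1 Y * L2_set a1 Y)"
      unfolding a1_def by (rule gram_inner[OF cinner_\<phi>1 cinner_\<phi>1])
    also have "L2_set a1 Y * L2_set a1 Y = (\<Sum>k\<in>Y. (a1 k)\<^sup>2)"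
      by (simp add: L2_set_def sum_nonneg)
    also have "?m * \<dots> \<le> ?m * (\<gamma>\<^sup>2 / 9 + \<nu>)" by (intro mult_left_mono n1 m)
    finally show ?thesis .
  qed
  let ?c = "sqrt (1 + \<nu>) * sqrt ((1 / 3 + \<gamma>\<^sup>2 / 10)\<^sup>2 + 4 * \<nu>)"
  have e2: "\<bar>inner (orth_proj V (\<phi> y)) (\<phi>2 v v y) - (\<Sum>k\<in>Y. a0 k * a2 k)\<bar> \<le> ?m * ?c"
  proof -
    have "\<bar>inner (orth_proj V (\<phi> y)) (\<phi>2 v v y) - (\<Sum>k\<in>Y. a0 k * a2 k)\<bar> \<le> ?m * (L2_set a0 Y * L2_set a2 Y)"
      unfolding a0_def a2_def by (rule gram_inner[OF cinner_\<phi> cinner_\<phi>2])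
    also have "\<dots> \<le> ?m * ?c"
      using n0 n2 \<nu>_nonneg by (intro mult_left_mono mult_mono m) (auto simp: L2_set_def sum_nonneg)
    finally show ?thesis .
  qed
  have "\<bar>\<Sum>k\<in>?Z. a0 k * a2 k\<bar> \<le> (\<Sum>k\<in>?Z. \<bar>a0 k\<bar> * \<bar>a2 k\<bar>)"
    by (rule order_trans[OF sum_abs]) (simp add: abs_mult)
  also have "\<dots> \<le> L2_set a0 ?Z * L2_set a2 ?Z" by (rule L2_set_mult_ineq)
  also have "\<dots> \<le> sqrt \<nu> * sqrt (4 * \<nu>)"
    using t0 t2 \<nu>_nonneg by (intro mult_mono) (auto simp: L2_set_def sum_nonneg)
  also have "\<dots> = 2 * \<nu>" using \<nu>_nonneg by (simp add: real_sqrt_mult)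
  finally have off: "\<bar>\<Sum>k\<in>?Z. a0 k * a2 k\<bar> \<le> 2 * \<nu>" .
  have offp: "0 \<le> (\<Sum>k\<in>?Z. (a1 k)\<^sup>2)" by (simp add: sum_nonneg)
  \<comment> \<open>Splitting off a2 + 1/3 and 1 - a0 makes both deviations quadratic in the
    distance t.\<close>
  have diag: "\<bar>a0 j * a2 j + 1 / 3\<bar> \<le> t\<^sup>2 / 10 + t\<^sup>2 / 18"
  proof -
    have "a0 j * a2 j + 1 / 3 = a0 j * (a2 j + 1 / 3) + (1 - a0 j) / 3" by (simp add: field_simps)
    also have "\<bar>\<dots>\<bar> \<le> \<bar>a0 j\<bar> * \<bar>a2 j + 1 / 3\<bar> + \<bar>(1 - a0 j) / 3\<bar>"
      using abs_triangle_ineq[of "a0 j * (a2 j + 1 / 3)" "(1 - a0 j) / 3"] by (simp add: abs_mult)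
    also have "\<dots> \<le> 1 * (t\<^sup>2 / 10) + t\<^sup>2 / 6 / 3"
      using j0 j2 by (intro add_mono mult_mono) auto
    finally show ?thesis by simp
  qed
  \<comment> \<open>4/15 is 1/9 + 1/10 + 1/18, from the squared first derivative and the two parts
    of \<open>diag\<close>; 3 \<nu> is \<nu> from the squared first derivatives and 2 \<nu> from the
    mixed products at the other points.\<close>
  have main: "\<bar>(\<Sum>k\<in>Y. a1 k * a1 k) + (\<Sum>k\<in>Y. a0 k * a2 k) + 1 / 3\<bar> \<le> 4 / 15 * \<gamma>\<^sup>2 + 3 * \<nu>"
  proof -
    have "(\<Sum>k\<in>Y. a1 k * a1 k) = (a1 j)\<^sup>2 + (\<Sum>k\<in>?Z. (a1 k)\<^sup>2)"
      unfolding split by (simp add: power2_eq_square)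
    moreover have "(\<Sum>k\<in>Y. a0 k * a2 k) = a0 j * a2 j + (\<Sum>k\<in>?Z. a0 k * a2 k)"
      by (rule split)
    ultimately show ?thesis
      using off offp t1 diag j1 tt zero_le_power2[of "a1 j"] unfolding abs_le_iff by linarith
  qed
  have "\<bar>inner (orth_proj V (\<phi>1 v y)) (\<phi>1 v y) + inner (orth_proj V (\<phi> y)) (\<phi>2 v v y) + 1 / 3\<bar>
      \<le> 4 / 15 * \<gamma>\<^sup>2 + 3 * \<nu> + (?m * (\<gamma>\<^sup>2 / 9 + \<nu>) + ?m * ?c)"
    using main e1 e2 unfolding abs_le_iff by linarith
  also have "?m * (\<gamma>\<^sup>2 / 9 + \<nu>) + ?m * ?c = ?m * C1_const \<gamma> \<nu>"
    unfolding C1_const_def by (simp only: distrib_left)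
  finally show ?thesis unfolding C2_const_def by simp
qed

end

section \<open>Perturbation of the subspace\<close>

locale wave_perturbed = wave_config +
  fixes U :: "sphere_L2 set" and \<eta> :: real
  assumes U: "fin_dim U"
    and close: "\<And>g. norm (orth_proj U g - orth_proj V g) \<le> \<eta> * norm g"
begin

abbreviation "P \<equiv> orth_proj U"

definition Q :: "real ^ 3 \<Rightarrow> real" where
  "Q y = 1 - (norm (P (\<phi> y)))\<^sup>2"

definition dQ :: "real ^ 3 \<Rightarrow> real ^ 3 \<Rightarrow> real" where
  "dQ y v = - 2 * inner (P (\<phi> y)) (\<phi>1 v y)"

text \<open>The adjoint of a linear functional, evaluated at \<open>1\<close>, is its Riesz representative.\<close>

definition gradQ :: "real ^ 3 \<Rightarrow> real ^ 3" where
  "gradQ y = adjoint (dQ y) 1"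

definition hessQ :: "real ^ 3 \<Rightarrow> real ^ 3 \<Rightarrow> real ^ 3 \<Rightarrow> real" where
  "hessQ y u v = - 2 * (inner (P (\<phi>1 u y)) (\<phi>1 v y) + inner (P (\<phi> y)) (\<phi>2 u v y))"

lemma \<eta>_nonneg: "0 \<le> \<eta>"
  using order_trans[OF norm_ge_zero close[of "\<phi> 0"]] by simp

lemma Q_eq: "Q y = (norm (\<phi> y - P (\<phi> y)))\<^sup>2"
  unfolding Q_def norm_orth_proj_complement[OF U] by simp

lemma bounded_linear_\<phi>1: "bounded_linear (\<lambda>v. \<phi>1 v y)"
  by (rule has_derivative_bounded_linear[OF has_derivative_wave]) simp

lemma bounded_linear_\<phi>2: "bounded_linear (\<lambda>u. \<phi>2 u v y)"
  by (rule has_derivative_bounded_linear[OF has_derivative_wave]) (simp add: continuous_dmult)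

lemmas \<phi>1_linear =
  linear_add[OF bounded_linear.linear[OF bounded_linear_\<phi>1]]
  linear_scale[OF bounded_linear.linear[OF bounded_linear_\<phi>1]]

lemmas \<phi>2_linear =
  linear_add[OF bounded_linear.linear[OF bounded_linear_\<phi>2]]
  linear_scale[OF bounded_linear.linear[OF bounded_linear_\<phi>2]]

lemma P_add: "P (f + g) = P f + P g"
  by (rule orth_proj_add[OF U])

lemma P_scaleR: "P (r *\<^sub>R f) = r *\<^sub>R P f"
  unfolding scaleR_sphere_L2_def by (rule orth_proj_scale[OF U])

lemma linear_dQ: "linear (dQ y)"
  by (intro linearI) (simp_all add: dQ_def \<phi>1_linear inner_add_right algebra_simps)

lemma inner_gradQ: "inner v (gradQ y) = dQ y v"
  using adjoint_works[OF linear_dQ, of v y 1] by (simp add: gradQ_def)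

text \<open>Writing the squared norm as the inner product of P \<phi> with \<phi> allows the product
  rule; its two terms agree because P is self-adjoint, whence the factor 2 in
  \<open>dQ\<close>.\<close>

lemma has_derivative_Q: "(Q has_derivative dQ y) (at y)"
proof -
  have \<phi>: "(\<phi> has_derivative (\<lambda>v. \<phi>1 v y)) (at y)" by (rule has_derivative_wave) simp
  have P\<phi>: "((\<lambda>y. P (\<phi> y)) has_derivative (\<lambda>v. P (\<phi>1 v y))) (at y)"
    by (rule bounded_linear.has_derivative[OF bounded_linear_orth_proj[OF U] \<phi>])
  have "((\<lambda>y. 1 - inner (P (\<phi> y)) (\<phi> y)) has_derivative
      (\<lambda>v. 0 - (inner (P (\<phi> y)) (\<phi>1 v y) + inner (P (\<phi>1 v y)) (\<phi> y)))) (at y)"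
    by (intro has_derivative_diff has_derivative_const has_derivative_inner P\<phi> \<phi>)
  moreover have "(\<lambda>v. 0 - (inner (P (\<phi> y)) (\<phi>1 v y) + inner (P (\<phi>1 v y)) (\<phi> y))) = dQ y"
  proof
    fix v
    have "inner (P (\<phi>1 v y)) (\<phi> y) = inner (P (\<phi> y)) (\<phi>1 v y)"
      by (rule trans[OF inner_orth_proj_commute[OF U] inner_commute])
    then show "0 - (inner (P (\<phi> y)) (\<phi>1 v y) + inner (P (\<phi>1 v y)) (\<phi> y)) = dQ y v"
      by (simp add: dQ_def)
  qed
  ultimately show ?thesis
    unfolding Q_def[abs_def] norm_orth_proj_sq[OF U] by simp
qed

lemma DERIV_dQ_line:
  "((\<lambda>t. dQ (y + t *\<^sub>R u) v) has_real_derivative hessQ (y + t *\<^sub>R u) u v) (at t)"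
proof -
  let ?z = "y + t *\<^sub>R u"
  have a: "((\<lambda>t. \<phi> (y + t *\<^sub>R u)) has_vector_derivative \<phi>1 u ?z) (at t)"
    by (rule has_vector_derivative_wave_line) simp
  have b: "((\<lambda>t. \<phi>1 v (y + t *\<^sub>R u)) has_vector_derivative \<phi>2 u v ?z) (at t)"
    by (rule has_vector_derivative_wave_line) (simp add: continuous_dmult)
  have c: "((\<lambda>t. P (\<phi> (y + t *\<^sub>R u))) has_vector_derivative P (\<phi>1 u ?z)) (at t)"
    by (rule bounded_linear.has_vector_derivative[OF bounded_linear_orth_proj[OF U] a])
  have "((\<lambda>t. inner (P (\<phi> (y + t *\<^sub>R u))) (\<phi>1 v (y + t *\<^sub>R u))) has_real_derivative
      inner (P (\<phi> ?z)) (\<phi>2 u v ?z) + inner (P (\<phi>1 u ?z)) (\<phi>1 v ?z)) (at t)"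
    unfolding has_real_derivative_iff_has_vector_derivative
    by (rule bounded_bilinear.has_vector_derivative[OF bounded_bilinear_inner c b])
  from DERIV_cmult[OF this, of "- 2"] show ?thesis
    unfolding dQ_def hessQ_def by (simp add: add.commute)
qed

text \<open>Comes from self-adjointness of P and commutation of the two multipliers, so no theorem
  on mixed partial derivatives is involved.\<close>

lemma hessQ_sym: "hessQ y u v = hessQ y v u"
proof -
  have "dmult u (dmult v one_fun) = dmult v (dmult u one_fun)"
    by (auto simp: dmult_def mult_ac)
  then show ?thesis
    unfolding hessQ_def inner_orth_proj_commute[OF U, of "\<phi>1 u y"] by (simp add: inner_commute)
qed

lemma linear_hessQ: "linear (\<lambda>u. hessQ y u v)"
  by (intro linearI) (simp_all add: hessQ_def \<phi>1_linear \<phi>2_linear P_add P_scaleR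
      inner_add_left inner_add_right algebra_simps)

abbreviation "\<Delta> \<equiv> C2_const \<gamma> \<mu> \<nu> + (2 / sqrt 5 + 2 / 3) * \<eta>"

text \<open>Changing the projector by \<eta> changes the two inner products by \<eta> times the
  norms of their arguments, that is by \<eta> / 3 and \<eta> / sqrt 5; the factor 2 of the Hessian
  doubles both.\<close>

lemma hessQ_unit:
  assumes jY: "j \<in> Y" and near: "dist y j \<le> \<gamma>" and v: "norm v = 1"
  shows "\<bar>hessQ y v v - 2 / 3\<bar> \<le> \<Delta>"
proof -
  let ?a = "inner (orth_proj V (\<phi>1 v y)) (\<phi>1 v y)" and ?b = "inner (orth_proj V (\<phi> y)) (\<phi>2 v v y)"
  let ?a' = "inner (P (\<phi>1 v y)) (\<phi>1 v y)" and ?b' = "inner (P (\<phi> y)) (\<phi>2 v v y)"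
  have n1: "norm (\<phi>1 v y) = 1 / sqrt 3" by (rule norm_wave_d[OF v])
  have n2: "norm (\<phi>2 v v y) = 1 / sqrt 5"
    using norm_wave_dd_sq[OF v, of y]
    by (intro power2_eq_imp_eq[of "norm _" "1 / sqrt 5"]) (simp_all add: power_divide)
  have "\<bar>?a' - ?a\<bar> = \<bar>inner (P (\<phi>1 v y) - orth_proj V (\<phi>1 v y)) (\<phi>1 v y)\<bar>"
    by (simp add: inner_diff_left)
  also have "\<dots> \<le> norm (P (\<phi>1 v y) - orth_proj V (\<phi>1 v y)) * norm (\<phi>1 v y)"
    by (rule Cauchy_Schwarz_ineq2)
  also have "\<dots> \<le> (\<eta> * (1 / sqrt 3)) * (1 / sqrt 3)"
    using close[of "\<phi>1 v y"] unfolding n1 by (intro mult_right_mono) auto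
  finally have a: "\<bar>?a' - ?a\<bar> \<le> \<eta> / 3" by simp
  have "\<bar>?b' - ?b\<bar> = \<bar>inner (P (\<phi> y) - orth_proj V (\<phi> y)) (\<phi>2 v v y)\<bar>"
    by (simp add: inner_diff_left)
  also have "\<dots> \<le> norm (P (\<phi> y) - orth_proj V (\<phi> y)) * norm (\<phi>2 v v y)"
    by (rule Cauchy_Schwarz_ineq2)
  also have "\<dots> \<le> (\<eta> * 1) * (1 / sqrt 5)"
    using close[of "\<phi> y"] unfolding n2 by (intro mult_right_mono) auto
  finally have b: "\<bar>?b' - ?b\<bar> \<le> \<eta> / sqrt 5" by simp
  have "\<bar>hessQ y v v - 2 / 3\<bar> = 2 * \<bar>?a' + ?b' + 1 / 3\<bar>"
    unfolding hessQ_def by (simp add: abs_if)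
  also have "\<dots> \<le> 2 * \<bar>?a + ?b + 1 / 3\<bar> + 2 * (\<eta> / 3 + \<eta> / sqrt 5)"
  proof -
    have "\<bar>x' + y' + 1 / 3\<bar> \<le> \<bar>x + y + 1 / 3\<bar> + (p + r)"
      if "\<bar>x' - x\<bar> \<le> p" "\<bar>y' - y\<bar> \<le> r" for x x' y y' p r :: real
      using that by linarith
    from this[OF a b] show ?thesis by simp
  qed
  also have "\<dots> \<le> C2_const \<gamma> \<mu> \<nu> + 2 * (\<eta> / 3 + \<eta> / sqrt 5)"
    using hessian_exact[OF jY near v] by simp
  also have "\<dots> = \<Delta>" by (simp add: algebra_simps)
  finally show ?thesis .
qed

text \<open>Read off from the Hessian bound at a centre, where \<Delta> dominates an absolute
  value.\<close>

lemma \<Delta>_nonneg: "0 \<le> \<Delta>"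
proof -
  obtain j where "j \<in> Y" using finY(2) by blast
  then have "\<bar>hessQ j (axis 1 1) (axis 1 1) - 2 / 3\<bar> \<le> \<Delta>"
    using \<gamma>(1) by (intro hessQ_unit) (auto simp: norm_axis_1)
  then show ?thesis by linarith
qed

lemma hessQ_bound:
  assumes jY: "j \<in> Y" and near: "dist y j \<le> \<gamma>"
  shows "\<bar>hessQ y u v - 2 / 3 * inner u v\<bar> \<le> \<Delta> * (norm u * norm v)"
proof (rule symmetric_form_bound[where B = "\<lambda>u v. hessQ y u v - 2 / 3 * inner u v"])
  show "linear (\<lambda>u. hessQ y u v - 2 / 3 * inner u v)" for v
    by (intro linearI) (simp_all add: linear_add[OF linear_hessQ] linear_scale[OF linear_hessQ]
        inner_add_left field_simps)
  show "hessQ y u v - 2 / 3 * inner u v = hessQ y v u - 2 / 3 * inner v u" for u v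
    by (simp add: hessQ_sym[of y u] inner_commute)
  show "\<bar>hessQ y v v - 2 / 3 * inner v v\<bar> \<le> \<Delta> * (norm v)\<^sup>2" for v
  proof (cases "v = 0")
    case True
    then show ?thesis using linear_0[OF linear_hessQ] by simp
  next
    case False
    define w where "w = v /\<^sub>R norm v"
    have w: "norm w = 1" "v = norm v *\<^sub>R w" using False by (simp_all add: w_def)
    have "hessQ y v v = norm v * hessQ y w v"
      by (subst (1) w(2)) (simp only: linear_scale[OF linear_hessQ] real_scaleR_def)
    also have "hessQ y w v = norm v * hessQ y w w"
      by (subst hessQ_sym, subst (1) w(2)) (simp only: linear_scale[OF linear_hessQ] real_scaleR_def)
    finally have "hessQ y v v - 2 / 3 * inner v v = (norm v)\<^sup>2 * (hessQ y w w - 2 / 3)"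
      by (simp add: power2_norm_eq_inner[symmetric] power2_eq_square algebra_simps)
    then have "\<bar>hessQ y v v - 2 / 3 * inner v v\<bar> = (norm v)\<^sup>2 * \<bar>hessQ y w w - 2 / 3\<bar>"
      by (simp add: abs_mult)
    also have "\<dots> \<le> (norm v)\<^sup>2 * \<Delta>"
      by (intro mult_left_mono hessQ_unit[OF jY near w(1)]) simp
    finally show ?thesis by (simp add: mult.commute)
  qed
qed

text \<open>Testing with the vector \<open>v\<close> that is to be bounded turns its squared norm
  into the increment of a real function on the segment, to which the mean value theorem applies. The
  segment stays in the ball by convexity.\<close>

lemma gradQ_contraction:
  assumes jY: "j \<in> Y" and y: "y \<in> ball j \<gamma>" and z: "z \<in> ball j \<gamma>"
  shows "norm (gradQ z - gradQ y - (2 / 3) *\<^sub>R (z - y)) \<le> \<Delta> * norm (z - y)"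
proof -
  define w where "w = z - y"
  define v where "v = gradQ z - gradQ y - (2 / 3) *\<^sub>R w"
  let ?F = "\<lambda>t. dQ (y + t *\<^sub>R w) v - 2 / 3 * t * inner w v"
  have "\<exists>t. 0 < t \<and> t < 1 \<and> ?F 1 - ?F 0 = (1 - 0) * (hessQ (y + t *\<^sub>R w) w v - 2 / 3 * inner w v)"
    by (rule MVT2) (auto intro!: derivative_eq_intros DERIV_dQ_line)
  then obtain t where t: "0 < t" "t < 1"
    and eq: "?F 1 - ?F 0 = hessQ (y + t *\<^sub>R w) w v - 2 / 3 * inner w v" by auto
  have "y + t *\<^sub>R w = (1 - t) *\<^sub>R y + t *\<^sub>R z" by (simp add: w_def algebra_simps)
  also have "\<dots> \<in> ball j \<gamma>" using t y z by (intro convexD convex_ball) auto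
  finally have near: "dist (y + t *\<^sub>R w) j \<le> \<gamma>" by (simp add: dist_commute)
  have "(norm v)\<^sup>2 = inner v (gradQ z - gradQ y - (2 / 3) *\<^sub>R w)"
    by (simp add: power2_norm_eq_inner v_def)
  also have "\<dots> = ?F 1 - ?F 0"
    by (simp add: inner_diff_right inner_gradQ inner_commute w_def)
  also have "\<dots> \<le> \<Delta> * (norm w * norm v)"
    unfolding eq using hessQ_bound[OF jY near, of w v] by linarith
  finally have "norm v * norm v \<le> (\<Delta> * norm w) * norm v"
    by (simp add: power2_eq_square mult_ac)
  moreover have "0 \<le> \<Delta> * norm w" by (intro mult_nonneg_nonneg \<Delta>_nonneg) simp
  ultimately have "norm v \<le> \<Delta> * norm w" by (cases "v = 0") auto
  then show ?thesis by (simp add: v_def w_def)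
qed

lemma norm_complement_center:
  assumes "j \<in> Y"
  shows "norm (\<phi> j - P (\<phi> j)) \<le> \<eta>"
proof -
  have "orth_proj V (\<phi> j) = \<phi> j"
    using assms by (intro orth_proj_id[OF V] L2.span_base) auto
  then show ?thesis using close[of "\<phi> j"] by (simp add: norm_minus_commute)
qed

text \<open>The wave is orthogonal to its derivative at the same point, so P \<phi> may be replaced
  by P \<phi> - \<phi>, whose norm at a centre is at most \<eta>.\<close>

lemma norm_gradQ_center:
  assumes "j \<in> Y"
  shows "norm (gradQ j) \<le> 2 * \<eta> / sqrt 3"
proof (cases "gradQ j = 0")
  case True
  then show ?thesis using \<eta>_nonneg by simp
next
  case False
  define v where "v = gradQ j /\<^sub>R norm (gradQ j)"
  have v: "norm v = 1" using False by (simp add: v_def)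
  have "inner (\<phi> j) (\<phi>1 v j) = 0"
    by (simp add: inner_commute[of "\<phi> j"] inner_wave_d)
  then have "inner v (gradQ j) = 2 * inner (\<phi> j - P (\<phi> j)) (\<phi>1 v j)"
    by (simp add: inner_gradQ dQ_def inner_diff_left)
  also have "\<dots> \<le> 2 * (norm (\<phi> j - P (\<phi> j)) * norm (\<phi>1 v j))"
    by (intro mult_left_mono norm_cauchy_schwarz) simp
  also have "\<dots> \<le> 2 * (\<eta> * (1 / sqrt 3))"
    unfolding norm_wave_d[OF v]
    by (intro mult_left_mono mult_right_mono norm_complement_center assms) auto
  finally have "inner v (gradQ j) \<le> 2 * \<eta> / sqrt 3" by simp
  moreover have "inner v (gradQ j) = norm (gradQ j)"
    using False by (simp add: v_def power2_norm_eq_inner[symmetric] power2_eq_square)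
  ultimately show ?thesis by simp
qed

text \<open>\<open>Q\<close> is the squared norm of the complementary projection of \<phi>: a
  difference of squares whose sum factor is at most 2, while \<phi> is Lipschitz with constant
  1/sqrt 3.\<close>

lemma Q_lipschitz: "Q y - Q z \<le> 2 / sqrt 3 * norm (y - z)"
proof -
  define R where "R = (\<lambda>f. f - P f)"
  have R1: "norm (R f) \<le> norm f" for f
    unfolding R_def
    by (rule power2_le_imp_le) (simp_all add: norm_orth_proj_complement[OF U])
  have "R (\<phi> y) - R (\<phi> z) = R (\<phi> y - \<phi> z)"
    using bounded_linear.linear[OF bounded_linear_orth_proj[OF U]] by (simp add: R_def linear_diff)
  then have "norm (R (\<phi> y)) - norm (R (\<phi> z)) \<le> norm (\<phi> y - \<phi> z)"
    using norm_triangle_ineq2[of "R (\<phi> y)" "R (\<phi> z)"] R1[of "\<phi> y - \<phi> z"] by simp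
  also have "\<dots> \<le> norm (y - z) / sqrt 3" by (rule norm_wave_diff_le)
  finally have d: "norm (R (\<phi> y)) - norm (R (\<phi> z)) \<le> norm (y - z) / sqrt 3" .
  have "Q y - Q z = (norm (R (\<phi> y)) - norm (R (\<phi> z))) * (norm (R (\<phi> y)) + norm (R (\<phi> z)))"
    by (simp add: Q_eq R_def power2_eq_square algebra_simps)
  also have "\<dots> \<le> norm (y - z) / sqrt 3 * (norm (R (\<phi> y)) + norm (R (\<phi> z)))"
    by (intro mult_right_mono d) simp
  also have "\<dots> \<le> norm (y - z) / sqrt 3 * 2"
    using R1[of "\<phi> y"] R1[of "\<phi> z"] by (intro mult_left_mono) auto
  finally show ?thesis by (simp add: mult.commute)
qed

lemma Q_center: "j \<in> Y \<Longrightarrow> Q j \<le> \<eta>\<^sup>2"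
  unfolding Q_eq by (intro power_mono norm_complement_center) auto

text \<open>Outside all wells the angle of \<phi> y to \<open>V\<close> is at least a = arcsin (sqrt
  A). An accepted point has angle below a - \<beta> to \<open>U\<close>, hence below a to
  \<open>V\<close> by the triangle inequality for angles.\<close>

lemma accepted_in_well:
  assumes A: "0 < A" "A \<le> A_const \<gamma> \<mu> \<nu>" and \<eta>: "\<eta> < sin (1 / 2 * arcsin (sqrt A))"
    and acc: "Q y < (sin (arcsin (sqrt A) - arcsin \<eta>))\<^sup>2"
  shows "\<exists>j\<in>Y. dist y j < \<gamma>"
proof (rule ccontr)
  assume "\<not> ?thesis"
  then have "A_const \<gamma> \<mu> \<nu> \<le> (norm (\<phi> y - orth_proj V (\<phi> y)))\<^sup>2"
    by (intro coercive_outside) (auto simp: not_less)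
  then have big: "sqrt A \<le> norm (\<phi> y - orth_proj V (\<phi> y))"
    using A by (intro real_le_lsqrt) auto
  have A1: "A \<le> 1" using A A_const_le_1 by linarith
  define a where "a = arcsin (sqrt A)"
  define \<beta> where "\<beta> = arcsin \<eta>"
  define \<alpha> where "\<alpha> = arcsin (norm (\<phi> y - P (\<phi> y)))"
  have a: "0 \<le> a" "a \<le> pi / 2" "sin a = sqrt A"
    unfolding a_def using A A1 arcsin_nonneg[of "sqrt A"] arcsin_ubound[of "sqrt A"]
      order_trans[of "-1" 0 "sqrt A"] by simp_all
  have \<eta>1: "\<eta> \<le> 1" using \<eta> sin_le_one[of "1 / 2 * arcsin (sqrt A)"] by linarith
  have \<beta>: "0 \<le> \<beta>" "sin \<beta> = \<eta>"
    unfolding \<beta>_def using \<eta>_nonneg \<eta>1 arcsin_nonneg[of \<eta>] by auto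
  \<comment> \<open>Keeps a - \<beta> between 0 and \<pi>/2, so that sine and arcsine may be
    exchanged below.\<close>
  have "\<beta> < a / 2"
  proof -
    have "\<beta> < arcsin (sin (a / 2))"
      unfolding \<beta>_def using \<eta> \<eta>_nonneg \<eta>1
      by (intro arcsin_less_arcsin) (auto simp: a_def)
    also have "\<dots> = a / 2" using a by (intro arcsin_sin) auto
    finally show ?thesis .
  qed
  have "norm (\<phi> y - P (\<phi> y)) < sin (a - \<beta>)"
  proof (rule power2_less_imp_less)
    show "(norm (\<phi> y - P (\<phi> y)))\<^sup>2 < (sin (a - \<beta>))\<^sup>2"
      using acc by (simp add: Q_eq a_def \<beta>_def)
    show "0 \<le> sin (a - \<beta>)" using a \<beta> \<open>\<beta> < a / 2\<close> by (intro sin_ge_zero) auto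
  qed
  then have "\<alpha> < arcsin (sin (a - \<beta>))"
    unfolding \<alpha>_def by (intro arcsin_less_arcsin) (auto intro: order_trans[OF _ norm_ge_zero])
  also have "\<dots> = a - \<beta>" using a \<beta> \<open>\<beta> < a / 2\<close> by (intro arcsin_sin) auto
  finally have \<alpha>\<beta>: "\<alpha> + \<beta> < a" by simp
  have n1: "norm (\<phi> y - P (\<phi> y)) \<le> 1"
    by (rule power2_le_imp_le) (simp_all add: norm_orth_proj_complement[OF U])
  have \<alpha>: "0 \<le> \<alpha>" "norm (\<phi> y - P (\<phi> y)) \<le> sin \<alpha>"
    unfolding \<alpha>_def using n1 arcsin_nonneg[of "norm (\<phi> y - P (\<phi> y))"]
    by (auto simp: arcsin_sin order_trans[OF _ norm_ge_zero])
  have "norm (\<phi> y - orth_proj V (\<phi> y)) \<le> sin (\<alpha> + \<beta>)"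
    using \<alpha> \<beta> \<alpha>\<beta> a by (intro orth_proj_angle[OF U V _ close]) auto
  also have "\<dots> < sin a"
    using \<alpha> \<beta> \<alpha>\<beta> a by (intro sin_monotone_2pi) auto
  finally show False using big a by simp
qed

end

section \<open>Gradient descent and clustering\<close>

text \<open>Two balls are used: the closed one of radius \<open>e\<close> is mapped into itself and
  carries the fixed point, while trajectories start in the open ball of radius \<rho>, which is
  preserved because e < \<rho>.\<close>

lemma contraction_iterates:
  fixes F :: "'a::euclidean_space \<Rightarrow> 'a"
  assumes e: "0 \<le> e" "e < \<rho>" and r: "0 \<le> r" "r < 1"
    and lip: "\<And>y z. y \<in> ball x \<rho> \<Longrightarrow> z \<in> ball x \<rho> \<Longrightarrow> dist (F y) (F z) \<le> r * dist y z"
    and center: "dist (F x) x \<le> (1 - r) * e"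
  obtains p where "p \<in> cball x e" "F p = p"
    "\<And>g n. g \<in> ball x \<rho> \<Longrightarrow> (F ^^ n) g \<in> ball x \<rho>"
    "\<And>g n. g \<in> ball x \<rho> \<Longrightarrow> dist ((F ^^ n) g) p \<le> r ^ n * dist g p"
proof -
  have x: "x \<in> ball x \<rho>" using e by simp
  have move: "dist x (F z) \<le> (1 - r) * e + r * dist x z" if "z \<in> ball x \<rho>" for z
    using dist_triangle[of x "F z" "F x"] lip[OF x that] center by (simp add: dist_commute)
  have "\<exists>!p. p \<in> cball x e \<and> F p = p"
  proof (rule Banach_fix[OF _ _ r])
    show "F ` cball x e \<subseteq> cball x e"
    proof clarify
      fix z assume z: "z \<in> cball x e"
      then have "dist x (F z) \<le> (1 - r) * e + r * dist x z" using e by (intro move) auto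
      also have "\<dots> \<le> (1 - r) * e + r * e" using z r by (intro add_left_mono mult_left_mono) auto
      also have "\<dots> = e" by (simp add: algebra_simps)
      finally show "F z \<in> cball x e" by simp
    qed
    show "dist (F y) (F z) \<le> r * dist y z" if "y \<in> cball x e" "z \<in> cball x e" for y z
      using that e by (intro lip) auto
  qed (use e in \<open>auto intro: compact_imp_complete\<close>)
  then obtain p where p: "p \<in> cball x e" "F p = p" by blast
  have pb: "p \<in> ball x \<rho>" using p(1) e by auto
  have stay: "(F ^^ n) g \<in> ball x \<rho>" if g: "g \<in> ball x \<rho>" for g n
  proof (induction n)
    case 0
    show ?case using g by simp
  next
    case (Suc n)
    have "dist x (F ((F ^^ n) g)) \<le> (1 - r) * e + r * dist x ((F ^^ n) g)"
      by (rule move[OF Suc.IH])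
    also have "\<dots> \<le> (1 - r) * e + r * \<rho>"
      using Suc.IH r by (intro add_left_mono mult_left_mono) auto
    also have "\<dots> < (1 - r) * \<rho> + r * \<rho>" using e r by simp
    also have "\<dots> = \<rho>" by (simp add: algebra_simps)
    finally show ?case by simp
  qed
  have "dist ((F ^^ n) g) p \<le> r ^ n * dist g p" if g: "g \<in> ball x \<rho>" for g n
  proof (induction n)
    case (Suc n)
    have "dist (F ((F ^^ n) g)) (F p) \<le> r * dist ((F ^^ n) g) p"
      by (rule lip[OF stay[OF g] pb])
    also have "\<dots> \<le> r * (r ^ n * dist g p)" by (intro mult_left_mono Suc.IH r)
    finally show ?case by (simp add: p(2) mult.assoc)
  qed simp
  then show ?thesis using that p stay by blast
qed

text \<open>The step fixes \<open>p\<close>, so its Lipschitz bound between y = p + t w and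
  \<open>p\<close> gives h (w . g y) \<ge> (1 - r) t |w|^2 > 0. Thus \<open>q\<close> increases
  along every segment leaving \<open>p\<close>.\<close>

lemma descent_map_unique_min:
  fixes q :: "'a::euclidean_space \<Rightarrow> real"
  assumes q: "\<And>z. (q has_derivative (\<lambda>v. inner v (g z))) (at z)" and h: "h > 0"
    and r: "r < 1"
    and lip: "\<And>y z. y \<in> ball x \<rho> \<Longrightarrow> z \<in> ball x \<rho> \<Longrightarrow>
      dist (y - h *\<^sub>R g y) (z - h *\<^sub>R g z) \<le> r * dist y z"
    and p: "p \<in> ball x \<rho>" "g p = 0"
  shows "is_arg_min q (\<lambda>w. w \<in> ball x \<rho>) z \<longleftrightarrow> z = p"
proof -
  have less: "q p < q z" if z: "z \<in> ball x \<rho>" "z \<noteq> p" for z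
  proof -
    define w where "w = z - p"
    have w: "norm w > 0" using z by (simp add: w_def)
    have der: "((\<lambda>t. q (p + t *\<^sub>R w)) has_real_derivative inner w (g (p + t *\<^sub>R w))) (at t)" for t
    proof -
      have l: "((\<lambda>t. p + t *\<^sub>R w) has_derivative (\<lambda>s. s *\<^sub>R w)) (at t)"
        by (auto intro!: derivative_eq_intros)
      show ?thesis
        using has_derivative_compose[OF l q]
        by (simp add: has_field_derivative_def mult.commute[of _ "inner w _"] mult_commute_abs)
    qed
    have "\<exists>t. 0 < t \<and> t < 1 \<and> q (p + 1 *\<^sub>R w) - q (p + 0 *\<^sub>R w) = (1 - 0) * inner w (g (p + t *\<^sub>R w))"
      by (rule MVT2) (auto intro: der)
    then obtain t where t: "0 < t" "t < 1" and eq: "q z - q p = inner w (g (p + t *\<^sub>R w))"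
      by (auto simp: w_def)
    let ?y = "p + t *\<^sub>R w"
    have "?y = (1 - t) *\<^sub>R p + t *\<^sub>R z" by (simp add: w_def algebra_simps)
    also have "\<dots> \<in> ball x \<rho>" using t p z by (intro convexD convex_ball) auto
    finally have yb: "?y \<in> ball x \<rho>" .
    have "norm (t *\<^sub>R w - h *\<^sub>R g ?y) \<le> r * norm (t *\<^sub>R w)"
      using lip[OF yb p(1)] p(2) by (simp add: dist_norm algebra_simps)
    then have "norm (t *\<^sub>R w - h *\<^sub>R g ?y) \<le> r * (t * norm w)"
      using t by simp
    then have "inner w (t *\<^sub>R w - h *\<^sub>R g ?y) \<le> norm w * (r * (t * norm w))"
      using norm_cauchy_schwarz[of w "t *\<^sub>R w - h *\<^sub>R g ?y"]
      by (meson mult_left_mono norm_ge_zero order_trans)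
    then have "t * (norm w)\<^sup>2 - h * inner w (g ?y) \<le> r * (t * (norm w)\<^sup>2)"
      by (simp add: inner_diff_right power2_norm_eq_inner[symmetric] power2_eq_square mult_ac)
    moreover have "0 < (1 - r) * (t * (norm w)\<^sup>2)" using r t w by simp
    ultimately have "0 < h * inner w (g ?y)" by (simp add: algebra_simps)
    then show ?thesis using eq h by (simp add: zero_less_mult_iff)
  qed
  show ?thesis
    unfolding is_arg_min_def using less p(1) by (metis less_asym)
qed

text \<open>Points of one group are joined directly and points of different groups never, so a path
  cannot leave its group.\<close>

lemma clusters_eq:
  assumes E: "E = (\<Union>x\<in>X. C x)" and ne: "\<And>x. x \<in> X \<Longrightarrow> C x \<noteq> {}"
    and near: "\<And>x a b. x \<in> X \<Longrightarrow> a \<in> C x \<Longrightarrow> b \<in> C x \<Longrightarrow> dist a b < r"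
    and far: "\<And>x y a b. x \<in> X \<Longrightarrow> y \<in> X \<Longrightarrow> x \<noteq> y \<Longrightarrow> a \<in> C x \<Longrightarrow> b \<in> C y \<Longrightarrow> r \<le> dist a b"
  shows "clusters r E = C ` X"
proof -
  let ?R = "{(a, b). a \<in> E \<and> b \<in> E \<and> dist a b < r}"
  have comp: "?R\<^sup>* `` {a} = C x" if x: "x \<in> X" and a: "a \<in> C x" for x a
  proof
    show "C x \<subseteq> ?R\<^sup>* `` {a}"
      using x a near[OF x a] by (auto simp: E intro!: r_into_rtrancl)
    have "b \<in> C x" if "(a, b) \<in> ?R\<^sup>*" for b
      using that
    proof (induction rule: rtrancl_induct)
      case base
      show ?case by (rule a)
    next
      case (step b c)
      then obtain y where y: "y \<in> X" "c \<in> C y" by (auto simp: E)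
      show ?case
        using far[OF x y(1) _ step.IH y(2)] step.hyps(2) y(2) by (cases "x = y") auto
    qed
    then show "?R\<^sup>* `` {a} \<subseteq> C x" by auto
  qed
  show ?thesis
  proof
    show "clusters r E \<subseteq> C ` X"
      unfolding clusters_def
    proof
      fix D assume "D \<in> E // ?R\<^sup>*"
      then obtain a where "a \<in> E" "D = ?R\<^sup>* `` {a}" by (rule quotientE)
      then show "D \<in> C ` X" using comp by (auto simp: E)
    qed
    show "C ` X \<subseteq> clusters r E"
    proof
      fix D assume "D \<in> C ` X"
      then obtain x where x: "x \<in> X" "D = C x" by blast
      obtain a where a: "a \<in> C x" using ne[OF x(1)] by blast
      have "a \<in> E" using x(1) a by (auto simp: E)
      then show "D \<in> clusters r E"
        unfolding clusters_def x(2) comp[OF x(1) a, symmetric] by (rule quotientI)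
    qed
  qed
qed

text \<open>The inverse of \<open>f\<close> is a competing bijection. \<open>Min\<close> is below
  its value only for a finite set of candidates, which holds since every candidate is one of
  finitely many distances.\<close>

lemma d_match_image_le:
  assumes X: "finite X" "X \<noteq> {}" and inj: "inj_on f X" and le: "\<And>x. x \<in> X \<Longrightarrow> dist (f x) x \<le> e"
  shows "d_match (f ` X) X \<le> e"
proof -
  let ?S = "{Max ((\<lambda>x. dist x (\<pi> x)) ` (f ` X)) | \<pi>. bij_betw \<pi> (f ` X) X}"
  let ?g = "inv_into X f"
  have sub: "?S \<subseteq> (\<lambda>(a, b). dist a b) ` (f ` X \<times> X)"
  proof
    fix m assume "m \<in> ?S"
    then obtain \<pi> where \<pi>: "bij_betw \<pi> (f ` X) X" "m = Max ((\<lambda>x. dist x (\<pi> x)) ` (f ` X))" by blast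
    have "m \<in> (\<lambda>x. dist x (\<pi> x)) ` (f ` X)"
      unfolding \<pi>(2) using X by (intro Max_in) auto
    then obtain a where a: "a \<in> f ` X" "m = dist a (\<pi> a)" by blast
    have "\<pi> a \<in> X" using \<pi>(1) a(1) by (auto simp: bij_betw_def)
    then show "m \<in> (\<lambda>(a, b). dist a b) ` (f ` X \<times> X)" using a by auto
  qed
  have fin: "finite ?S" by (rule finite_subset[OF sub]) (use X in auto)
  have "Max ((\<lambda>x. dist x (?g x)) ` (f ` X)) \<in> ?S"
    using inj by (auto intro!: exI[of _ ?g] bij_betw_inv_into inj_on_imp_bij_betw)
  then have "d_match (f ` X) X \<le> Max ((\<lambda>x. dist x (?g x)) ` (f ` X))"
    unfolding d_match_def by (intro Min_le fin)
  also have "\<dots> \<le> e"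
    using X le inj by (subst Max_le_iff) (auto simp: inv_into_f_f)
  finally show ?thesis .
qed

lemma
  assumes "finite X" "card X \<ge> 2"
  shows min_sep_le: "\<And>x y. x \<in> X \<Longrightarrow> y \<in> X \<Longrightarrow> x \<noteq> y \<Longrightarrow> min_sep X \<le> dist x y"
    and min_sep_pos: "0 < min_sep X"
proof -
  let ?S = "{dist x y | x y. x \<in> X \<and> y \<in> X \<and> x \<noteq> y}"
  have fin: "finite ?S"
    by (rule finite_subset[of _ "(\<lambda>(a, b). dist a b) ` (X \<times> X)"]) (use assms in auto)
  have "\<exists>x\<in>X. \<exists>y\<in>X. x \<noteq> y"
    using assms by (metis One_nat_def card_le_Suc0_iff_eq not_less_eq_eq numeral_2_eq_2)
  then have ne: "?S \<noteq> {}" by blast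
  show "min_sep X \<le> dist x y" if "x \<in> X" "y \<in> X" "x \<noteq> y" for x y
    unfolding min_sep_def using that by (intro Min_le fin) blast
  show "0 < min_sep X"
    unfolding min_sep_def using Min_in[OF fin ne] by auto
qed

lemma gradient_eqI:
  assumes "(f has_derivative (\<lambda>v. inner v D)) (at z)"
  shows "gradient f z = D"
  unfolding gradient_def
proof (rule the_equality)
  show "GDERIV f z :> D" using assms by (simp add: gderiv_def)
  fix D' assume "GDERIV f z :> D'"
  then have "(\<lambda>v. inner v D') = (\<lambda>v. inner v D)"
    using has_derivative_unique[OF _ assms] by (simp add: gderiv_def)
  then have "inner (D' - D) D' = inner (D' - D) D" by meson
  then have "inner (D' - D) (D' - D) = 0" by (simp add: inner_diff_right)
  then show "D' = D" by simp
qed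

text \<open>Indexing the minimizers by the centres as \<open>xt x\<close> ties wells, limits and
  matching together; the equivalence with \<open>is_arg_min\<close> states existence and uniqueness
  at once, and \<open>rep\<close> ranges over all choices of representatives.\<close>

theorem theorem6p1:
  fixes \<kappa> \<rho> \<gamma> \<mu> \<nu> \<eta> \<delta>star \<Delta>star Astar cplus cminus \<epsilon>star \<tau>star hstar rstar rcl :: real
    and s N :: nat
    and X G Gstar :: "(real ^ 3) set"
    and U :: "sphere_L2 set"
    and q :: "real ^ 3 \<Rightarrow> real"
    and traj :: "real ^ 3 \<Rightarrow> nat \<Rightarrow> real ^ 3"
  assumes "\<kappa> > 0" and "s \<ge> 2"
    and "finite X" and "card X = s"
    and "\<rho> > 0" and "(\<Union>x\<in>X. cball x \<rho>) \<subseteq> ball 0 1" and "\<rho> \<le> min_sep X / 2"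
    and "\<gamma> = \<kappa> * \<rho>"
    and "\<mu> = mu_const \<kappa> s (min_sep X)" and "\<mu> < 1"
    and "\<nu> = nu_const s \<mu>"
    and "L2.subspace U" and "L2.dim U = s"
    and "q = q_fun \<kappa> U"
    and "onorm (\<lambda>f. orth_proj U f - orth_proj (wave_span \<kappa> X) f) \<le> \<eta>"
    and "0 < \<delta>star" and "\<delta>star \<le> min_sep X"
    and "C2_const \<gamma> \<mu> \<nu> + (2 / sqrt 5 + 2 / 3) * \<eta> \<le> \<Delta>star" and "\<Delta>star < 2 / 3"
    and "0 < Astar" and "Astar \<le> A_const \<gamma> \<mu> \<nu>"
    and "cplus = 2 / 3 + \<Delta>star" and "cminus = 2 / 3 - \<Delta>star"
    and "\<epsilon>star = 2 * \<eta> / (sqrt 3 * cminus * \<kappa>)"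
    and "\<eta> < sqrt 3 / 2 * \<gamma> * cminus"
    and "\<eta> < sin (1 / 2 * arcsin (sqrt Astar))"
    and "\<tau>star = (sin (arcsin (sqrt Astar) - arcsin \<eta>))\<^sup>2"
    and "hstar = 3 / (2 * \<kappa>\<^sup>2)" and "rstar = 3 / 2 * \<Delta>star"
    and "finite G" and "G \<noteq> {}" and "G \<subseteq> ball 0 1"
    and "(SUP z\<in>ball 0 1. Min ((\<lambda>g. dist z g) ` G))
           < min (\<rho> - \<epsilon>star) (sqrt 3 / (2 * \<kappa>) * (\<tau>star - \<eta>\<^sup>2))"
    and "8 * \<rho> * rstar ^ N < \<delta>star - 2 * \<epsilon>star"
    and "4 * \<rho> * rstar ^ N < rcl" and "rcl < \<delta>star - 2 * \<epsilon>star - 4 * \<rho> * rstar ^ N"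
    and "Gstar = {g \<in> G. q g < \<tau>star}"
    and "traj = gd_iter hstar q"
  shows "\<exists>xt :: real ^ 3 \<Rightarrow> real ^ 3.
      (\<forall>x\<in>X. \<forall>z. is_arg_min q (\<lambda>w. w \<in> ball x \<rho>) z \<longleftrightarrow> z = xt x) \<and>
      Gstar \<subseteq> (\<Union>x\<in>X. ball x \<rho>) \<and>
      (\<forall>x\<in>X. Gstar \<inter> ball x \<rho> \<noteq> {}) \<and>
      (\<forall>g\<in>Gstar. \<exists>x\<in>X. (\<forall>n. traj g n \<in> ball x \<rho>) \<and> traj g \<longlonglongrightarrow> xt x) \<and>
      {l. \<exists>g\<in>Gstar. traj g \<longlonglongrightarrow> l} = xt ` X \<and>
      card (xt ` X) = s \<and>
      d_match (xt ` X) X \<le> \<epsilon>star \<and>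
      (\<forall>x\<in>X. \<forall>g\<in>Gstar \<inter> ball x \<rho>. dist (traj g N) (xt x) \<le> 2 * \<rho> * rstar ^ N) \<and>
      (\<forall>rep. (\<forall>C\<in>clusters rcl ((\<lambda>g. traj g N) ` Gstar). rep C \<in> C) \<longrightarrow>
         (let Xhat = rep ` clusters rcl ((\<lambda>g. traj g N) ` Gstar)
          in card Xhat = s \<and> d_match Xhat X \<le> \<epsilon>star + 2 * \<rho> * rstar ^ N))"
proof -
  define \<delta> where "\<delta> = min_sep X"
  have \<kappa>: "\<kappa> > 0" and finX: "finite X" and cardX: "card X = s" "card X \<ge> 2" and \<rho>: "\<rho> > 0" "\<rho> \<le> \<delta> / 2"
    using assms(1-7) by (auto simp: \<delta>_def)
  have Xne: "X \<noteq> {}" using cardX by auto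
  have \<delta>: "\<delta> > 0" "\<And>x y. x \<in> X \<Longrightarrow> y \<in> X \<Longrightarrow> x \<noteq> y \<Longrightarrow> \<delta> \<le> dist x y"
    unfolding \<delta>_def using min_sep_pos[OF finX cardX(2)] min_sep_le[OF finX cardX(2)] by auto
  have Xball: "X \<subseteq> ball 0 1"
  proof
    fix x assume x: "x \<in> X"
    then have "x \<in> (\<Union>x\<in>X. cball x \<rho>)" using \<rho> by (intro UN_I[OF x]) simp
    then show "x \<in> ball 0 1" using assms(6) by blast
  qed

  \<comment> \<open>Rescaling by the wave number\<close>
  define Y where "Y = (\<lambda>x. \<kappa> *\<^sub>R x) ` X"
  have injY: "inj_on (\<lambda>x. \<kappa> *\<^sub>R x) X" using \<kappa> by (auto intro: inj_onI)
  have cardY: "card Y = s" unfolding Y_def card_image[OF injY] by (rule cardX)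
  have distY: "dist (\<kappa> *\<^sub>R x) (\<kappa> *\<^sub>R y) = \<kappa> * dist x y" for x y :: "real ^ 3"
    using \<kappa> by (simp add: dist_norm scaleR_diff_right[symmetric])
  have span_eq: "L2.span (wave one_fun ` Y) = wave_span \<kappa> X"
    by (simp add: wave_span_def Y_def image_image plane_wave_eq)
  have fdU: "fin_dim U" using fin_dim_dim assms by auto
  have fdX: "fin_dim (wave_span \<kappa> X)" by (rule fin_dim_wave_span[OF finX])
  have close: "norm (orth_proj U g - orth_proj (wave_span \<kappa> X) g) \<le> \<eta> * norm g" for g
  proof -
    have "bounded_linear (\<lambda>f. orth_proj U f - orth_proj (wave_span \<kappa> X) f)"
      by (intro bounded_linear_sub bounded_linear_orth_proj fdU fdX)
    from onorm[OF this, of g] show ?thesis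
      using mult_right_mono[OF assms(15), of "norm g"] by simp
  qed
  interpret wave_perturbed Y "\<kappa> * \<delta>" \<gamma> \<mu> \<nu> U \<eta>
  proof
    show "finite Y" "Y \<noteq> {}" using finX Xne by (auto simp: Y_def)
    show "0 < \<kappa> * \<delta>" using \<kappa> \<delta> by simp
    show "\<kappa> * \<delta> \<le> dist x y" if xy: "x \<in> Y" "y \<in> Y" "x \<noteq> y" for x y
    proof -
      obtain a b where "a \<in> X" "b \<in> X" "x = \<kappa> *\<^sub>R a" "y = \<kappa> *\<^sub>R b" "a \<noteq> b"
        using xy by (auto simp: Y_def)
      then show ?thesis using \<delta>(2)[of a b] \<kappa> by (simp add: distY)
    qed
    show "0 < \<gamma>" "\<gamma> \<le> \<kappa> * \<delta> / 2" using \<kappa> \<rho> assms(8) by auto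
    show "\<mu> = 9 / 2 * (real (card Y) powr (2 / 3) / (\<kappa> * \<delta>))"
      using assms(9) by (simp add: mu_const_def cardY \<delta>_def)
    show "\<mu> < 1" "\<nu> = nu_const (card Y) \<mu>" using assms by (auto simp: cardY)
    show "fin_dim U" by (rule fdU)
    show "norm (orth_proj U g - orth_proj (L2.span (wave one_fun ` Y)) g) \<le> \<eta> * norm g" for g
      unfolding span_eq by (rule close)
  qed
  have q_eq: "q = (\<lambda>z. Q (\<kappa> *\<^sub>R z))"
    by (simp add: assms(14) q_fun_def Q_def plane_wave_eq fun_eq_iff)
  define g where "g = (\<lambda>z. \<kappa> *\<^sub>R gradQ (\<kappa> *\<^sub>R z))"
  have q_der: "(q has_derivative (\<lambda>v. inner v (g z))) (at z)" for z
  proof -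
    have "((\<lambda>z. \<kappa> *\<^sub>R z) has_derivative (\<lambda>v. \<kappa> *\<^sub>R v)) (at z)"
      by (auto intro!: derivative_eq_intros)
    from has_derivative_compose[OF this has_derivative_Q] show ?thesis
      by (simp add: q_eq g_def inner_gradQ linear_scale[OF linear_dQ])
  qed
  have grad: "gradient q z = g z" for z by (rule gradient_eqI[OF q_der])
  define F where "F = (\<lambda>z. z - hstar *\<^sub>R g z)"
  have traj: "traj z n = (F ^^ n) z" for z n
    by (simp add: assms(38) gd_iter_def F_def grad)

  \<comment> \<open>The gradient step as a contraction in each well\<close>
  have \<eta>0: "0 \<le> \<eta>" by (rule \<eta>_nonneg)
  have \<Delta>star: "0 \<le> \<Delta>star" "\<Delta> \<le> \<Delta>star" "\<Delta>star < 2 / 3" using \<Delta>_nonneg assms(18,19) by auto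
  have r: "0 \<le> rstar" "rstar < 1" using \<Delta>star assms(29) by auto
  have cm: "cminus > 0" using \<Delta>star assms(23) by simp
  have h: "hstar > 0" using \<kappa> assms(28) by simp
  have e0: "0 \<le> \<epsilon>star" using \<eta>0 cm \<kappa> assms(24) by simp
  have "\<eta> / (sqrt 3 / 2 * cminus * \<kappa>) < \<rho>"
    using assms(25) cm \<kappa> by (simp add: assms(8) pos_divide_less_eq mult_ac)
  then have e\<rho>: "\<epsilon>star < \<rho>" unfolding assms(24) by (simp add: field_simps)
  have lip: "dist (F y) (F z) \<le> rstar * dist y z" if x: "x \<in> X" and y: "y \<in> ball x \<rho>" and z: "z \<in> ball x \<rho>" for x y z
  proof -
    have b: "\<kappa> *\<^sub>R w \<in> ball (\<kappa> *\<^sub>R x) \<gamma>" if "w \<in> ball x \<rho>" for w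
      using that \<kappa> by (simp add: distY assms(8))
    let ?W = "\<kappa> *\<^sub>R y - \<kappa> *\<^sub>R z"
    let ?D = "gradQ (\<kappa> *\<^sub>R y) - gradQ (\<kappa> *\<^sub>R z) - (2 / 3) *\<^sub>R ?W"
    have "norm ?D \<le> \<Delta> * norm ?W"
      by (rule gradQ_contraction[of "\<kappa> *\<^sub>R x"]) (use x y z b in \<open>auto simp: Y_def\<close>)
    also have "\<dots> \<le> \<Delta>star * norm ?W" by (intro mult_right_mono \<Delta>star) simp
    also have "norm ?W = \<kappa> * dist y z" using distY[of y z] by (simp add: dist_norm)
    finally have D: "norm ?D \<le> \<Delta>star * (\<kappa> * dist y z)" .
    \<comment> \<open>The step size is the inverse of (2/3) \<kappa>^2, with one \<kappa> from the
      chain rule in \<open>g\<close> and one from the rescaled points; so the identity part of the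
      step cancels exactly and only \<open>?D\<close> survives.\<close>
    have "(hstar * \<kappa>) *\<^sub>R ((2 / 3) *\<^sub>R ?W) = y - z"
      using \<kappa> by (simp add: assms(28) scaleR_diff_right[symmetric] power2_eq_square)
    then have "F y - F z = - ((hstar * \<kappa>) *\<^sub>R ?D)"
      by (simp add: F_def g_def scaleR_diff_right)
    then have "dist (F y) (F z) = hstar * \<kappa> * norm ?D"
      using h \<kappa> by (simp add: dist_norm abs_mult)
    also have "\<dots> \<le> hstar * \<kappa> * (\<Delta>star * (\<kappa> * dist y z))"
      using h \<kappa> by (intro mult_left_mono D) auto
    also have "\<dots> = rstar * dist y z"
      using \<kappa> by (simp add: assms(28,29) power2_eq_square)
    finally show ?thesis .
  qed
  have center: "dist (F x) x \<le> (1 - rstar) * \<epsilon>star" if x: "x \<in> X" for x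
  proof -
    have "dist (F x) x = hstar * \<kappa> * norm (gradQ (\<kappa> *\<^sub>R x))"
      using h \<kappa> by (simp add: F_def g_def dist_norm abs_mult)
    also have "\<dots> \<le> hstar * \<kappa> * (2 * \<eta> / sqrt 3)"
      using h \<kappa> x by (intro mult_left_mono norm_gradQ_center) (auto simp: Y_def)
    \<comment> \<open>This equation determines \<epsilon>: the first step from the centre is at most
      1 - r times \<epsilon>.\<close>
    also have "\<dots> = 3 / 2 * cminus * \<epsilon>star"
      using cm \<kappa> by (simp add: assms(24,28) field_simps power2_eq_square)
    also have "3 / 2 * cminus = 1 - rstar" by (simp add: assms(23,29))
    finally show ?thesis .
  qed
  have "\<exists>p. p \<in> cball x \<epsilon>star \<and> F p = p \<and>
      (\<forall>z\<in>ball x \<rho>. \<forall>n. (F ^^ n) z \<in> ball x \<rho> \<and> dist ((F ^^ n) z) p \<le> rstar ^ n * dist z p)"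
    if x: "x \<in> X" for x
    by (rule contraction_iterates[OF e0 e\<rho> r lip[OF x] center[OF x]]) auto
  then obtain xt where xt: "\<And>x. x \<in> X \<Longrightarrow> xt x \<in> cball x \<epsilon>star" "\<And>x. x \<in> X \<Longrightarrow> F (xt x) = xt x"
    and stay: "\<And>x z n. x \<in> X \<Longrightarrow> z \<in> ball x \<rho> \<Longrightarrow> (F ^^ n) z \<in> ball x \<rho>"
    and conv: "\<And>x z n. x \<in> X \<Longrightarrow> z \<in> ball x \<rho> \<Longrightarrow> dist ((F ^^ n) z) (xt x) \<le> rstar ^ n * dist z (xt x)"
    by metis
  have xtb: "xt x \<in> ball x \<rho>" if "x \<in> X" for x using xt(1)[OF that] e\<rho> by simp
  have xte: "dist (xt x) x \<le> \<epsilon>star" if "x \<in> X" for x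
    using xt(1)[OF that] by (simp add: dist_commute)
  have wells: "x = y" if "x \<in> X" "y \<in> X" "z \<in> ball x \<rho>" "z \<in> ball y \<rho>" for x y z
    using \<delta>(2)[of x y] that \<rho> dist_triangle2[of x y z] by (force simp: dist_commute)
  have inj: "inj_on xt X"
    using wells xtb by (metis inj_onI)
  have bound: "dist ((F ^^ n) z) (xt x) \<le> 2 * \<rho> * rstar ^ n" if x: "x \<in> X" and z: "z \<in> ball x \<rho>" for x z n
  proof -
    have "dist z (xt x) \<le> 2 * \<rho>"
      using dist_triangle3[of z "xt x" x] z xtb[OF x] by simp
    then have "rstar ^ n * dist z (xt x) \<le> rstar ^ n * (2 * \<rho>)"
      using r by (intro mult_left_mono) auto
    then show ?thesis using conv[OF x z, of n] by (simp add: mult_ac)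
  qed
  have lim: "traj z \<longlonglongrightarrow> xt x" if x: "x \<in> X" and z: "z \<in> ball x \<rho>" for x z
  proof (rule metric_tendsto_imp_tendsto)
    show "(\<lambda>n. 2 * \<rho> * rstar ^ n) \<longlonglongrightarrow> 0"
      using r by (auto intro!: tendsto_eq_intros LIMSEQ_power_zero)
    show "\<forall>\<^sub>F n in sequentially. dist (traj z n) (xt x) \<le> dist (2 * \<rho> * rstar ^ n) 0"
      using bound[OF x z] \<rho> r by (simp add: traj)
  qed

  \<comment> \<open>Minimizers, acceptance and limits\<close>
  have c1: "\<forall>x\<in>X. \<forall>z. is_arg_min q (\<lambda>w. w \<in> ball x \<rho>) z \<longleftrightarrow> z = xt x"
  proof (intro ballI allI)
    fix x z assume x: "x \<in> X"
    have "g (xt x) = 0" using xt(2)[OF x] h by (simp add: F_def)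
    then show "is_arg_min q (\<lambda>w. w \<in> ball x \<rho>) z \<longleftrightarrow> z = xt x"
      using lip[OF x] unfolding F_def
      by (intro descent_map_unique_min[OF q_der h r(2) _ xtb[OF x]]) auto
  qed
  have c2: "Gstar \<subseteq> (\<Union>x\<in>X. ball x \<rho>)"
  proof
    fix z assume "z \<in> Gstar"
    then have "Q (\<kappa> *\<^sub>R z) < (sin (arcsin (sqrt Astar) - arcsin \<eta>))\<^sup>2"
      by (simp add: assms(37,27) q_eq)
    then obtain x where "x \<in> X" "dist (\<kappa> *\<^sub>R z) (\<kappa> *\<^sub>R x) < \<gamma>"
      using accepted_in_well[OF assms(20,21,26)] by (auto simp: Y_def)
    then show "z \<in> (\<Union>x\<in>X. ball x \<rho>)"
      using \<kappa> by (auto simp: distY assms(8) dist_commute)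
  qed
  have c3: "\<forall>x\<in>X. Gstar \<inter> ball x \<rho> \<noteq> {}"
  proof
    fix x assume x: "x \<in> X"
    \<comment> \<open>The grid point nearest to the centre is accepted: the first entry of the mesh
      bound keeps it in the well, the second keeps \<open>Q\<close> below \<tau> by the Lipschitz
      estimate, starting from at most \<eta>^2 at the centre.\<close>
    have "Min (dist x ` G) \<in> dist x ` G" using assms(30,31) by (intro Min_in) auto
    then obtain z where z: "z \<in> G" "Min (dist x ` G) = dist x z" by blast
    \<comment> \<open>Needed for the supremum to dominate the value at \<open>x\<close>; 2 is the
      diameter of the unit ball.\<close>
    have "bdd_above ((\<lambda>z. Min (dist z ` G)) ` ball 0 1)"
    proof (rule bdd_aboveI2)
      fix w :: "real ^ 3" assume w: "w \<in> ball 0 1"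
      have "Min (dist w ` G) \<le> dist w z" using assms(30) z by (intro Min_le) auto
      also have "\<dots> \<le> dist w 0 + dist 0 z" by (rule dist_triangle)
      also have "\<dots> \<le> 1 + 1"
        using w z(1) assms(32) by (intro add_mono) (auto simp: dist_commute less_imp_le)
      finally show "Min (dist w ` G) \<le> 1 + 1" .
    qed
    then have "dist x z \<le> (SUP z\<in>ball 0 1. Min (dist z ` G))"
      unfolding z(2)[symmetric] using x Xball by (intro cSUP_upper) auto
    then have d: "dist x z < \<rho> - \<epsilon>star" "dist x z < sqrt 3 / (2 * \<kappa>) * (\<tau>star - \<eta>\<^sup>2)"
      using assms(33) by auto
    have "Q (\<kappa> *\<^sub>R z) - Q (\<kappa> *\<^sub>R x) \<le> 2 / sqrt 3 * norm (\<kappa> *\<^sub>R z - \<kappa> *\<^sub>R x)" by (rule Q_lipschitz)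
    also have "norm (\<kappa> *\<^sub>R z - \<kappa> *\<^sub>R x) = \<kappa> * dist x z"
      using distY[of z x] by (simp add: dist_norm norm_minus_commute)
    also have "2 / sqrt 3 * (\<kappa> * dist x z) < 2 / sqrt 3 * (\<kappa> * (sqrt 3 / (2 * \<kappa>) * (\<tau>star - \<eta>\<^sup>2)))"
      using d(2) \<kappa> by (intro mult_strict_left_mono) auto
    also have "\<dots> = \<tau>star - \<eta>\<^sup>2" using \<kappa> by simp
    finally have "Q (\<kappa> *\<^sub>R z) - Q (\<kappa> *\<^sub>R x) < \<tau>star - \<eta>\<^sup>2" .
    moreover have "\<kappa> *\<^sub>R x \<in> Y" using x unfolding Y_def by (rule imageI)
    ultimately have "Q (\<kappa> *\<^sub>R z) < \<tau>star" using Q_center[of "\<kappa> *\<^sub>R x"] by linarith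
    then have "z \<in> Gstar" using z by (simp add: assms(37) q_eq)
    then show "Gstar \<inter> ball x \<rho> \<noteq> {}" using d(1) e0 by auto
  qed
  have c4: "\<forall>z\<in>Gstar. \<exists>x\<in>X. (\<forall>n. traj z n \<in> ball x \<rho>) \<and> traj z \<longlonglongrightarrow> xt x"
  proof
    fix z assume "z \<in> Gstar"
    then obtain x where x: "x \<in> X" "z \<in> ball x \<rho>" using c2 by blast
    have "\<forall>n. traj z n \<in> ball x \<rho>" unfolding traj using stay[OF x] by blast
    then show "\<exists>x\<in>X. (\<forall>n. traj z n \<in> ball x \<rho>) \<and> traj z \<longlonglongrightarrow> xt x"
      using x(1) lim[OF x] by blast
  qed
  have c5: "{l. \<exists>z\<in>Gstar. traj z \<longlonglongrightarrow> l} = xt ` X"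
  proof (intro equalityI subsetI)
    fix l assume "l \<in> {l. \<exists>z\<in>Gstar. traj z \<longlonglongrightarrow> l}"
    then obtain z where "z \<in> Gstar" "traj z \<longlonglongrightarrow> l" by blast
    then show "l \<in> xt ` X" using c4 LIMSEQ_unique by blast
  next
    fix l assume "l \<in> xt ` X"
    then obtain x where x: "x \<in> X" "l = xt x" by blast
    obtain z where "z \<in> Gstar" "z \<in> ball x \<rho>" using c3 x(1) by blast
    then show "l \<in> {l. \<exists>z\<in>Gstar. traj z \<longlonglongrightarrow> l}" using lim[OF x(1)] x(2) by blast
  qed
  have c6: "card (xt ` X) = s" using card_image[OF inj] cardX by simp
  have c7: "d_match (xt ` X) X \<le> \<epsilon>star"
    by (rule d_match_image_le[OF finX Xne inj xte])
  have c8: "\<forall>x\<in>X. \<forall>z\<in>Gstar \<inter> ball x \<rho>. dist (traj z N) (xt x) \<le> 2 * \<rho> * rstar ^ N"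
    using bound by (auto simp: traj simp del: mem_ball)

  \<comment> \<open>Clustering of the endpoints\<close>
  define E where "E = (\<lambda>x. (\<lambda>z. traj z N) ` (Gstar \<inter> ball x \<rho>))"
  have Exb: "dist a (xt x) \<le> 2 * \<rho> * rstar ^ N" if "x \<in> X" "a \<in> E x" for x a
    using c8 that by (auto simp: E_def)
  have Ex: "dist a x \<le> \<epsilon>star + 2 * \<rho> * rstar ^ N" if "x \<in> X" "a \<in> E x" for x a
    using Exb[OF that] xte[OF that(1)] dist_triangle[of a x "xt x"] by linarith
  \<comment> \<open>The centres are at least \<delta>star apart and each endpoint is within
    \<epsilon>star + 2 \<rho> rstar^N of its own, which leaves more than the upper limit imposed on
    \<open>rcl\<close>.\<close>
  have far: "rcl \<le> dist a b" if "x \<in> X" "y \<in> X" "x \<noteq> y" "a \<in> E x" "b \<in> E y" for x y a b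
    using Ex[OF that(1,4)] Ex[OF that(2,5)] \<delta>(2)[OF that(1-3)] assms(17,36)
      dist_triangle[of x y a] dist_triangle[of a y b]
    by (simp add: \<delta>_def dist_commute)
  have clus: "clusters rcl ((\<lambda>z. traj z N) ` Gstar) = E ` X"
  proof (rule clusters_eq)
    show "(\<lambda>z. traj z N) ` Gstar = (\<Union>x\<in>X. E x)"
      using c2 unfolding E_def by blast
    show "E x \<noteq> {}" if "x \<in> X" for x using c3 that by (auto simp: E_def simp del: mem_ball)
    \<comment> \<open>Twice the distance of an endpoint to the minimizer is 4 \<rho> rstar^N, the
      lower limit imposed on \<open>rcl\<close>.\<close>
    show "dist a b < rcl" if "x \<in> X" "a \<in> E x" "b \<in> E x" for x a b
      using Exb[OF that(1,2)] Exb[OF that(1,3)] dist_triangle2[of a b "xt x"] assms(35) by linarith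
  qed (rule far)
  have "0 \<le> 4 * \<rho> * rstar ^ N" using \<rho> r by simp
  then have rcl: "rcl > 0" using assms(35) by linarith
  have c9: "card (rep ` E ` X) = s \<and> d_match (rep ` E ` X) X \<le> \<epsilon>star + 2 * \<rho> * rstar ^ N"
    if rep: "\<forall>C\<in>E ` X. rep C \<in> C" for rep
  proof -
    have in_E: "rep (E x) \<in> E x" if "x \<in> X" for x using rep that by blast
    have injr: "inj_on (\<lambda>x. rep (E x)) X"
    proof (rule inj_onI, rule ccontr)
      fix x y assume xy: "x \<in> X" "y \<in> X" "rep (E x) = rep (E y)" "x \<noteq> y"
      \<comment> \<open>A common representative would have distance 0 to itself, below the positive
        \<open>rcl\<close>.\<close>
      then show False using far[OF xy(1,2,4) in_E[OF xy(1)] in_E[OF xy(2)]] rcl by simp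
    qed
    have "card ((\<lambda>x. rep (E x)) ` X) = s" using card_image[OF injr] cardX by simp
    moreover have "d_match ((\<lambda>x. rep (E x)) ` X) X \<le> \<epsilon>star + 2 * \<rho> * rstar ^ N"
      by (rule d_match_image_le[OF finX Xne injr]) (rule Ex, assumption, rule in_E)
    ultimately show ?thesis by (simp add: image_image)
  qed
  show ?thesis
    using c1 c2 c3 c4 c5 c6 c7 c8 c9 unfolding clus Let_def by (intro exI[of _ xt]) blast
qed

end
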